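(* Let $G$ be an infinite Abelian group such that $\exp G=\infty$. Then $G$ admits a non-discrete reflexive group topology, i.e. there exists a group topology $\tau$ on $G$ which is not discrete and for which the topological group $(G,\tau)$ is Pontryagin reflexive.
   Context: $\exp G$ denotes the least common multiple of the orders of the elements of $G$; $\exp G=\infty$ means that there is no integer $n\geq 1$ with $ng=0$ for all $g\in G$. For an Abelian topological group $G$, the character group $G^{\wedge}$ is the group of all continuous homomorphisms (characters) from $G$ into the torus $\mathbb{T}=\{z\in\mathbb{C}: |z|=1\}$, endowed with the compact-open topology. $G$ is called (Pontryagin) reflexive if the canonical homomorphism $\alpha_G: G\to G^{\wedge\wedge}$, $g\mapsto (\chi\mapsto (\chi,g))$, where $(\chi,g)=\chi(g)$, is a topological isomorphism (a group isomorphism that is a homeomorphism). *)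

theory Defs
  imports "HOL-Analysis.Analysis" "HOL-Algebra.Multiplicative_Group"
begin

(* The test for a common n comes first because Lcm on nat is 0 both for an infinite set
   and for a set containing 0, and ord is 0 at elements of infinite order. *)
definition group_exponent :: "('a, 'b) monoid_scheme \<Rightarrow> enat" where
  "group_exponent G =
     (if \<exists>n::nat. n \<ge> 1 \<and> (\<forall>g\<in>carrier G. g [^]\<^bsub>G\<^esub> n = \<one>\<^bsub>G\<^esub>)
      then enat (LCM g\<in>carrier G. group.ord G g) else \<infinity>)"

(* No separation axiom is included: the character group of any topological group is
   Hausdorff, so reflexivity below forces the topology to be Hausdorff. *)
definition group_topology :: "('a, 'b) monoid_scheme \<Rightarrow> 'a topology \<Rightarrow> bool" where
  "group_topology G T \<longleftrightarrow>
     group G \<and> topspace T = carrier G \<and>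
     continuous_map (prod_topology T T) T (\<lambda>(x, y). x \<otimes>\<^bsub>G\<^esub> y) \<and>
     continuous_map T T (\<lambda>x. inv\<^bsub>G\<^esub> x)"

definition torus_group :: "complex monoid" where
  "torus_group = \<lparr>carrier = {z. cmod z = 1}, mult = (*), one = 1\<rparr>"

definition torus_topology :: "complex topology" where
  "torus_topology = top_of_set {z. cmod z = 1}"

(* Characters are functions on the carrier only; extensionality makes each one
   a single HOL function. *)
definition characters :: "('a, 'b) monoid_scheme \<Rightarrow> 'a topology \<Rightarrow> ('a \<Rightarrow> complex) set" where
  "characters G T =
     {\<phi> \<in> extensional (carrier G). \<phi> \<in> hom G torus_group \<and> continuous_map T torus_topology \<phi>}"

definition dual_group :: "('a, 'b) monoid_scheme \<Rightarrow> 'a topology \<Rightarrow> ('a \<Rightarrow> complex) monoid" where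
  "dual_group G T =
     \<lparr>carrier = characters G T,
      mult = (\<lambda>\<phi> \<psi>. \<lambda>g\<in>carrier G. \<phi> g * \<psi> g),
      one = (\<lambda>g\<in>carrier G. 1)\<rparr>"

definition compact_open_topology ::
    "'a topology \<Rightarrow> 'b topology \<Rightarrow> ('a \<Rightarrow> 'b) set \<Rightarrow> ('a \<Rightarrow> 'b) topology" where
  "compact_open_topology X Y F =
     topology_generated_by {{f \<in> F. f ` K \<subseteq> U} | K U. compactin X K \<and> openin Y U}"

lemma topspace_compact_open_topology [simp]: "topspace (compact_open_topology X Y F) = F"
proof -
  have "F \<in> {{f \<in> F. f ` K \<subseteq> U} | K U. compactin X K \<and> openin Y U}"
    by (rule CollectI, rule exI[of _ "{}"], rule exI[of _ "{}"]) auto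
  then show ?thesis
    unfolding compact_open_topology_def topology_generated_by_topspace by blast
qed

definition dual_topology :: "('a, 'b) monoid_scheme \<Rightarrow> 'a topology \<Rightarrow> ('a \<Rightarrow> complex) topology" where
  "dual_topology G T = compact_open_topology T torus_topology (characters G T)"

abbreviation bidual_group ::
    "('a, 'b) monoid_scheme \<Rightarrow> 'a topology \<Rightarrow> (('a \<Rightarrow> complex) \<Rightarrow> complex) monoid" where
  "bidual_group G T \<equiv> dual_group (dual_group G T) (dual_topology G T)"

abbreviation bidual_topology ::
    "('a, 'b) monoid_scheme \<Rightarrow> 'a topology \<Rightarrow> (('a \<Rightarrow> complex) \<Rightarrow> complex) topology" where
  "bidual_topology G T \<equiv> dual_topology (dual_group G T) (dual_topology G T)"

definition canonical_map ::
    "('a, 'b) monoid_scheme \<Rightarrow> 'a topology \<Rightarrow> 'a \<Rightarrow> ('a \<Rightarrow> complex) \<Rightarrow> complex" where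
  "canonical_map G T g = (\<lambda>\<phi>\<in>characters G T. \<phi> g)"

definition pontryagin_reflexive :: "('a, 'b) monoid_scheme \<Rightarrow> 'a topology \<Rightarrow> bool" where
  "pontryagin_reflexive G T \<longleftrightarrow>
     canonical_map G T \<in> iso G (bidual_group G T) \<and>
     homeomorphic_map T (bidual_topology G T) (canonical_map G T)"

end

(* Choose a sequence g in G whose values can be prescribed almost arbitrarily by characters: for a
   finite set F, any sequence of unit complex numbers that starts with enough ones is, up to small
   errors tending to 0, the sequence of values on g of a character close to 1 on F.  If G has an
   element e of infinite order, powers of e with rapidly growing exponents do; otherwise let the
   order of g n modulo the earlier terms grow rapidly.

   Let S be the group of characters tending to 1 along g.  Give G the topology of uniform
   convergence on the sets of characters tending to 1 along g at a given rate.  Then g tends to the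
   identity, S is the dual of G, and the compact-open topologies on S and on its dual are the
   expected ones, so everything reduces to showing that a continuous homomorphism psi from S to
   the circle is the evaluation at a point of G.  A gliding hump argument shows that psi is
   pointwise continuous on some uniform ball of S.  Splitting a character into two halves by
   interpolating square roots of its values enlarges the ball, up to all of S.  Finally, a
   pointwise continuous psi different from all evaluations is refuted by averaging the product of
   psi and a positive trigonometric kernel concentrated near 1. *)

theory Submission
  imports Defs
begin

section \<open>Compact-open topologies into the circle\<close>

text \<open>The topology is the one that reflexivity dictates: a reflexive group carries the
  topology of uniform convergence on the compact subsets of its dual, and the characters tending to
  1 at a given rate turn out to form, up to inclusion, the compact subsets of S. The obstacle is
  that a homomorphism on S that is continuous for the compact-open topology is controlled by the
  values of a character at finitely many points and, uniformly, along the whole sequence, whereas an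
  evaluation is controlled by finitely many points alone. The freedom of interpolation removes the
  uniform part. It is also where the infinite exponent enters: on a group of exponent m all values
  of characters are m-th roots of unity. The balls grow by the factor 6/5, which is less than the
  square root of 2 gained by taking roots and so leaves room for the interpolation error. Duality of
  compact groups and Haar measure are replaced by averages over finite lists of characters; the
  algebraic input is the existence of characters, which rests on divisibility of the circle.\<close>

lemma topspace_torus_topology [simp]: "topspace torus_topology = {z. cmod z = 1}"
  by (simp add: torus_topology_def)

lemma continuous_map_torusD:
  "continuous_map X torus_topology f \<Longrightarrow> x \<in> topspace X \<Longrightarrow> cmod (f x) = 1"
  by (fastforce simp: continuous_map_def Pi_iff)

lemma continuous_map_torusI:
  assumes "\<And>x. x \<in> topspace X \<Longrightarrow> cmod (f x) = 1"
    and "\<And>x r. x \<in> topspace X \<Longrightarrow> r > 0 \<Longrightarrow>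
      \<exists>U. openin X U \<and> x \<in> U \<and> (\<forall>y\<in>U. cmod (f y - f x) < r)"
  shows "continuous_map X torus_topology f"
  unfolding continuous_map_def
proof (intro conjI allI impI)
  show "f \<in> topspace X \<rightarrow> topspace torus_topology"
    using assms(1) by auto
next
  fix V assume "openin torus_topology V"
  then obtain O' where O': "open O'" "V = {z. cmod z = 1} \<inter> O'"
    by (auto simp: torus_topology_def openin_open)
  show "openin X {x \<in> topspace X. f x \<in> V}"
  proof (subst openin_subopen, intro ballI)
    fix x assume x: "x \<in> {x \<in> topspace X. f x \<in> V}"
    then obtain r where r: "r > 0" "ball (f x) r \<subseteq> O'"
      using O' open_contains_ball by blast
    obtain U where U: "openin X U" "x \<in> U" "\<forall>y\<in>U. cmod (f y - f x) < r"
      using assms(2) x r(1) by blast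
    have "U \<subseteq> {x \<in> topspace X. f x \<in> V}"
    proof
      fix y assume y: "y \<in> U"
      then have yX: "y \<in> topspace X" using U(1) openin_subset by blast
      have "f y \<in> ball (f x) r" using U(3) y by (auto simp: dist_norm norm_minus_commute)
      with r(2) yX assms(1) O'(2) show "y \<in> {x \<in> topspace X. f x \<in> V}" by auto
    qed
    with U show "\<exists>T. openin X T \<and> x \<in> T \<and> T \<subseteq> {x \<in> topspace X. f x \<in> V}" by blast
  qed
qed

lemma openin_torus_ball:
  assumes "continuous_map X torus_topology f"
  shows "openin X {x \<in> topspace X. cmod (f x - z) < r}"
proof -
  have "openin torus_topology ({w. cmod w = 1} \<inter> ball z r)"
    unfolding torus_topology_def by (simp add: openin_open_Int)
  then have "openin X {x \<in> topspace X. f x \<in> {w. cmod w = 1} \<inter> ball z r}"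
    using assms unfolding continuous_map_def by (elim conjE allE impE)
  moreover have "{x \<in> topspace X. f x \<in> {w. cmod w = 1} \<inter> ball z r} = {x \<in> topspace X. cmod (f x - z) < r}"
    using continuous_map_torusD[OF assms] by (auto simp: dist_norm norm_minus_commute)
  ultimately show ?thesis by simp
qed

lemma closedin_torus_cball:
  assumes "continuous_map X torus_topology f"
  shows "closedin X {x \<in> topspace X. cmod (f x - z) \<le> r}"
proof -
  have "closedin torus_topology ({w. cmod w = 1} \<inter> cball z r)"
    unfolding torus_topology_def by (simp add: closedin_closed_Int)
  then have "closedin X {x \<in> topspace X. f x \<in> {w. cmod w = 1} \<inter> cball z r}"
    using assms closedin_continuous_map_preimage by blast
  moreover have "{x \<in> topspace X. f x \<in> {w. cmod w = 1} \<inter> cball z r} = {x \<in> topspace X. cmod (f x - z) \<le> r}"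
    using continuous_map_torusD[OF assms] by (auto simp: dist_norm norm_minus_commute)
  ultimately show ?thesis by simp
qed

text \<open>Induction over the generation of open sets; for a subbasic set the compact image of K
  keeps a positive distance from the complement of the open target. Together with the next lemma
  this identifies the compact-open topology as that of uniform convergence on compact sets, the form
  used later.\<close>

lemma compact_open_contains_uniform_nbhd:
  assumes F: "\<And>f. f \<in> F \<Longrightarrow> continuous_map X torus_topology f"
    and W: "openin (compact_open_topology X torus_topology F) W" and f: "f \<in> W"
  shows "\<exists>K r. compactin X K \<and> r > 0 \<and> (\<forall>g\<in>F. (\<forall>x\<in>K. cmod (g x - f x) < r) \<longrightarrow> g \<in> W)"
proof -
  have "generate_topology_on {{f \<in> F. f ` K \<subseteq> U} | K U. compactin X K \<and> openin torus_topology U} W"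
    using W unfolding compact_open_topology_def openin_topology_generated_by_iff .
  then show ?thesis using f
  proof induction
    case Empty
    then show ?case by simp
  next
    case (Int a b)
    from Int.IH(1) Int.prems obtain K r where
      1: "compactin X K" "r > 0" "\<forall>g\<in>F. (\<forall>x\<in>K. cmod (g x - f x) < r) \<longrightarrow> g \<in> a"
      by blast
    from Int.IH(2) Int.prems obtain K' r' where
      2: "compactin X K'" "r' > 0" "\<forall>g\<in>F. (\<forall>x\<in>K'. cmod (g x - f x) < r') \<longrightarrow> g \<in> b"
      by blast
    show ?case
    proof (intro exI conjI ballI impI)
      show "compactin X (K \<union> K')" by (rule compactin_Un[OF 1(1) 2(1)])
      show "min r r' > 0" using 1(2) 2(2) by simp
      fix g assume g: "g \<in> F" "\<forall>x\<in>K \<union> K'. cmod (g x - f x) < min r r'"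
      have "g \<in> a" using g by (intro 1(3)[rule_format]) auto
      moreover have "g \<in> b" using g by (intro 2(3)[rule_format]) auto
      ultimately show "g \<in> a \<inter> b" by blast
    qed
  next
    case (UN \<A>)
    then obtain A where A: "A \<in> \<A>" "f \<in> A" by blast
    obtain K r where "compactin X K" "r > 0" "\<forall>g\<in>F. (\<forall>x\<in>K. cmod (g x - f x) < r) \<longrightarrow> g \<in> A"
      using UN.IH[OF A] by blast
    then show ?case using A(1) by (intro exI[of _ K] exI[of _ r]) blast
  next
    case (Basis s)
    then obtain K U where s: "s = {f \<in> F. f ` K \<subseteq> U}" "compactin X K" "openin torus_topology U"
      by blast
    then obtain O' where O': "open O'" "U = {z. cmod z = 1} \<inter> O'"
      by (auto simp: torus_topology_def openin_open)
    have "continuous_map X torus_topology f" using Basis s F by blast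
    then have "compactin torus_topology (f ` K)"
      using s(2) image_compactin by blast
    then have "compact (f ` K)"
      by (simp add: torus_topology_def compactin_subtopology)
    moreover have "f ` K \<subseteq> O'" using Basis s O' by auto
    ultimately obtain r where r: "r > 0" "(\<Union>x\<in>f ` K. ball x r) \<subseteq> O'"
      using O'(1) compact_subset_open_imp_ball_epsilon_subset by metis
    have "g \<in> s" if g: "g \<in> F" "\<forall>x\<in>K. cmod (g x - f x) < r" for g
    proof -
      have "g x \<in> U" if x: "x \<in> K" for x
      proof -
        have "x \<in> topspace X" using s(2) x compactin_subset_topspace by blast
        then have "cmod (g x) = 1" by (rule continuous_map_torusD[OF F[OF g(1)]])
        moreover have "g x \<in> ball (f x) r"
          using bspec[OF g(2) x] by (simp add: dist_norm norm_minus_commute)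
        moreover have "ball (f x) r \<subseteq> O'" using r(2) x by (simp add: UN_subset_iff)
        ultimately show ?thesis unfolding O'(2) by (simp add: subset_iff)
      qed
      then show ?thesis using g s by auto
    qed
    then show ?case using s(2) r(1) by blast
  qed
qed

text \<open>K is cut into finitely many compact pieces \<open>C y\<close> on which f varies by at
  most r/3. Mapping each piece into the ball of radius r/2 about \<open>f y\<close> is a subbasic
  condition, and r/2 + r/3 < r. The sets \<open>V y\<close> are open counterparts of the pieces and
  give the finite cover.\<close>

lemma uniform_nbhd_contains_compact_open:
  assumes f: "f \<in> F" "continuous_map X torus_topology f" and K: "compactin X K" and r: "r > 0"
  shows "\<exists>W. openin (compact_open_topology X torus_topology F) W \<and> f \<in> W \<and>
    (\<forall>g\<in>W. \<forall>x\<in>K. cmod (g x - f x) < r)"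
proof -
  define C where "C y = K \<inter> {x \<in> topspace X. cmod (f x - f y) \<le> r / 3}" for y
  define V where "V y = {x \<in> topspace X. cmod (f x - f y) < r / 3}" for y
  define B where "B y = {w. cmod w = 1} \<inter> ball (f y) (r / 2)" for y
  have KX: "K \<subseteq> topspace X" using K compactin_subset_topspace by blast
  have C: "compactin X (C y)" for y
    unfolding C_def by (intro compact_Int_closedin K closedin_torus_cball f(2))
  have V: "openin X (V y)" for y
    unfolding V_def by (rule openin_torus_ball[OF f(2)])
  have "K \<subseteq> (\<Union>y\<in>K. V y)" using KX r by (auto simp: V_def)
  then obtain \<F> where \<F>: "finite \<F>" "\<F> \<subseteq> V ` K" "K \<subseteq> \<Union>\<F>"
    using K V unfolding compactin_def by (metis (no_types, lifting) imageE)
  then obtain Y where Y: "finite Y" "Y \<subseteq> K" "K \<subseteq> (\<Union>y\<in>Y. V y)"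
    by (metis finite_subset_image)
  define W where "W = F \<inter> (\<Inter>y\<in>Y. {g \<in> F. g ` C y \<subseteq> B y})"
  have B: "openin torus_topology (B y)" for y
    unfolding B_def torus_topology_def by (simp add: openin_open_Int)
  have "openin (compact_open_topology X torus_topology F) {g \<in> F. g ` C y \<subseteq> B y}" for y
    unfolding compact_open_topology_def using C B by (blast intro: topology_generated_by_Basis)
  moreover have "openin (compact_open_topology X torus_topology F) F"
    by (metis openin_topspace topspace_compact_open_topology)
  ultimately have "openin (compact_open_topology X torus_topology F) W"
    unfolding W_def using Y(1) by (cases "Y = {}") (auto intro!: openin_Int openin_Inter)
  moreover have "f \<in> W"
  proof -
    have "f x \<in> B y" if "x \<in> C y" for x y
    proof -
      have "x \<in> topspace X" "cmod (f x - f y) \<le> r / 3" using that by (auto simp: C_def)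
      with r continuous_map_torusD[OF f(2)] show ?thesis
        by (auto simp: B_def dist_norm norm_minus_commute)
    qed
    then show ?thesis using f(1) by (auto simp: W_def)
  qed
  moreover have "cmod (g x - f x) < r" if g: "g \<in> W" and x: "x \<in> K" for g x
  proof -
    obtain y where y: "y \<in> Y" "x \<in> V y" using Y x by blast
    have "x \<in> C y" using y x by (auto simp: V_def C_def)
    then have "g x \<in> B y" using g y by (auto simp: W_def)
    then have "cmod (g x - f y) < r / 2" by (auto simp: B_def dist_norm norm_minus_commute)
    moreover have "cmod (f y - f x) < r / 3" using y by (auto simp: V_def norm_minus_commute)
    ultimately have "cmod (g x - f x) < r / 2 + r / 3"
      using norm_triangle_ineq[of "g x - f y" "f y - f x"] by simp
    then show ?thesis using r by simp
  qed
  ultimately show ?thesis by blast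
qed

section \<open>Extending homomorphisms into divisible groups\<close>

definition divisible_group :: "('d, 'e) monoid_scheme \<Rightarrow> bool" where
  "divisible_group D \<longleftrightarrow> comm_group D \<and>
     (\<forall>d\<in>carrier D. \<forall>n::nat. n > 0 \<longrightarrow> (\<exists>e\<in>carrier D. e [^]\<^bsub>D\<^esub> n = d))"

text \<open>A homomorphism on a subgroup of G is encoded by its graph, a subgroup of the product.
  For a subgroup, being single valued amounts to being so over the identity, and unions of chains
  are immediate.\<close>

definition partial_hom_graph ::
    "('a, 'b) monoid_scheme \<Rightarrow> ('d, 'e) monoid_scheme \<Rightarrow> ('a \<times> 'd) set \<Rightarrow> bool" where
  "partial_hom_graph G D R \<longleftrightarrow> subgroup R (G \<times>\<times> D) \<and> (\<forall>d. (\<one>\<^bsub>G\<^esub>, d) \<in> R \<longrightarrow> d = \<one>\<^bsub>D\<^esub>)"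

text \<open>The remainder of k modulo m is again an exponent leading into E, hence 0 by minimality
  of m.\<close>

lemma (in group) least_pow_dvd_iff:
  fixes E :: "'a set"
  assumes E: "subgroup E G" and g: "g \<in> carrier G"
    and m: "m > 0" "g [^] (m::nat) \<in> E" "\<And>j::nat. 0 < j \<Longrightarrow> j < m \<Longrightarrow> g [^] j \<notin> E"
    and k: "g [^] (k::int) \<in> E"
  shows "int m dvd k"
proof -
  define q r where "q = k div int m" and "r = k mod int m"
  have k': "k = int m * q + r" by (simp add: q_def r_def)
  have "(g [^] m) [^] (- q) \<in> E"
    using E m(2) by (metis subgroup_int_pow_closed)
  moreover have "(g [^] m) [^] (- q) = g [^] (- (int m * q))"
    using g by (metis int_pow_int int_pow_pow minus_mult_right)
  ultimately have "g [^] (- (int m * q)) \<otimes> g [^] k \<in> E"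
    using E k by (simp add: subgroup.m_closed)
  then have rE: "g [^] r \<in> E"
    using g by (simp add: int_pow_mult[symmetric] k')
  have r: "0 \<le> r" "r < int m" using m(1) by (simp_all add: r_def)
  then have "g [^] nat r \<in> E" using rE by (metis int_pow_int int_nat_eq)
  then have "nat r = 0" using m(3)[of "nat r"] r by linarith
  then have "r = 0" using r by simp
  then show ?thesis using k' by simp
qed

lemma (in group) int_pow_mem_imp_nat_pow_mem:
  assumes E: "subgroup E G" and g: "g \<in> carrier G" and k: "g [^] (k::int) \<in> E" "k \<noteq> 0"
  shows "\<exists>m::nat. m > 0 \<and> g [^] m \<in> E"
proof -
  have "g [^] \<bar>k\<bar> \<in> E"
  proof (cases "k \<ge> 0")
    case False
    then have "g [^] \<bar>k\<bar> = inv (g [^] k)"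
      using g by (simp add: int_pow_neg)
    then show ?thesis using k E by (simp add: subgroup.m_inv_closed)
  qed (use k in simp)
  then have "g [^] nat \<bar>k\<bar> \<in> E" by (metis int_pow_int int_nat_eq abs_ge_zero)
  then show ?thesis using k(2) by (intro exI[of _ "nat \<bar>k\<bar>"]) simp
qed

text \<open>Divisible groups are injective. The result is applied with two targets: the circle, for
  characters, and the reals, for elements of infinite order.\<close>

locale hom_extension = G: comm_group G + D: comm_group D
  for G :: "('a, 'b) monoid_scheme" and D :: "('d, 'e) monoid_scheme" +
  assumes divisible: "divisible_group D"
begin

sublocale GD: group "G \<times>\<times> D"
  by (rule DirProd_group[OF G.is_group D.is_group])

lemma graph_subgroup: "partial_hom_graph G D R \<Longrightarrow> subgroup R (G \<times>\<times> D)"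
  unfolding partial_hom_graph_def by (rule conjunct1)

lemma graph_at_one: "partial_hom_graph G D R \<Longrightarrow> (\<one>\<^bsub>G\<^esub>, d) \<in> R \<Longrightarrow> d = \<one>\<^bsub>D\<^esub>"
  unfolding partial_hom_graph_def by (elim conjE allE impE)

lemma graph_closed:
  assumes "partial_hom_graph G D R" "(x, d) \<in> R" "(y, e) \<in> R"
  shows "(x \<otimes>\<^bsub>G\<^esub> y, d \<otimes>\<^bsub>D\<^esub> e) \<in> R"
  using subgroup.m_closed[OF graph_subgroup[OF assms(1)] assms(2,3)] by simp

lemma graph_carrier:
  assumes "partial_hom_graph G D R" "(x, d) \<in> R"
  shows "x \<in> carrier G" "d \<in> carrier D"
  using subgroup.mem_carrier[OF graph_subgroup[OF assms(1)] assms(2)] by simp_all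

lemma graph_inv:
  assumes "partial_hom_graph G D R" "(x, d) \<in> R"
  shows "(inv\<^bsub>G\<^esub> x, inv\<^bsub>D\<^esub> d) \<in> R"
  using subgroup.m_inv_closed[OF graph_subgroup[OF assms(1)] assms(2)] graph_carrier[OF assms]
  by (simp add: inv_DirProd[OF G.is_group D.is_group])

lemma graph_one:
  assumes "partial_hom_graph G D R"
  shows "(\<one>\<^bsub>G\<^esub>, \<one>\<^bsub>D\<^esub>) \<in> R"
  using subgroup.one_closed[OF graph_subgroup[OF assms]] by simp

lemma graph_nat_pow:
  assumes "partial_hom_graph G D R" "(x, d) \<in> R"
  shows "(x [^]\<^bsub>G\<^esub> (n::nat), d [^]\<^bsub>D\<^esub> n) \<in> R"
proof (induction n)
  case (Suc n)
  then show ?case using graph_closed[OF assms(1) Suc assms(2)] by simp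
qed (simp add: graph_one[OF assms(1)])

lemma graph_int_pow:
  assumes "partial_hom_graph G D R" "(x, d) \<in> R"
  shows "(x [^]\<^bsub>G\<^esub> (k::int), d [^]\<^bsub>D\<^esub> k) \<in> R"
proof (cases "k < 0")
  case True
  show ?thesis
    unfolding int_pow_def2 if_P[OF True] by (rule graph_inv[OF assms(1) graph_nat_pow[OF assms]])
next
  case False
  show ?thesis
    unfolding int_pow_def2 if_not_P[OF False] by (rule graph_nat_pow[OF assms])
qed

lemma graph_unique:
  assumes R: "partial_hom_graph G D R" and "(x, d) \<in> R" "(x, e) \<in> R"
  shows "d = e"
proof -
  note c = graph_carrier[OF R assms(2)] graph_carrier[OF R assms(3)]
  have "(x \<otimes>\<^bsub>G\<^esub> inv\<^bsub>G\<^esub> x, d \<otimes>\<^bsub>D\<^esub> inv\<^bsub>D\<^esub> e) \<in> R"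
    by (intro graph_closed[OF R] graph_inv[OF R] assms)
  then have "d \<otimes>\<^bsub>D\<^esub> inv\<^bsub>D\<^esub> e = \<one>\<^bsub>D\<^esub>"
    using c(1) by (intro graph_at_one[OF R]) simp
  then show ?thesis using c D.inv_equality[of d "inv\<^bsub>D\<^esub> e"] by simp
qed

definition adjoin :: "('a \<times> 'd) set \<Rightarrow> 'a \<Rightarrow> 'd \<Rightarrow> ('a \<times> 'd) set" where
  "adjoin R g w = {(x \<otimes>\<^bsub>G\<^esub> g [^]\<^bsub>G\<^esub> k, d \<otimes>\<^bsub>D\<^esub> w [^]\<^bsub>D\<^esub> k) | x d (k::int). (x, d) \<in> R}"

text \<open>\<open>compat\<close> keeps the new relation single valued: if x times the k-th power of
  g is the identity, then that power is the inverse of x, and R already fixes its value.\<close>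

lemma adjoin:
  assumes R: "partial_hom_graph G D R" and g: "g \<in> carrier G" and w: "w \<in> carrier D"
    and compat: "\<And>(k::int) d. (g [^]\<^bsub>G\<^esub> k, d) \<in> R \<Longrightarrow> d = w [^]\<^bsub>D\<^esub> k"
  shows "partial_hom_graph G D (adjoin R g w)" "R \<subseteq> adjoin R g w" "(g, w) \<in> adjoin R g w"
proof -
  note gc = graph_carrier[OF R]
  show sub: "R \<subseteq> adjoin R g w"
  proof
    fix p assume "p \<in> R"
    then show "p \<in> adjoin R g w"
      unfolding adjoin_def using gc[of "fst p" "snd p"]
      by (intro CollectI exI[of _ "fst p"] exI[of _ "snd p"] exI[of _ "0::int"]) auto
  qed
  show "(g, w) \<in> adjoin R g w"
    unfolding adjoin_def using g w graph_one[OF R]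
    by (intro CollectI exI[of _ "\<one>\<^bsub>G\<^esub>"] exI[of _ "\<one>\<^bsub>D\<^esub>"] exI[of _ "1::int"]) auto
  show "partial_hom_graph G D (adjoin R g w)"
    unfolding partial_hom_graph_def
  proof (intro conjI allI impI GD.subgroupI)
    show "adjoin R g w \<subseteq> carrier (G \<times>\<times> D)"
      unfolding adjoin_def using gc g w by auto
    show "adjoin R g w \<noteq> {}" using sub graph_one[OF R] by auto
  next
    fix p assume "p \<in> adjoin R g w"
    then obtain x d k where p: "(x, d) \<in> R" "p = (x \<otimes>\<^bsub>G\<^esub> g [^]\<^bsub>G\<^esub> (k::int), d \<otimes>\<^bsub>D\<^esub> w [^]\<^bsub>D\<^esub> k)"
      by (auto simp: adjoin_def)
    have "inv\<^bsub>G \<times>\<times> D\<^esub> p = (inv\<^bsub>G\<^esub> x \<otimes>\<^bsub>G\<^esub> g [^]\<^bsub>G\<^esub> (- k), inv\<^bsub>D\<^esub> d \<otimes>\<^bsub>D\<^esub> w [^]\<^bsub>D\<^esub> (- k))"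
      using p gc[OF p(1)] g w
      by (simp add: inv_DirProd[OF G.is_group D.is_group] G.inv_mult D.inv_mult G.int_pow_neg D.int_pow_neg)
    then show "inv\<^bsub>G \<times>\<times> D\<^esub> p \<in> adjoin R g w"
      unfolding adjoin_def using graph_inv[OF R p(1)] by blast
  next
    fix p p' assume "p \<in> adjoin R g w" "p' \<in> adjoin R g w"
    then obtain x d k x' d' k' where
      p: "(x, d) \<in> R" "p = (x \<otimes>\<^bsub>G\<^esub> g [^]\<^bsub>G\<^esub> (k::int), d \<otimes>\<^bsub>D\<^esub> w [^]\<^bsub>D\<^esub> k)" and
      p': "(x', d') \<in> R" "p' = (x' \<otimes>\<^bsub>G\<^esub> g [^]\<^bsub>G\<^esub> (k'::int), d' \<otimes>\<^bsub>D\<^esub> w [^]\<^bsub>D\<^esub> k')"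
      by (auto simp: adjoin_def)
    have "p \<otimes>\<^bsub>G \<times>\<times> D\<^esub> p' =
      ((x \<otimes>\<^bsub>G\<^esub> x') \<otimes>\<^bsub>G\<^esub> g [^]\<^bsub>G\<^esub> (k + k'), (d \<otimes>\<^bsub>D\<^esub> d') \<otimes>\<^bsub>D\<^esub> w [^]\<^bsub>D\<^esub> (k + k'))"
      using p p' gc[OF p(1)] gc[OF p'(1)] g w
      by (simp add: G.int_pow_mult D.int_pow_mult G.m_ac D.m_ac)
    then show "p \<otimes>\<^bsub>G \<times>\<times> D\<^esub> p' \<in> adjoin R g w"
      unfolding adjoin_def using graph_closed[OF R p(1) p'(1)] by blast
  next
    fix e assume "(\<one>\<^bsub>G\<^esub>, e) \<in> adjoin R g w"
    then obtain x d k where p: "(x, d) \<in> R" "\<one>\<^bsub>G\<^esub> = x \<otimes>\<^bsub>G\<^esub> g [^]\<^bsub>G\<^esub> (k::int)" "e = d \<otimes>\<^bsub>D\<^esub> w [^]\<^bsub>D\<^esub> k"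
      by (auto simp: adjoin_def)
    note c = gc[OF p(1)]
    have "inv\<^bsub>G\<^esub> x = g [^]\<^bsub>G\<^esub> k"
      using p(2) c(1) g by (metis G.int_pow_closed G.inv_equality G.m_comm)
    then have "inv\<^bsub>D\<^esub> d = w [^]\<^bsub>D\<^esub> k"
      using graph_inv[OF R p(1)] compat by metis
    then show "e = \<one>\<^bsub>D\<^esub>" using p(3) c(2) by (metis D.r_inv)
  qed
qed

text \<open>The exponents k for which the k-th power of g lies in the domain E of R are the
  multiples of the least positive one, m, and w is an m-th root of the value that R prescribes
  there. If there is no such m, w = 1 will do. Divisibility of D enters only here.\<close>

lemma adjoin_value_exists:
  assumes R: "partial_hom_graph G D R" and g: "g \<in> carrier G"
  shows "\<exists>w\<in>carrier D. \<forall>(k::int) d. (g [^]\<^bsub>G\<^esub> k, d) \<in> R \<longrightarrow> d = w [^]\<^bsub>D\<^esub> k"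
proof -
  define E where "E = fst ` R"
  have E: "subgroup E G"
  proof (rule G.subgroupI)
    show "E \<subseteq> carrier G" using graph_carrier[OF R] by (auto simp: E_def)
    show "E \<noteq> {}" using graph_one[OF R] by (auto simp: E_def)
    show "inv\<^bsub>G\<^esub> a \<in> E" if "a \<in> E" for a
      using that graph_inv[OF R] by (force simp: E_def)
    show "a \<otimes>\<^bsub>G\<^esub> b \<in> E" if "a \<in> E" "b \<in> E" for a b
      using that graph_closed[OF R] by (force simp: E_def)
  qed
  show ?thesis
  proof (cases "\<exists>m::nat. m > 0 \<and> g [^]\<^bsub>G\<^esub> m \<in> E")
    case True
    define m where "m = (LEAST m::nat. m > 0 \<and> g [^]\<^bsub>G\<^esub> m \<in> E)"
    have m: "m > 0" "g [^]\<^bsub>G\<^esub> m \<in> E" using LeastI_ex[OF True] by (simp_all add: m_def)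
    have least: "g [^]\<^bsub>G\<^esub> j \<notin> E" if "0 < j" "j < m" for j
      using not_less_Least[of j "\<lambda>m. m > 0 \<and> g [^]\<^bsub>G\<^esub> m \<in> E"] that by (auto simp: m_def)
    obtain d0 where d0: "(g [^]\<^bsub>G\<^esub> m, d0) \<in> R" using m(2) by (auto simp: E_def)
    obtain w where w: "w \<in> carrier D" "w [^]\<^bsub>D\<^esub> m = d0"
      using divisible m(1) graph_carrier[OF R d0] by (auto simp: divisible_group_def)
    have "d = w [^]\<^bsub>D\<^esub> k" if d: "(g [^]\<^bsub>G\<^esub> k, d) \<in> R" for k :: int and d
    proof -
      have "g [^]\<^bsub>G\<^esub> k \<in> E" using d by (force simp: E_def)
      then obtain q where q: "k = int m * q"
        using G.least_pow_dvd_iff[OF E g m least] by (auto simp: dvd_def)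
      have "((g [^]\<^bsub>G\<^esub> m) [^]\<^bsub>G\<^esub> q, d0 [^]\<^bsub>D\<^esub> q) \<in> R" by (rule graph_int_pow[OF R d0])
      moreover have "(g [^]\<^bsub>G\<^esub> m) [^]\<^bsub>G\<^esub> q = g [^]\<^bsub>G\<^esub> k"
        unfolding q using g by (metis int_pow_int G.int_pow_pow)
      moreover have "d0 [^]\<^bsub>D\<^esub> q = w [^]\<^bsub>D\<^esub> k"
        unfolding q using w by (metis int_pow_int D.int_pow_pow)
      ultimately show ?thesis using graph_unique[OF R d] by simp
    qed
    then show ?thesis using w(1) by blast
  next
    case False
    have "d = \<one>\<^bsub>D\<^esub> [^]\<^bsub>D\<^esub> k" if d: "(g [^]\<^bsub>G\<^esub> k, d) \<in> R" for k :: int and d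
    proof -
      have gE: "g [^]\<^bsub>G\<^esub> k \<in> E" using d by (force simp: E_def)
      have "k = 0"
        using False G.int_pow_mem_imp_nat_pow_mem[OF E g gE] by blast
      then show ?thesis using d graph_at_one[OF R] by simp
    qed
    then show ?thesis by blast
  qed
qed

lemma partial_hom_graph_Union:
  assumes "\<C> \<noteq> {}" and chain: "\<And>A B. A \<in> \<C> \<Longrightarrow> B \<in> \<C> \<Longrightarrow> A \<subseteq> B \<or> B \<subseteq> A"
    and R: "\<And>R. R \<in> \<C> \<Longrightarrow> partial_hom_graph G D R"
  shows "partial_hom_graph G D (\<Union>\<C>)"
  unfolding partial_hom_graph_def
proof (intro conjI allI impI GD.subgroupI)
  have sub: "R \<in> \<C> \<Longrightarrow> subgroup R (G \<times>\<times> D)" for R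
    using R graph_subgroup by blast
  then show "\<Union>\<C> \<subseteq> carrier (G \<times>\<times> D)" using subgroup.subset by blast
  show "\<Union>\<C> \<noteq> {}" using assms(1) R graph_one by blast
  show "inv\<^bsub>G \<times>\<times> D\<^esub> a \<in> \<Union>\<C>" if "a \<in> \<Union>\<C>" for a
    using that sub subgroup.m_inv_closed by (metis UnionE UnionI)
  show "a \<otimes>\<^bsub>G \<times>\<times> D\<^esub> b \<in> \<Union>\<C>" if ab: "a \<in> \<Union>\<C>" "b \<in> \<Union>\<C>" for a b
  proof -
    obtain A B where "A \<in> \<C>" "a \<in> A" "B \<in> \<C>" "b \<in> B" using ab by blast
    then obtain C where "C \<in> \<C>" "a \<in> C" "b \<in> C" using chain by (meson subsetD)
    then show ?thesis using sub subgroup.m_closed by (metis UnionI)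
  qed
  show "d = \<one>\<^bsub>D\<^esub>" if "(\<one>\<^bsub>G\<^esub>, d) \<in> \<Union>\<C>" for d
    using that R graph_at_one by blast
qed

text \<open>Zorn's lemma: a maximal graph is total, since \<open>adjoin\<close> would enlarge any
  other.\<close>

theorem extend_graph:
  assumes R0: "partial_hom_graph G D R0"
  shows "\<exists>f\<in>hom G D. \<forall>(x, d)\<in>R0. f x = d"
proof -
  define \<A> where "\<A> = {R. partial_hom_graph G D R \<and> R0 \<subseteq> R}"
  have "\<exists>M\<in>\<A>. \<forall>X\<in>\<A>. M \<subseteq> X \<longrightarrow> X = M"
  proof (rule subset_Zorn_nonempty)
    show "\<A> \<noteq> {}" using R0 by (auto simp: \<A>_def)
    fix \<C> assume "\<C> \<noteq> {}" "subset.chain \<A> \<C>"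
    then show "\<Union>\<C> \<in> \<A>"
      using partial_hom_graph_Union[of \<C>] unfolding \<A>_def subset.chain_def by blast
  qed
  then obtain M where M\<A>: "M \<in> \<A>" and maxM: "\<forall>X\<in>\<A>. M \<subseteq> X \<longrightarrow> X = M" ..
  have M: "partial_hom_graph G D M" "R0 \<subseteq> M" using M\<A> by (simp_all add: \<A>_def)
  have maximal: "X = M" if "partial_hom_graph G D X" "M \<subseteq> X" for X
    using maxM that M(2) by (auto simp: \<A>_def)
  have total: "\<exists>d. (x, d) \<in> M" if x: "x \<in> carrier G" for x
  proof -
    obtain w where w: "w \<in> carrier D" "\<And>(k::int) d. (x [^]\<^bsub>G\<^esub> k, d) \<in> M \<Longrightarrow> d = w [^]\<^bsub>D\<^esub> k"
      using adjoin_value_exists[OF M(1) x] by blast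
    have "adjoin M x w = M" by (intro maximal adjoin[OF M(1) x w])
    then show ?thesis using adjoin(3)[OF M(1) x w] by blast
  qed
  define f where "f x = (SOME d. (x, d) \<in> M)" for x
  have f: "(x, f x) \<in> M" if "x \<in> carrier G" for x
    unfolding f_def using total[OF that] by (rule someI_ex)
  have "f \<in> hom G D"
  proof (rule homI)
    show "f x \<in> carrier D" if "x \<in> carrier G" for x
      using graph_carrier(2)[OF M(1) f[OF that]] .
    show "f (x \<otimes>\<^bsub>G\<^esub> y) = f x \<otimes>\<^bsub>D\<^esub> f y" if "x \<in> carrier G" "y \<in> carrier G" for x y
      using graph_unique[OF M(1) f graph_closed[OF M(1) f f]] that by simp
  qed
  moreover have "f x = d" if "(x, d) \<in> R0" for x d
  proof -
    have "(x, d) \<in> M" using that M(2) by (rule subsetD[rotated])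
    show ?thesis
      by (rule graph_unique[OF M(1) f[OF graph_carrier(1)[OF M(1) \<open>(x, d) \<in> M\<close>]] \<open>(x, d) \<in> M\<close>])
  qed
  ultimately show ?thesis by blast
qed

corollary hom_trivial_on_subgroup:
  assumes E: "subgroup E G" and g: "g \<in> carrier G" and w: "w \<in> carrier D"
    and compat: "\<And>k::int. g [^]\<^bsub>G\<^esub> k \<in> E \<Longrightarrow> w [^]\<^bsub>D\<^esub> k = \<one>\<^bsub>D\<^esub>"
  shows "\<exists>f\<in>hom G D. (\<forall>x\<in>E. f x = \<one>\<^bsub>D\<^esub>) \<and> f g = w"
proof -
  have R: "partial_hom_graph G D (E \<times> {\<one>\<^bsub>D\<^esub>})"
    unfolding partial_hom_graph_def
    by (auto intro!: DirProd_subgroups G.is_group D.is_group E D.triv_subgroup)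
  have c: "d = w [^]\<^bsub>D\<^esub> k" if "(g [^]\<^bsub>G\<^esub> k, d) \<in> E \<times> {\<one>\<^bsub>D\<^esub>}" for k :: int and d
    using that compat by simp
  obtain f where f: "f \<in> hom G D" "\<forall>(x, d)\<in>adjoin (E \<times> {\<one>\<^bsub>D\<^esub>}) g w. f x = d"
    using extend_graph[OF adjoin(1)[OF R g w c]] by blast
  moreover have "f g = w" using f(2) adjoin(3)[OF R g w c] by auto
  moreover have "f x = \<one>\<^bsub>D\<^esub>" if "x \<in> E" for x
    using f(2) adjoin(2)[OF R g w c] that by fastforce
  ultimately show ?thesis by blast
qed

end

section \<open>Algebraic characters\<close>

definition alg_chars :: "('a, 'b) monoid_scheme \<Rightarrow> ('a \<Rightarrow> complex) set" where
  "alg_chars G = extensional (carrier G) \<inter> hom G torus_group"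

definition char_mult :: "('a, 'b) monoid_scheme \<Rightarrow> ('a \<Rightarrow> complex) \<Rightarrow> ('a \<Rightarrow> complex) \<Rightarrow> 'a \<Rightarrow> complex" where
  "char_mult G \<xi> \<beta> = (\<lambda>x\<in>carrier G. \<xi> x * \<beta> x)"

definition char_inv :: "('a, 'b) monoid_scheme \<Rightarrow> ('a \<Rightarrow> complex) \<Rightarrow> 'a \<Rightarrow> complex" where
  "char_inv G \<xi> = (\<lambda>x\<in>carrier G. cnj (\<xi> x))"

definition char_one :: "('a, 'b) monoid_scheme \<Rightarrow> 'a \<Rightarrow> complex" where
  "char_one G = (\<lambda>x\<in>carrier G. 1)"

section \<open>The circle and the additive reals as divisible groups\<close>

lemma torus_group_simps [simp]:
  "carrier torus_group = {z. cmod z = 1}"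
  "x \<otimes>\<^bsub>torus_group\<^esub> y = x * y"
  "\<one>\<^bsub>torus_group\<^esub> = 1"
  by (simp_all add: torus_group_def)

lemma comm_group_torus: "comm_group torus_group"
proof (rule comm_groupI)
  show "\<exists>y\<in>carrier torus_group. y \<otimes>\<^bsub>torus_group\<^esub> x = \<one>\<^bsub>torus_group\<^esub>" if "x \<in> carrier torus_group" for x
  proof (intro bexI[of _ "inverse x"])
    have "x \<noteq> 0" using that by auto
    then show "inverse x \<otimes>\<^bsub>torus_group\<^esub> x = \<one>\<^bsub>torus_group\<^esub>" by simp
  qed (use that in \<open>simp add: norm_inverse\<close>)
qed (auto simp: norm_mult)

lemma torus_nat_pow [simp]: "x [^]\<^bsub>torus_group\<^esub> (n::nat) = x ^ n"
  by (induction n) (simp_all add: nat_pow_def torus_group_def)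

lemma divisible_torus: "divisible_group torus_group"
  unfolding divisible_group_def
proof (intro conjI ballI allI impI comm_group_torus)
  fix d :: complex and n :: nat assume d: "d \<in> carrier torus_group" and n: "n > 0"
  have t: "d = cis (Arg d)" using d rcis_cmod_Arg[of d] by (simp add: rcis_def)
  show "\<exists>e\<in>carrier torus_group. e [^]\<^bsub>torus_group\<^esub> n = d"
    using n t by (intro bexI[of _ "cis (Arg d / n)"]) (simp_all add: Complex.DeMoivre)
qed

definition real_group :: "real monoid" where
  "real_group = \<lparr>carrier = UNIV, mult = (+), one = 0\<rparr>"

lemma real_group_simps [simp]:
  "carrier real_group = UNIV" "x \<otimes>\<^bsub>real_group\<^esub> y = x + y" "\<one>\<^bsub>real_group\<^esub> = 0"
  by (simp_all add: real_group_def)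

lemma comm_group_real: "comm_group real_group"
proof (rule comm_groupI)
  show "\<exists>y\<in>carrier real_group. y \<otimes>\<^bsub>real_group\<^esub> x = \<one>\<^bsub>real_group\<^esub>" for x
    by (intro bexI[of _ "- x"]) auto
qed auto

lemma real_nat_pow [simp]: "x [^]\<^bsub>real_group\<^esub> (n::nat) = n * x"
  by (induction n) (simp_all add: nat_pow_def real_group_def algebra_simps)

lemma divisible_real: "divisible_group real_group"
  unfolding divisible_group_def
proof (intro conjI ballI allI impI comm_group_real)
  fix d :: real and n :: nat assume "n > 0"
  then show "\<exists>e\<in>carrier real_group. e [^]\<^bsub>real_group\<^esub> n = d"
    by (intro bexI[of _ "d / n"]) simp_all
qed

context comm_group
begin

section \<open>Pointwise calculus of characters\<close>

lemma alg_charsI: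
  assumes "\<xi> \<in> extensional (carrier G)" "\<And>x. x \<in> carrier G \<Longrightarrow> cmod (\<xi> x) = 1"
    "\<And>x y. x \<in> carrier G \<Longrightarrow> y \<in> carrier G \<Longrightarrow> \<xi> (x \<otimes> y) = \<xi> x * \<xi> y"
  shows "\<xi> \<in> alg_chars G"
  using assms by (auto simp: alg_chars_def intro!: homI)

lemma char_norm: "\<xi> \<in> alg_chars G \<Longrightarrow> x \<in> carrier G \<Longrightarrow> cmod (\<xi> x) = 1"
  by (auto simp: alg_chars_def hom_def Pi_iff)

lemma char_mult_hom: "\<xi> \<in> alg_chars G \<Longrightarrow> x \<in> carrier G \<Longrightarrow> y \<in> carrier G \<Longrightarrow> \<xi> (x \<otimes> y) = \<xi> x * \<xi> y"
  using hom_mult[of \<xi> G torus_group x y] by (simp add: alg_chars_def)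

lemma char_neq_0: "\<xi> \<in> alg_chars G \<Longrightarrow> x \<in> carrier G \<Longrightarrow> \<xi> x \<noteq> 0"
  using char_norm by fastforce

lemma char_at_one: "\<xi> \<in> alg_chars G \<Longrightarrow> \<xi> \<one> = 1"
  using char_mult_hom[of \<xi> \<one> \<one>] char_neq_0[of \<xi> \<one>] by simp

lemma char_mult_cnj:
  assumes "\<xi> \<in> alg_chars G" "x \<in> carrier G" shows "\<xi> x * cnj (\<xi> x) = 1"
  using char_norm[OF assms] complex_norm_square[of "\<xi> x"] by simp

lemma char_dist_le_2:
  assumes "\<xi> \<in> alg_chars G" "x \<in> carrier G" shows "cmod (\<xi> x - 1) \<le> 2"
  using norm_triangle_ineq4[of "\<xi> x" 1] char_norm[OF assms] by simp

lemma char_at_inv: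
  assumes "\<xi> \<in> alg_chars G" "x \<in> carrier G" shows "\<xi> (inv x) = cnj (\<xi> x)"
proof -
  have "\<xi> (inv x) * \<xi> x = 1"
    using char_mult_hom[of \<xi> "inv x" x] char_at_one[OF assms(1)] assms by simp
  moreover have "cnj (\<xi> x) * \<xi> x = 1" using char_mult_cnj[OF assms] by (simp add: mult.commute)
  ultimately show ?thesis using char_neq_0[OF assms] by (metis mult_cancel_right)
qed

lemma char_at_pow: "\<xi> \<in> alg_chars G \<Longrightarrow> x \<in> carrier G \<Longrightarrow> \<xi> (x [^] (n::nat)) = \<xi> x ^ n"
  by (induction n) (simp_all add: char_at_one char_mult_hom)

lemma char_eqI:
  assumes "\<xi> \<in> alg_chars G" "\<beta> \<in> alg_chars G" "\<And>x. x \<in> carrier G \<Longrightarrow> \<xi> x = \<beta> x"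
  shows "\<xi> = \<beta>"
  by (rule extensionalityI[of _ "carrier G"]) (use assms in \<open>auto simp: alg_chars_def\<close>)

lemma char_mult_apply: "x \<in> carrier G \<Longrightarrow> char_mult G \<xi> \<beta> x = \<xi> x * \<beta> x"
  by (simp add: char_mult_def)

lemma char_inv_apply: "x \<in> carrier G \<Longrightarrow> char_inv G \<xi> x = cnj (\<xi> x)"
  by (simp add: char_inv_def)

lemma char_one_apply: "x \<in> carrier G \<Longrightarrow> char_one G x = 1"
  by (simp add: char_one_def)

lemma char_mult_closed:
  assumes "\<xi> \<in> alg_chars G" "\<beta> \<in> alg_chars G" shows "char_mult G \<xi> \<beta> \<in> alg_chars G"
  by (rule alg_charsI)
    (simp_all add: char_mult_def norm_mult char_norm[OF assms(1)] char_norm[OF assms(2)]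
      char_mult_hom[OF assms(1)] char_mult_hom[OF assms(2)])

lemma char_inv_closed:
  assumes "\<xi> \<in> alg_chars G" shows "char_inv G \<xi> \<in> alg_chars G"
  by (rule alg_charsI)
    (simp_all add: char_inv_def char_norm[OF assms] char_mult_hom[OF assms])

lemma char_one_closed: "char_one G \<in> alg_chars G"
  by (rule alg_charsI) (simp_all add: char_one_def)

lemma char_mult_one_one: "char_mult G (char_one G) (char_one G) = char_one G"
  by (rule char_eqI) (simp_all add: char_mult_closed char_one_closed char_mult_apply char_one_apply)

lemma multiplicative_at_char_one:
  assumes "\<psi> (char_mult G (char_one G) (char_one G)) = \<psi> (char_one G) * \<psi> (char_one G)"
    and "cmod (\<psi> (char_one G)) = 1"
  shows "\<psi> (char_one G) = 1"
proof -
  have "\<psi> (char_one G) \<noteq> 0" using assms(2) by auto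
  then show ?thesis using assms(1) by (simp add: char_mult_one_one)
qed

section \<open>Existence of characters with given values\<close>

lemma character_trivial_on_subgroup:
  assumes E: "subgroup E G" and g: "g \<in> carrier G" and w: "cmod w = 1"
    and compat: "\<And>k::int. g [^] k \<in> E \<Longrightarrow> w [^]\<^bsub>torus_group\<^esub> k = \<one>\<^bsub>torus_group\<^esub>"
  shows "\<exists>\<xi>\<in>alg_chars G. (\<forall>x\<in>E. \<xi> x = 1) \<and> \<xi> g = w"
proof -
  interpret T: comm_group torus_group by (rule comm_group_torus)
  interpret hom_extension G torus_group by unfold_locales (rule divisible_torus)
  obtain f where f: "f \<in> hom G torus_group" "\<forall>x\<in>E. f x = 1" "f g = w"
    using hom_trivial_on_subgroup[OF E g, of w] w compat by auto
  have "restrict f (carrier G) \<in> alg_chars G"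
    using f(1) by (auto simp: alg_chars_def hom_def)
  moreover have "x \<in> carrier G" if "x \<in> E" for x using subgroup.mem_carrier[OF E that] .
  ultimately show ?thesis using f g by (intro bexI[of _ "restrict f (carrier G)"]) auto
qed

text \<open>Here m is the order of g modulo E, so a power of g lies in E only if its exponent is a
  multiple of m, and for such exponents the power of w is 1.\<close>

lemma character_with_value:
  fixes m :: nat
  assumes E: "subgroup E G" and g: "g \<in> carrier G" and w: "cmod w = 1"
    and m: "m > 0" "g [^] m \<in> E" "\<And>j. 0 < j \<Longrightarrow> j < m \<Longrightarrow> g [^] j \<notin> E" and wm: "w ^ m = 1"
  shows "\<exists>\<xi>\<in>alg_chars G. (\<forall>x\<in>E. \<xi> x = 1) \<and> \<xi> g = w"
proof (rule character_trivial_on_subgroup[OF E g w])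
  interpret T: comm_group torus_group by (rule comm_group_torus)
  show "w [^]\<^bsub>torus_group\<^esub> k = \<one>\<^bsub>torus_group\<^esub>" if k: "g [^] k \<in> E" for k :: int
  proof -
    obtain q where q: "k = int m * q"
      using least_pow_dvd_iff[OF E g m k] by (auto simp: dvd_def)
    have "w [^]\<^bsub>torus_group\<^esub> k = (w [^]\<^bsub>torus_group\<^esub> m) [^]\<^bsub>torus_group\<^esub> q"
      unfolding q using w T.int_pow_pow[of w "int m" q] by (simp add: int_pow_int)
    also have "w [^]\<^bsub>torus_group\<^esub> m = \<one>\<^bsub>torus_group\<^esub>" using wm by simp
    finally show ?thesis by (simp only: T.int_pow_one)
  qed
qed

text \<open>Modulo E the element g has a finite order m > 1 or infinite order; it is sent to a
  primitive m-th root of unity or to -1.\<close>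

lemma character_separates:
  assumes E: "subgroup E G" and g: "g \<in> carrier G" "g \<notin> E"
  shows "\<exists>\<xi>\<in>alg_chars G. (\<forall>x\<in>E. \<xi> x = 1) \<and> \<xi> g \<noteq> 1"
proof (cases "\<exists>m::nat. m > 0 \<and> g [^] m \<in> E")
  case True
  define m where "m = (LEAST m::nat. m > 0 \<and> g [^] m \<in> E)"
  have m: "m > 0" "g [^] m \<in> E" using LeastI_ex[OF True] by (simp_all add: m_def)
  have least: "g [^] j \<notin> E" if "0 < j" "j < m" for j
    using not_less_Least[of j "\<lambda>m. m > 0 \<and> g [^] m \<in> E"] that by (auto simp: m_def)
  have m1: "m \<noteq> 1" using m g by (metis nat_pow_eone)
  have w: "cmod (cis (2 * pi / m)) = 1" "cis (2 * pi / m) ^ m = 1"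
    using m(1) by (simp_all add: Complex.DeMoivre)
  moreover have "cis (2 * pi / m) \<noteq> 1"
  proof
    assume "cis (2 * pi / m) = 1"
    then have "cos (2 * pi / m) = 1" by (metis cis.simps(1) one_complex.simps(1))
    then obtain k :: int where k: "2 * pi / m = real_of_int k * 2 * pi"
      using cos_one_2pi_int by blast
    then have "1 = real_of_int k * m" using m(1) by (simp add: field_simps)
    then have "1 = k * int m" by (metis of_int_eq_iff of_int_mult of_int_of_nat_eq of_int_1)
    then have "int m dvd 1" by (metis dvd_triv_right)
    then show False using m1 by simp
  qed
  ultimately show ?thesis
    using character_with_value[OF E g(1) w(1) m least w(2)] by metis
next
  case False
  interpret T: comm_group torus_group by (rule comm_group_torus)
  have "(-1) [^]\<^bsub>torus_group\<^esub> k = \<one>\<^bsub>torus_group\<^esub>" if k: "g [^] k \<in> E" for k :: int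
  proof -
    have "k = 0" using False int_pow_mem_imp_nat_pow_mem[OF E g(1) k] by blast
    then show ?thesis by simp
  qed
  then have "\<exists>\<xi>\<in>alg_chars G. (\<forall>x\<in>E. \<xi> x = 1) \<and> \<xi> g = -1"
    by (intro character_trivial_on_subgroup[OF E g(1)]) simp_all
  then show ?thesis by (elim bexE, intro bexI) simp_all
qed

end

section \<open>Finite averages and pointwise continuous homomorphisms\<close>

lemma sum_list_product_map:
  fixes f :: "'a \<Rightarrow> 'c::comm_semiring_0"
  shows "sum_list (map (\<lambda>(a, b). f a * g b) (List.product xs ys)) = sum_list (map f xs) * sum_list (map g ys)"
  by (induction xs) (simp_all add: sum_list_const_mult distrib_right comp_def)

text \<open>A finite substitute for the fact that nontrivial characters integrate to 0. For a single
  \<phi>, the powers of some s with \<phi> s different from 1 give a geometric sum, which stays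
  bounded. For several, lists are multiplied elementwise: the sums factor, one factor is small and
  the other at most its length.\<close>

lemma averaging:
  fixes mul :: "'s \<Rightarrow> 's \<Rightarrow> 's" and \<Phi> :: "('s \<Rightarrow> complex) set" and \<kappa> :: real
  assumes S: "e \<in> S" "\<And>s t. s \<in> S \<Longrightarrow> t \<in> S \<Longrightarrow> mul s t \<in> S"
    and fin: "finite \<Phi>" and \<kappa>: "\<kappa> > 0"
    and \<Phi>: "\<And>\<phi>. \<phi> \<in> \<Phi> \<Longrightarrow> \<phi> e = 1"
      "\<And>\<phi> s t. \<phi> \<in> \<Phi> \<Longrightarrow> s \<in> S \<Longrightarrow> t \<in> S \<Longrightarrow> \<phi> (mul s t) = \<phi> s * \<phi> t"
      "\<And>\<phi> s. \<phi> \<in> \<Phi> \<Longrightarrow> s \<in> S \<Longrightarrow> cmod (\<phi> s) = 1"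
      "\<And>\<phi>. \<phi> \<in> \<Phi> \<Longrightarrow> \<exists>s\<in>S. \<phi> s \<noteq> 1"
  shows "\<exists>l. l \<noteq> [] \<and> set l \<subseteq> S \<and> (\<forall>\<phi>\<in>\<Phi>. cmod (sum_list (map \<phi> l)) \<le> \<kappa> * length l)"
  using fin \<Phi>
proof (induction \<Phi>)
  case empty
  then show ?case using S(1) by (intro exI[of _ "[e]"]) auto
next
  case (insert \<phi> \<Phi>)
  have "\<exists>l. l \<noteq> [] \<and> set l \<subseteq> S \<and> (\<forall>\<phi>\<in>\<Phi>. cmod (sum_list (map \<phi> l)) \<le> \<kappa> * length l)"
    by (rule insert.IH) (use insert.prems in \<open>simp_all\<close>)
  then obtain l where l: "l \<noteq> []" "set l \<subseteq> S" "\<And>\<phi>'. \<phi>' \<in> \<Phi> \<Longrightarrow> cmod (sum_list (map \<phi>' l)) \<le> \<kappa> * length l"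
    by blast
  obtain s where s: "s \<in> S" "\<phi> s \<noteq> 1" using insert.prems(4)[of \<phi>] by auto
  define pw where "pw i = (mul s ^^ i) e" for i
  have pwS: "pw i \<in> S" for i by (induction i) (simp_all add: pw_def S s(1))
  have pw: "\<phi> (pw i) = \<phi> s ^ i" for i
  proof (induction i)
    case (Suc i)
    have "\<phi> (pw (Suc i)) = \<phi> (mul s (pw i))" by (simp add: pw_def)
    also have "\<dots> = \<phi> s * \<phi> (pw i)" by (rule insert.prems(2)) (use s pwS in auto)
    finally show ?case using Suc by simp
  qed (use insert.prems(1) in \<open>simp add: pw_def\<close>)
  have \<phi>s: "cmod (\<phi> s) = 1" using insert.prems(3)[of \<phi> s] s by simp
  \<comment> \<open>The geometric sum is at most \<open>2 / cmod (1 - \<phi> s)\<close> whatever its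
    length, and this N makes that bound at most \<open>\<kappa> * N\<close>.\<close>
  obtain N :: nat where N: "2 / (\<kappa> * cmod (1 - \<phi> s)) < N" using reals_Archimedean2 by blast
  have pos: "\<kappa> * cmod (1 - \<phi> s) > 0" using \<kappa> s(2) by simp
  then have N0: "N > 0" using N by (cases N) (auto simp: field_simps)
  define l1 where "l1 = map pw [0..<N]"
  have l1: "l1 \<noteq> []" "set l1 \<subseteq> S" "length l1 = N" using N0 pwS by (auto simp: l1_def)
  have "sum_list (map \<phi> l1) = (\<Sum>i<N. \<phi> s ^ i)"
    by (simp add: l1_def comp_def pw sum_list_distinct_conv_sum_set atLeast0LessThan)
  also have "\<dots> = (1 - \<phi> s ^ N) / (1 - \<phi> s)" using s(2) by (simp add: sum_gp_strict)
  finally have "cmod (sum_list (map \<phi> l1)) = cmod (1 - \<phi> s ^ N) / cmod (1 - \<phi> s)"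
    by (simp add: norm_divide)
  also have "\<dots> \<le> 2 / cmod (1 - \<phi> s)"
    using norm_triangle_ineq4[of 1 "\<phi> s ^ N"] \<phi>s by (intro divide_right_mono) (simp_all add: norm_power)
  also have "\<dots> \<le> \<kappa> * N" using N pos s(2) by (simp add: field_simps)
  finally have avg1: "cmod (sum_list (map \<phi> l1)) \<le> \<kappa> * length l1" using l1 by simp
  define L where "L = map (\<lambda>(a, b). mul a b) (List.product l l1)"
  have L: "sum_list (map \<phi>' L) = sum_list (map \<phi>' l) * sum_list (map \<phi>' l1)" if "\<phi>' \<in> insert \<phi> \<Phi>" for \<phi>'
  proof -
    have "map \<phi>' L = map (\<lambda>(a, b). \<phi>' a * \<phi>' b) (List.product l l1)"
      unfolding L_def using insert.prems(2)[OF that] l(2) l1(2) by auto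
    then show ?thesis by (simp only: sum_list_product_map)
  qed
  have norm_le: "cmod (sum_list (map \<phi>' xs)) \<le> length xs" if "\<phi>' \<in> insert \<phi> \<Phi>" "set xs \<subseteq> S" for \<phi>' xs
    using that(2)
  proof (induction xs)
    case (Cons a xs)
    then show ?case using norm_triangle_ineq[of "\<phi>' a" "sum_list (map \<phi>' xs)"] insert.prems(3)[OF that(1), of a] by simp
  qed simp
  have len: "length L = length l * length l1" by (simp add: L_def)
  have "cmod (sum_list (map \<phi>' L)) \<le> \<kappa> * length L" if \<phi>': "\<phi>' \<in> insert \<phi> \<Phi>" for \<phi>'
  proof (cases "\<phi>' = \<phi>")
    case True
    have "cmod (sum_list (map \<phi> l)) * cmod (sum_list (map \<phi> l1)) \<le> length l * (\<kappa> * length l1)"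
      by (intro mult_mono avg1 norm_le) (use l in auto)
    then show ?thesis using L[OF \<phi>'] True len by (simp add: norm_mult mult_ac)
  next
    case False
    then have "cmod (sum_list (map \<phi>' l)) * cmod (sum_list (map \<phi>' l1)) \<le> (\<kappa> * length l) * length l1"
      using \<phi>' l1(2) \<kappa> by (intro mult_mono norm_le l(3)) auto
    then show ?thesis using L[OF \<phi>'] len by (simp add: norm_mult mult_ac)
  qed
  moreover have "L \<noteq> []" using len l(1) l1(1) by (metis length_0_conv mult_eq_0_iff)
  moreover have "set L \<subseteq> S" unfolding L_def using l(2) l1(2) S(2) by auto
  ultimately show ?case by blast
qed

text \<open>With d the root of c of order r + 1, the expression equals
  \<open>((M + 1) * d ^ M) ^ r * d ^ M\<close>. It weighs the exponential decay of a kernel away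
  from 1 against the number of its monomials, which is polynomial in M.\<close>

lemma poly_times_power_small:
  assumes c: "0 \<le> c" "c < (1::real)" and \<epsilon>: "\<epsilon> > 0"
  shows "\<exists>M::nat. c ^ M * real (M + 1) ^ r < \<epsilon>"
proof -
  define d where "d = root (Suc r) c"
  have d: "0 \<le> d" "d < 1" "d ^ Suc r = c"
    using c real_root_less_iff[of "Suc r" c 1] by (simp_all add: d_def del: power_Suc)
  have "(\<lambda>n. of_nat n * d ^ n) \<longlonglongrightarrow> 0" by (rule powser_times_n_limit_0) (use d in simp)
  moreover have "(\<lambda>n. d ^ n) \<longlonglongrightarrow> 0" using d by (intro LIMSEQ_realpow_zero)
  ultimately have "(\<lambda>n. of_nat n * d ^ n + d ^ n) \<longlonglongrightarrow> 0 + 0" by (rule tendsto_add)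
  then have lim: "(\<lambda>n. (of_nat n * d ^ n + d ^ n) ^ r * d ^ n) \<longlonglongrightarrow> (0 + 0) ^ r * 0"
    using \<open>(\<lambda>n. d ^ n) \<longlonglongrightarrow> 0\<close> by (intro tendsto_mult tendsto_power)
  have eq: "(of_nat n * d ^ n + d ^ n) ^ r * d ^ n = c ^ n * real (n + 1) ^ r" for n
  proof -
    have "(of_nat n * d ^ n + d ^ n) ^ r * d ^ n = (real (n + 1) * d ^ n) ^ r * d ^ n"
      by (simp add: algebra_simps)
    also have "\<dots> = real (n + 1) ^ r * (d ^ n) ^ Suc r" by (simp only: power_mult_distrib power_Suc mult_ac)
    also have "(d ^ n) ^ Suc r = c ^ n" unfolding d(3)[symmetric] by (simp only: power_mult[symmetric] mult.commute[of n])
    finally show ?thesis by simp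
  qed
  have "eventually (\<lambda>n. c ^ n * real (n + 1) ^ r < \<epsilon>) sequentially"
    using order_tendstoD(2)[OF lim[unfolded eq]] \<epsilon> by simp
  then show ?thesis by (rule eventually_happens'[OF sequentially_bot])
qed

context comm_group
begin

lemma monomial_element:
  assumes "finite F" "F \<subseteq> carrier G"
  shows "\<exists>u\<in>carrier G. \<forall>\<xi>\<in>alg_chars G. \<xi> u = (\<Prod>x\<in>F. \<xi> x ^ (p x :: nat))"
  using assms
proof (induction F)
  case empty
  then show ?case using char_at_one by (intro bexI[of _ \<one>]) auto
next
  case (insert y F)
  then obtain u where u: "u \<in> carrier G" "\<And>\<xi>. \<xi> \<in> alg_chars G \<Longrightarrow> \<xi> u = (\<Prod>x\<in>F. \<xi> x ^ p x)" by auto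
  show ?case
  proof (intro bexI[of _ "y [^] p y \<otimes> u"] ballI)
    fix \<xi> assume \<xi>: "\<xi> \<in> alg_chars G"
    have "\<xi> (y [^] p y \<otimes> u) = \<xi> y ^ p y * (\<Prod>x\<in>F. \<xi> x ^ p x)"
      using \<xi> u insert.prems by (simp add: char_mult_hom char_at_pow)
    then show "\<xi> (y [^] p y \<otimes> u) = (\<Prod>x\<in>insert y F. \<xi> x ^ p x)"
      using insert.hyps by simp
  qed (use u insert.prems in simp)
qed

text \<open>Each factor is expanded by the binomial theorem, and a monomial in values of \<xi> is
  again a value of \<xi>, at a point independent of \<xi>. That the weights sum to 1 is read off at
  the trivial character.\<close>

lemma kernel_expansion:
  assumes F: "finite F" "F \<subseteq> carrier G"
  shows "\<exists>(I :: ('a \<Rightarrow> nat) set) q u. finite I \<and> card I = (M + 1) ^ card F \<and>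
     (\<forall>p\<in>I. (0::real) \<le> q p \<and> u p \<in> carrier G) \<and> sum q I = 1 \<and>
     (\<forall>\<xi>\<in>alg_chars G. (\<Prod>x\<in>F. ((1 + \<xi> x) / 2) ^ M) = (\<Sum>p\<in>I. of_real (q p) * \<xi> (u p)))"
proof -
  define I where "I = PiE F (\<lambda>_. {..M})"
  define q where "q p = (\<Prod>x\<in>F. real (M choose p x) / 2 ^ M)" for p :: "'a \<Rightarrow> nat"
  have "\<forall>p. \<exists>u\<in>carrier G. \<forall>\<xi>\<in>alg_chars G. \<xi> u = (\<Prod>x\<in>F. \<xi> x ^ (p x :: nat))"
    using monomial_element[OF F] by blast
  then obtain u where u: "\<And>p. u p \<in> carrier G"
    "\<And>p \<xi>. \<xi> \<in> alg_chars G \<Longrightarrow> \<xi> (u p) = (\<Prod>x\<in>F. \<xi> x ^ (p x :: nat))" by metis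
  have I: "finite I" "card I = (M + 1) ^ card F"
    using F(1) by (simp_all add: I_def finite_PiE card_PiE)
  have ex: "(\<Prod>x\<in>F. ((1 + \<xi> x) / 2) ^ M) = (\<Sum>p\<in>I. of_real (q p) * \<xi> (u p))" if \<xi>: "\<xi> \<in> alg_chars G" for \<xi>
  proof -
    have "((1 + z) / 2) ^ M = (\<Sum>k\<le>M. of_real (real (M choose k) / 2 ^ M) * z ^ k)" for z :: complex
    proof -
      have "((1 + z) / 2) ^ M = (z + 1) ^ M / 2 ^ M" by (simp add: power_divide add.commute)
      also have "\<dots> = (\<Sum>k\<le>M. of_real (real (M choose k) / 2 ^ M) * z ^ k)"
        by (simp add: binomial_ring sum_divide_distrib)
      finally show ?thesis .
    qed
    then have "(\<Prod>x\<in>F. ((1 + \<xi> x) / 2) ^ M) = (\<Prod>x\<in>F. \<Sum>k\<le>M. of_real (real (M choose k) / 2 ^ M) * \<xi> x ^ k)"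
      by simp
    also have "\<dots> = (\<Sum>p\<in>I. \<Prod>x\<in>F. of_real (real (M choose p x) / 2 ^ M) * \<xi> x ^ p x)"
      unfolding I_def by (rule prod_sum_PiE) (use F in auto)
    also have "\<dots> = (\<Sum>p\<in>I. of_real (q p) * \<xi> (u p))"
      by (intro sum.cong refl) (simp add: u(2)[OF \<xi>] q_def prod.distrib del: of_real_divide)
    finally show ?thesis .
  qed
  have "(\<Prod>x\<in>F. ((1 + char_one G x) / 2) ^ M) = 1"
  proof (intro prod.neutral ballI)
    fix x assume "x \<in> F"
    then have "char_one G x = 1" using F(2) by (auto simp: char_one_apply)
    then show "((1 + char_one G x) / 2) ^ M = 1" by simp
  qed
  then have "complex_of_real (sum q I) = 1"
    using ex[OF char_one_closed] by (simp add: char_one_apply[OF u(1)])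
  then have "sum q I = 1" by (simp only: of_real_eq_1_iff)
  then show ?thesis using I u(1) ex by (intro exI[of _ I] exI[of _ q] exI[of _ u]) (auto simp: q_def intro!: prod_nonneg)
qed

end

context comm_group
begin

text \<open>The kernel \<open>P\<close> is nonnegative, small off the neighbourhood given by F and
  \<delta>, and a convex combination of evaluations \<open>\<xi> (v j)\<close>. If \<psi> is no
  evaluation, all products \<open>\<xi> (v j) * \<psi> \<xi>\<close> are nontrivial and average to
  nearly 0, and so does \<open>P \<xi> * \<psi> \<xi>\<close>. But its real part is at least about
  half of \<open>P \<xi>\<close>, whose average the diagonal terms keep near 1/K or above.\<close>

lemma pointwise_continuous_hom_is_evaluation:
  assumes S: "S \<subseteq> alg_chars G" "char_one G \<in> S"
      "\<And>\<xi> \<beta>. \<xi> \<in> S \<Longrightarrow> \<beta> \<in> S \<Longrightarrow> char_mult G \<xi> \<beta> \<in> S"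
    and \<psi>: "\<And>\<xi>. \<xi> \<in> S \<Longrightarrow> cmod (\<psi> \<xi>) = 1"
      "\<And>\<xi> \<beta>. \<xi> \<in> S \<Longrightarrow> \<beta> \<in> S \<Longrightarrow> \<psi> (char_mult G \<xi> \<beta>) = \<psi> \<xi> * \<psi> \<beta>"
    and F: "finite F" "F \<subseteq> carrier G" and \<delta>: "\<delta> > 0"
    and cont: "\<And>\<xi>. \<xi> \<in> S \<Longrightarrow> (\<forall>x\<in>F. cmod (\<xi> x - 1) \<le> \<delta>) \<Longrightarrow> 1 / 2 \<le> Re (\<psi> \<xi>)"
  shows "\<exists>d\<in>carrier G. \<forall>\<xi>\<in>S. \<psi> \<xi> = \<xi> d"
proof (rule ccontr)
  assume no_eval: "\<not> ?thesis"
  have SA: "\<xi> \<in> alg_chars G" if "\<xi> \<in> S" for \<xi> using S(1) that by blast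
  \<comment> \<open>For z on the circle, \<open>(1 + z) / 2\<close> has squared modulus
    \<open>1 - (cmod (z - 1))\<^sup>2 / 4\<close>, so c bounds it once z is \<delta> away from 1.
    The minimum with 1 keeps c nonnegative.\<close>
  define c where "c = 1 - (min \<delta> 1)\<^sup>2 / 4"
  have "(min \<delta> 1)\<^sup>2 \<le> 1" using \<delta> by (intro power_le_one) auto
  then have c: "0 \<le> c" "c < 1" using \<delta> by (auto simp: c_def)
  \<comment> \<open>The constant 12 is chosen so that \<open>3 * \<kappa> + 3 * \<tau>\<close> falls
    below half of 1/K at the end.\<close>
  obtain M :: nat where M: "c ^ M * real (M + 1) ^ card F < 1 / 12"
    using poly_times_power_small[OF c, of "1 / 12" "card F"] by auto
  define \<tau> where "\<tau> = c ^ M"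
  define K where "K = real (M + 1) ^ card F"
  have K: "K > 0" by (simp add: K_def)
  have \<tau>: "\<tau> \<ge> 0" "\<tau> < 1 / (12 * K)" using c M K by (simp_all add: \<tau>_def K_def field_simps)
  obtain I :: "('a \<Rightarrow> nat) set" and q u where I: "finite I" "card I = (M + 1) ^ card F"
    and q': "\<forall>p\<in>I. (0::real) \<le> q p \<and> u p \<in> carrier G" and q1: "sum q I = 1"
    and Qexp': "\<forall>\<xi>\<in>alg_chars G.
      (\<Prod>x\<in>F. ((1 + \<xi> x) / 2) ^ M) = (\<Sum>p\<in>I. of_real (q p) * \<xi> (u p))"
    using kernel_expansion[OF F, of M] by (elim exE conjE) (rule that)
  note Qexp = bspec[OF Qexp']
  have q: "q p \<ge> 0" "u p \<in> carrier G" if "p \<in> I" for p using q' that by blast+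
  \<comment> \<open>Taking the squared modulus of the kernel makes it real and nonnegative and pairs
    its monomials: weights are multiplied, and \<open>u p\<close> meets the inverse of
    \<open>u p'\<close>.\<close>
  define J where "J = I \<times> I"
  define cc where "cc j = q (fst j) * q (snd j)" for j
  define v where "v j = u (fst j) \<otimes> inv (u (snd j))" for j
  have J: "finite J" using I by (simp add: J_def)
  have v: "v j \<in> carrier G" if "j \<in> J" for j using that q(2) by (auto simp: J_def v_def)
  have cc: "cc j \<ge> 0" if "j \<in> J" for j using that q(1) by (auto simp: J_def cc_def)
  have cc1: "sum cc J = 1"
    using sum_product[of q I q I] q1 by (simp add: J_def cc_def sum.cartesian_product case_prod_beta)
  define P where "P \<xi> = (cmod (\<Prod>x\<in>F. ((1 + \<xi> x) / 2) ^ M))\<^sup>2" for \<xi> :: "'a \<Rightarrow> complex"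
  have Pexp: "complex_of_real (P \<xi>) = (\<Sum>j\<in>J. of_real (cc j) * \<xi> (v j))" if \<xi>: "\<xi> \<in> S" for \<xi>
  proof -
    note A = SA[OF \<xi>]
    have "complex_of_real (P \<xi>) = (\<Sum>p\<in>I. of_real (q p) * \<xi> (u p)) * cnj (\<Sum>p\<in>I. of_real (q p) * \<xi> (u p))"
      unfolding P_def Qexp[OF A] by (simp only: complex_norm_square of_real_power[symmetric])
    also have "\<dots> = (\<Sum>p\<in>I. \<Sum>p'\<in>I. (of_real (q p) * \<xi> (u p)) * (of_real (q p') * cnj (\<xi> (u p'))))"
      by (simp add: sum_product)
    also have "\<dots> = (\<Sum>p\<in>I. \<Sum>p'\<in>I. of_real (cc (p, p')) * \<xi> (v (p, p')))"
    proof (intro sum.cong refl)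
      fix p p' assume p: "p \<in> I" "p' \<in> I"
      have "\<xi> (v (p, p')) = \<xi> (u p) * cnj (\<xi> (u p'))"
        using p q(2) by (simp add: v_def char_mult_hom[OF A] char_at_inv[OF A])
      then show "(of_real (q p) * \<xi> (u p)) * (of_real (q p') * cnj (\<xi> (u p'))) = of_real (cc (p, p')) * \<xi> (v (p, p'))"
        by (simp add: cc_def)
    qed
    also have "\<dots> = (\<Sum>j\<in>J. of_real (cc j) * \<xi> (v j))"
      by (simp add: J_def sum.cartesian_product case_prod_beta)
    finally show ?thesis .
  qed
  define \<kappa> where "\<kappa> = 1 / (12 * K)"
  have \<kappa>: "\<kappa> > 0" using K by (simp add: \<kappa>_def)
  \<comment> \<open>Indices whose evaluation is constantly 1 on S have average 1 and cannot be among
    the homomorphisms to be averaged away. The diagonal of J consists of such indices.\<close>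
  define trivial where "trivial j \<longleftrightarrow> (\<forall>\<xi>\<in>S. \<xi> (v j) = 1)" for j
  define \<Phi> where "\<Phi> = (\<lambda>j \<xi>. \<xi> (v j) * \<psi> \<xi>) ` J \<union> (\<lambda>j \<xi>. \<xi> (v j)) ` {j \<in> J. \<not> trivial j}"
  have \<psi>1: "\<psi> (char_one G) = 1"
    by (rule multiplicative_at_char_one[OF \<psi>(2)[OF S(2) S(2)] \<psi>(1)[OF S(2)]])
  \<comment> \<open>A trivial product would exhibit \<psi> as the evaluation at
    \<open>inv (v j)\<close>; this is where the assumption that \<psi> is no evaluation
    enters.\<close>
  have nontriv: "\<exists>\<xi>\<in>S. \<xi> (v j) * \<psi> \<xi> \<noteq> 1" if j: "j \<in> J" for j
  proof (rule ccontr)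
    assume "\<not> ?thesis"
    then have *: "\<xi> (v j) * \<psi> \<xi> = 1" if "\<xi> \<in> S" for \<xi> using that by blast
    have "\<psi> \<xi> = \<xi> (inv (v j))" if \<xi>: "\<xi> \<in> S" for \<xi>
    proof -
      have "\<xi> (inv (v j)) * \<xi> (v j) = 1"
        using char_mult_hom[OF SA[OF \<xi>], of "inv (v j)" "v j"] v[OF j] char_at_one[OF SA[OF \<xi>]] by simp
      then have "\<xi> (inv (v j)) * (\<xi> (v j) * \<psi> \<xi>) = \<psi> \<xi>" by (simp add: mult.assoc[symmetric])
      then show ?thesis using *[OF \<xi>] by simp
    qed
    then show False using no_eval v[OF j] by blast
  qed
  have "\<exists>l. l \<noteq> [] \<and> set l \<subseteq> S \<and> (\<forall>\<phi>\<in>\<Phi>. cmod (sum_list (map \<phi> l)) \<le> \<kappa> * length l)"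
  proof (rule averaging[where mul = "char_mult G" and e = "char_one G"])
    show "finite \<Phi>" using J by (simp add: \<Phi>_def)
    show "\<phi> (char_one G) = 1" if "\<phi> \<in> \<Phi>" for \<phi>
      using that by (auto simp: \<Phi>_def \<psi>1 char_one_apply v)
    show "\<phi> (char_mult G s t) = \<phi> s * \<phi> t" if "\<phi> \<in> \<Phi>" "s \<in> S" "t \<in> S" for \<phi> s t
      using that by (auto simp: \<Phi>_def \<psi>(2) char_mult_apply v)
    show "cmod (\<phi> s) = 1" if "\<phi> \<in> \<Phi>" "s \<in> S" for \<phi> s
      using that by (auto simp: \<Phi>_def norm_mult \<psi>(1) char_norm SA v)
    show "\<exists>s\<in>S. \<phi> s \<noteq> 1" if "\<phi> \<in> \<Phi>" for \<phi>
      using that nontriv by (auto simp: \<Phi>_def trivial_def)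
  qed (use S \<kappa> in auto)
  then obtain l where l: "l \<noteq> []" "set l \<subseteq> S"
    and avg: "\<And>\<phi>. \<phi> \<in> \<Phi> \<Longrightarrow> cmod (sum_list (map \<phi> l)) \<le> \<kappa> * length l" by blast
  define n where "n = real (length l)"
  have n: "n > 0" using l by (simp add: n_def)
  have swap: "sum_list (map (\<lambda>\<xi>. (\<Sum>j\<in>J. f j \<xi>)) l) = (\<Sum>j\<in>J. sum_list (map (f j) l))"
    for f :: "_ \<Rightarrow> _ \<Rightarrow> complex"
    by (induction l) (simp_all add: sum.distrib)
  have cong: "sum_list (map f l) = sum_list (map h l)" if "\<And>\<xi>. \<xi> \<in> S \<Longrightarrow> f \<xi> = h \<xi>" for f h :: "_ \<Rightarrow> complex"
  proof -
    have "map f l = map h l" using that l(2) by auto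
    then show ?thesis by (rule arg_cong)
  qed
  have upper: "Re (sum_list (map (\<lambda>\<xi>. of_real (P \<xi>) * \<psi> \<xi>) l)) \<le> \<kappa> * n"
  proof -
    have "sum_list (map (\<lambda>\<xi>. of_real (P \<xi>) * \<psi> \<xi>) l) = sum_list (map (\<lambda>\<xi>. \<Sum>j\<in>J. of_real (cc j) * (\<xi> (v j) * \<psi> \<xi>)) l)"
      by (rule cong) (simp add: Pexp sum_distrib_right mult.assoc)
    also have "\<dots> = (\<Sum>j\<in>J. of_real (cc j) * sum_list (map (\<lambda>\<xi>. \<xi> (v j) * \<psi> \<xi>) l))"
      by (simp add: swap sum_list_const_mult)
    finally have "cmod (sum_list (map (\<lambda>\<xi>. of_real (P \<xi>) * \<psi> \<xi>) l)) \<le> (\<Sum>j\<in>J. cc j * (\<kappa> * n))"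
    proof (elim ssubst, intro sum_norm_le)
      fix j assume j: "j \<in> J"
      have "cmod (sum_list (map (\<lambda>\<xi>. \<xi> (v j) * \<psi> \<xi>) l)) \<le> \<kappa> * n"
        unfolding n_def by (rule avg) (use j in \<open>simp add: \<Phi>_def\<close>)
      then show "cmod (of_real (cc j) * sum_list (map (\<lambda>\<xi>. \<xi> (v j) * \<psi> \<xi>) l)) \<le> cc j * (\<kappa> * n)"
        using cc[OF j] by (simp add: norm_mult mult_left_mono)
    qed
    also have "\<dots> = \<kappa> * n" using cc1 by (simp add: sum_distrib_right[symmetric])
    finally show ?thesis using complex_Re_le_cmod order_trans by blast
  qed
  have lower: "n * (1 / K - \<kappa>) \<le> Re (sum_list (map (\<lambda>\<xi>. of_real (P \<xi>)) l))"
  proof -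
    have "sum_list (map (\<lambda>\<xi>. of_real (P \<xi>)) l) = sum_list (map (\<lambda>\<xi>. \<Sum>j\<in>J. of_real (cc j) * \<xi> (v j)) l)"
      by (rule cong) (rule Pexp)
    also have "\<dots> = (\<Sum>j\<in>J. of_real (cc j) * sum_list (map (\<lambda>\<xi>. \<xi> (v j)) l))"
      by (simp add: swap sum_list_const_mult)
    finally have eq: "Re (sum_list (map (\<lambda>\<xi>. of_real (P \<xi>)) l)) = (\<Sum>j\<in>J. cc j * Re (sum_list (map (\<lambda>\<xi>. \<xi> (v j)) l)))"
      by simp
    \<comment> \<open>Diagonal pairs contribute exactly n. Off the diagonal, a trivial index
      contributes n as well, which only helps, and any other at least
      \<open>- \<kappa> * n\<close>.\<close>
    have term_bound: "(if fst j = snd j then n else 0) - \<kappa> * n \<le> Re (sum_list (map (\<lambda>\<xi>. \<xi> (v j)) l))" if j: "j \<in> J" for j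
    proof (cases "trivial j")
      case True
      have "sum_list (map (\<lambda>\<xi>. \<xi> (v j)) l) = sum_list (map (\<lambda>\<xi>. 1) l)"
        by (rule cong) (use True in \<open>simp add: trivial_def\<close>)
      also have "\<dots> = of_real n" by (simp add: n_def sum_list_triv)
      finally show ?thesis using n mult_pos_pos[OF \<kappa> n] by simp
    next
      case False
      have "fst j \<noteq> snd j"
      proof
        assume "fst j = snd j"
        then have "v j = \<one>" using j q(2) by (auto simp: v_def J_def)
        then show False using False char_at_one SA by (simp add: trivial_def)
      qed
      have "cmod (sum_list (map (\<lambda>\<xi>. \<xi> (v j)) l)) \<le> \<kappa> * n"
        unfolding n_def by (rule avg) (use j False in \<open>auto simp: \<Phi>_def\<close>)
      then show ?thesis
        using \<open>fst j \<noteq> snd j\<close> abs_Re_le_cmod[of "sum_list (map (\<lambda>\<xi>. \<xi> (v j)) l)"] by simp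
    qed
    have "(\<Sum>j\<in>J. cc j * ((if fst j = snd j then n else 0) - \<kappa> * n))
      = (\<Sum>p\<in>I. \<Sum>p'\<in>I. (if p' = p then q p * q p * n else 0)) - \<kappa> * n"
    proof -
      have "(\<Sum>j\<in>J. cc j * ((if fst j = snd j then n else 0) - \<kappa> * n))
        = (\<Sum>j\<in>J. cc j * (if fst j = snd j then n else 0)) - (\<Sum>j\<in>J. cc j * (\<kappa> * n))"
        by (simp only: right_diff_distrib sum_subtractf)
      also have "(\<Sum>j\<in>J. cc j * (\<kappa> * n)) = \<kappa> * n" using cc1 by (simp add: sum_distrib_right[symmetric])
      also have "(\<Sum>j\<in>J. cc j * (if fst j = snd j then n else 0)) = (\<Sum>p\<in>I. \<Sum>p'\<in>I. (if p' = p then q p * q p * n else 0))"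
        unfolding J_def cc_def by (subst sum.cartesian_product) (auto intro!: sum.cong)
      finally show ?thesis .
    qed
    also have "(\<Sum>p\<in>I. \<Sum>p'\<in>I. (if p' = p then q p * q p * n else 0)) = (\<Sum>p\<in>I. (q p)\<^sup>2) * n"
      using I(1) by (simp add: sum_distrib_right power2_eq_square)
    finally have "(\<Sum>p\<in>I. (q p)\<^sup>2) * n - \<kappa> * n \<le> (\<Sum>j\<in>J. cc j * Re (sum_list (map (\<lambda>\<xi>. \<xi> (v j)) l)))"
      using sum_mono[of J "\<lambda>j. cc j * ((if fst j = snd j then n else 0) - \<kappa> * n)"
        "\<lambda>j. cc j * Re (sum_list (map (\<lambda>\<xi>. \<xi> (v j)) l))"] term_bound cc
      by (simp add: mult_left_mono)
    \<comment> \<open>Cauchy-Schwarz for K weights with sum 1.\<close>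
    moreover have "1 / K \<le> (\<Sum>p\<in>I. (q p)\<^sup>2)"
    proof -
      have "1 \<le> (\<Sum>p\<in>I. (q p)\<^sup>2) * K"
        using sum_squared_le_sum_of_squares[of q I] q1 I by (simp add: K_def)
      then show ?thesis using K by (simp add: field_simps)
    qed
    then have "1 / K * n \<le> (\<Sum>p\<in>I. (q p)\<^sup>2) * n" using n by (intro mult_right_mono) auto
    ultimately show ?thesis unfolding eq by (simp add: algebra_simps)
  qed
  \<comment> \<open>Off the neighbourhood only \<open>Re (\<psi> \<xi>) \<ge> - 1\<close> is known;
    there -P = P/2 - 3/2 P, and P is at most \<tau>.\<close>
  have pointwise: "P \<xi> / 2 - 3 / 2 * \<tau> \<le> Re (of_real (P \<xi>) * \<psi> \<xi>)" if \<xi>: "\<xi> \<in> S" for \<xi>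
  proof -
    have P0: "P \<xi> \<ge> 0" by (simp add: P_def)
    show ?thesis
    proof (cases "\<forall>x\<in>F. cmod (\<xi> x - 1) \<le> \<delta>")
      case True
      then have "P \<xi> * (1 / 2) \<le> P \<xi> * Re (\<psi> \<xi>)" using cont[OF \<xi>] P0 by (intro mult_left_mono) auto
      then show ?thesis using \<tau>(1) by simp
    next
      case False
      then obtain y where y: "y \<in> F" "cmod (\<xi> y - 1) > \<delta>" by auto
      have nrm: "cmod (\<xi> x) = 1" if "x \<in> F" for x using char_norm[OF SA[OF \<xi>]] F that by blast
      have par: "(cmod ((1 + z) / 2))\<^sup>2 = 1 - (cmod (z - 1))\<^sup>2 / 4" if "cmod z = 1" for z
        using that by (simp add: norm_divide cmod_def power_divide) (simp add: power2_eq_square field_simps)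
      have fac: "(cmod ((1 + \<xi> x) / 2))\<^sup>2 \<le> 1" if "x \<in> F" for x
        using par[OF nrm[OF that]] by simp
      have facy: "(cmod ((1 + \<xi> y) / 2))\<^sup>2 \<le> c"
      proof -
        have "(min \<delta> 1)\<^sup>2 \<le> (cmod (\<xi> y - 1))\<^sup>2" using y(2) \<delta> by (intro power_mono) auto
        then show ?thesis using par[OF nrm[OF y(1)]] by (simp add: c_def)
      qed
      have "P \<xi> = (\<Prod>x\<in>F. ((cmod ((1 + \<xi> x) / 2))\<^sup>2) ^ M)"
        unfolding P_def prod_norm[symmetric] by (simp add: norm_power prod_power_distrib power_mult[symmetric] mult.commute)
      also have "\<dots> = ((cmod ((1 + \<xi> y) / 2))\<^sup>2) ^ M * (\<Prod>x\<in>F - {y}. ((cmod ((1 + \<xi> x) / 2))\<^sup>2) ^ M)"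
        using F(1) y(1) by (rule prod.remove)
      also have "\<dots> \<le> c ^ M * 1"
      proof (intro mult_mono power_mono facy)
        show "(\<Prod>x\<in>F - {y}. ((cmod ((1 + \<xi> x) / 2))\<^sup>2) ^ M) \<le> 1"
          by (intro prod_le_1 conjI power_le_one fac zero_le_power norm_ge_zero) auto
        show "0 \<le> (\<Prod>x\<in>F - {y}. ((cmod ((1 + \<xi> x) / 2))\<^sup>2) ^ M)" by (intro prod_nonneg) auto
      qed (use c in auto)
      finally have "P \<xi> \<le> \<tau>" by (simp add: \<tau>_def)
      moreover have "- 1 \<le> Re (\<psi> \<xi>)" using abs_Re_le_cmod[of "\<psi> \<xi>"] \<psi>(1)[OF \<xi>] by simp
      then have "P \<xi> * (- 1) \<le> P \<xi> * Re (\<psi> \<xi>)" using P0 by (intro mult_left_mono)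
      ultimately show ?thesis by simp
    qed
  qed
  have mid: "Re (sum_list (map (\<lambda>\<xi>. of_real (P \<xi>)) l)) / 2 - 3 / 2 * \<tau> * n \<le> Re (sum_list (map (\<lambda>\<xi>. of_real (P \<xi>) * \<psi> \<xi>) l))"
    unfolding n_def using l(2)
  proof (induction l)
    case (Cons a l)
    have "3 / 2 * \<tau> * length (a # l) = 3 / 2 * \<tau> * length l + 3 / 2 * \<tau>"
      by (simp add: algebra_simps)
    moreover have "P a / 2 - 3 / 2 * \<tau> \<le> Re (of_real (P a) * \<psi> a)" using Cons.prems by (intro pointwise) simp
    moreover have "Re (sum_list (map (\<lambda>\<xi>. of_real (P \<xi>)) l)) / 2 - 3 / 2 * \<tau> * length l
        \<le> Re (sum_list (map (\<lambda>\<xi>. of_real (P \<xi>) * \<psi> \<xi>) l))"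
      using Cons.IH Cons.prems by simp
    ultimately show ?case
      by (simp only: list.map sum_list.Cons plus_complex.sel Re_complex_of_real add_divide_distrib)
  qed simp
  have "n * (1 / K - \<kappa>) / 2 - 3 / 2 * \<tau> * n
      \<le> Re (sum_list (map (\<lambda>\<xi>. of_real (P \<xi>)) l)) / 2 - 3 / 2 * \<tau> * n"
    by (intro diff_right_mono divide_right_mono lower) simp
  then have "n * (1 / K - \<kappa>) / 2 - 3 / 2 * \<tau> * n \<le> \<kappa> * n"
    by (rule order_trans[OF _ order_trans[OF mid upper]])
  then have "n * (1 / K) \<le> n * (3 * \<kappa> + 3 * \<tau>)" by (simp add: algebra_simps)
  then have "1 / K \<le> 3 * \<kappa> + 3 * \<tau>" using n by (simp only: mult_le_cancel_left_pos)
  moreover have "3 * \<kappa> + 3 * \<tau> < 6 * (1 / (12 * K))" using \<tau>(2) by (simp add: \<kappa>_def)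
  moreover have "6 * (1 / (12 * K)) = (1 / K) / 2" by simp
  moreover have "1 / K > 0" using K by simp
  ultimately show False by linarith
qed

end

section \<open>Homomorphisms on characters tending to 1 along a sequence\<close>

lemma cmod_cis_minus_one_sq: "(cmod (cis t - 1))\<^sup>2 = 2 - 2 * cos t"
proof -
  have "(cmod (cis t - 1))\<^sup>2 = (cos t - 1)\<^sup>2 + (sin t)\<^sup>2"
    by (simp add: cmod_def)
  also have "\<dots> = 2 - 2 * cos t"
    using sin_cos_squared_add[of t] by (simp add: power2_eq_square algebra_simps)
  finally show ?thesis .
qed

lemma cmod_cis_minus_one_le: "cmod (cis t - 1) \<le> \<bar>t\<bar>"
proof -
  have "cmod (cis t - 1) = 2 * \<bar>sin (t / 2)\<bar>"
    using dist_exp_i_1[of t] by (simp add: cis_conv_exp)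
  also have "\<dots> \<le> \<bar>t\<bar>" using abs_sin_x_le_abs_x[of "t / 2"] by simp
  finally show ?thesis .
qed

lemma cnj_dist_one: "cmod (cnj z - 1) = cmod (z - 1)"
  by (metis complex_cnj_diff complex_cnj_one complex_mod_cnj)

lemma norm_prod_minus_one_le:
  fixes z :: "nat \<Rightarrow> complex"
  assumes "\<And>j. cmod (z j) = 1"
  shows "cmod ((\<Prod>j<k. z j) - 1) \<le> (\<Sum>j<k. cmod (z j - 1))"
proof (induction k)
  case (Suc k)
  have "(\<Prod>j<Suc k. z j) - 1 = ((\<Prod>j<k. z j) - 1) * z k + (z k - 1)" by (simp add: algebra_simps)
  also have "cmod \<dots> \<le> cmod ((\<Prod>j<k. z j) - 1) + cmod (z k - 1)"
    using norm_triangle_ineq[of "((\<Prod>j<k. z j) - 1) * z k" "z k - 1"] assms[of k]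
    by (simp only: norm_mult mult_1_right)
  finally show ?case using Suc by simp
qed simp

text \<open>The circle has no small subgroups: squaring v multiplies its distance to 1 by
  \<open>cmod (v + 1)\<close>, which is at least 3/2 while that distance is below 1. Under repeated
  squaring the distance would grow geometrically.\<close>

lemma unit_powers_leave:
  assumes "cmod w = 1" "\<And>k::nat. cmod (w ^ k - 1) < 1"
  shows "w = 1"
proof -
  have "cmod (w ^ (2 ^ k) - 1) \<ge> (3 / 2) ^ k * cmod (w - 1)" for k
  proof (induction k)
    case (Suc k)
    let ?v = "w ^ (2 ^ k)"
    have sq: "?v\<^sup>2 - 1 = (?v - 1) * (?v + 1)" by (simp add: power2_eq_square algebra_simps)
    have v: "cmod ?v = 1" using assms(1) by (simp add: norm_power)
    have par: "(cmod (?v + 1))\<^sup>2 + (cmod (?v - 1))\<^sup>2 = 4"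
      using v unfolding cmod_def by (simp add: real_sqrt_eq_1_iff) (simp add: power2_eq_square algebra_simps)
    have "(cmod (?v - 1))\<^sup>2 \<le> 1\<^sup>2" using assms(2)[of "2 ^ k"] by (intro power_mono) auto
    then have "(3 / 2)\<^sup>2 \<le> (cmod (?v + 1))\<^sup>2" using par by (simp add: power2_eq_square)
    then have "3 / 2 \<le> cmod (?v + 1)" by (rule power2_le_imp_le) simp
    then have "(3 / 2) ^ k * cmod (w - 1) * (3 / 2) \<le> cmod (?v - 1) * cmod (?v + 1)"
      using Suc by (intro mult_mono) auto
    moreover have "w ^ (2 ^ Suc k) = ?v\<^sup>2" by (metis power_Suc2 power_mult)
    ultimately show ?case using sq by (simp add: norm_mult mult_ac)
  qed simp
  then have bound: "(3 / 2) ^ k * cmod (w - 1) \<le> 1" for k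
    using assms(2)[of "2 ^ k"] by (meson less_le_trans less_imp_le order_trans)
  show ?thesis
  proof (rule ccontr)
    assume "w \<noteq> 1"
    then have pos: "cmod (w - 1) > 0" by simp
    obtain k where "1 / cmod (w - 1) < (3 / 2 :: real) ^ k"
      using real_arch_pow[of "3 / 2" "1 / cmod (w - 1)"] by auto
    then have "1 < (3 / 2) ^ k * cmod (w - 1)" using pos by (simp add: pos_divide_less_eq)
    then show False using bound[of k] by simp
  qed
qed

text \<open>The principal root s has nonnegative real part, so \<open>cmod (s + 1)\<close> is at
  least the square root of 2, and z - 1 = (s + 1) (s - 1).\<close>

lemma csqrt_dist_one:
  assumes z: "cmod z = 1"
  shows "2 * (cmod (csqrt z - 1))\<^sup>2 \<le> (cmod (z - 1))\<^sup>2"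
proof -
  define s where "s = csqrt z"
  have s: "s\<^sup>2 = z" "Re s \<ge> 0" "cmod s = 1"
    unfolding s_def using z by (simp_all only: power2_csqrt Re_csqrt norm_csqrt real_sqrt_one)
  have "(cmod (s + 1))\<^sup>2 = (cmod s)\<^sup>2 + 2 * Re s + 1"
    unfolding cmod_power2 by (simp add: power2_eq_square algebra_simps)
  then have "2 \<le> (cmod (s + 1))\<^sup>2" using s by simp
  then have "2 * (cmod (s - 1))\<^sup>2 \<le> (cmod (s + 1))\<^sup>2 * (cmod (s - 1))\<^sup>2"
    by (intro mult_right_mono) auto
  also have "\<dots> = (cmod ((s + 1) * (s - 1)))\<^sup>2" by (simp add: norm_mult power_mult_distrib)
  also have "(s + 1) * (s - 1) = z - 1"
    unfolding s(1)[symmetric] by (simp add: power2_eq_square algebra_simps)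
  finally show ?thesis by (simp add: s_def)
qed

text \<open>All factors turn in the same direction and the partial products never leave a small arc
  around 1, so the factors cannot stay away from 1.\<close>

lemma rotating_products_leave_arc:
  fixes z :: "nat \<Rightarrow> complex"
  assumes z: "\<And>j. cmod (z j) = 1" "\<And>j. 0 \<le> Im (z j)" "\<And>j. \<eta> < cmod (z j - 1)" and \<eta>: "\<eta> > 0"
    and close1: "\<And>j. cmod (z j - 1) \<le> 1 / 2"
    and close: "\<And>k. cmod ((\<Prod>j<k. z j) - 1) \<le> 1 / 2"
  shows False
proof -
  define \<theta> where "\<theta> j = Arg (z j)" for j
  have cis: "z j = cis (\<theta> j)" for j
    using rcis_cmod_Arg[of "z j"] z(1)[of j] by (simp add: rcis_def \<theta>_def)
  have \<theta>0: "\<theta> j \<ge> 0" for j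
  proof (rule ccontr)
    assume "\<not> \<theta> j \<ge> 0"
    then have "sin (\<theta> j) < 0"
      using Arg_bounded[of "z j"] sin_gt_zero[of "- \<theta> j"] by (simp add: \<theta>_def)
    moreover have "Im (z j) = sin (\<theta> j)" using cis[of j] by simp
    ultimately show False using z(2)[of j] by simp
  qed
  have \<theta>\<eta>: "\<theta> j > \<eta>" for j
    using z(3)[of j] cmod_cis_minus_one_le[of "\<theta> j"] \<theta>0[of j] by (simp add: cis)
  have prod_cis: "(\<Prod>j<k. z j) = cis (\<Sum>j<k. \<theta> j)" for k
    by (induction k) (simp_all add: cis cis_mult add.commute)
  have small: "A \<le> pi / 3" if A: "0 \<le> A" "A \<le> pi" "cmod (cis A - 1) \<le> 1 / 2" for A
  proof (rule ccontr)
    assume "\<not> A \<le> pi / 3"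
    then have "cos A < cos (pi / 3)" using A by (intro cos_monotone_0_pi) auto
    then have "cos A < 1 / 2" by (simp add: cos_60)
    moreover have "(cmod (cis A - 1))\<^sup>2 \<le> (1 / 2)\<^sup>2" using A(3) by (intro power_mono) auto
    then have "2 - 2 * cos A \<le> 1 / 4" unfolding cmod_cis_minus_one_sq by (simp add: power2_eq_square)
    ultimately show False by simp
  qed
  have \<theta>3: "\<theta> j \<le> pi / 3" for j
  proof (rule small)
    show "0 \<le> \<theta> j" by (rule \<theta>0)
    show "\<theta> j \<le> pi" using Arg_bounded[of "z j"] by (simp add: \<theta>_def)
    show "cmod (cis (\<theta> j) - 1) \<le> 1 / 2" using close1[of j] by (simp only: cis)
  qed
  \<comment> \<open>The induction excludes wrapping around the circle: an angle of at most pi/3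
    added to a sum of at most pi/3 stays below pi, and in that range closeness of the product to 1
    brings the sum back to at most pi/3.\<close>
  have A: "(\<Sum>j<k. \<theta> j) \<le> pi / 3" for k
  proof (induction k)
    case (Suc k)
    have "0 \<le> (\<Sum>j<Suc k. \<theta> j)" using \<theta>0 by (intro sum_nonneg) auto
    moreover have "(\<Sum>j<Suc k. \<theta> j) \<le> pi" using Suc \<theta>3[of k] pi_gt_zero unfolding sum.lessThan_Suc by linarith
    ultimately show ?case using close[of "Suc k"] by (intro small) (simp_all only: prod_cis)
  qed simp
  obtain k :: nat where k: "pi / 3 < k * \<eta>" using \<eta> ex_less_of_nat_mult by blast
  have "k * \<eta> \<le> (\<Sum>j<k. \<theta> j)" using sum_mono[of "{..<k}" "\<lambda>_. \<eta>" \<theta>] \<theta>\<eta> by (simp add: less_imp_le)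
  then show False using A[of k] k by simp
qed

text \<open>The prescribed values start with N ones because early terms of g may lie in F or be tied
  to it. The error has to tend to 0, besides being at most \<delta>, so that interpolating a
  sequence with limit 1 yields a character that tends to 1 along g.\<close>

definition (in comm_group) interpolates_from :: "(nat \<Rightarrow> 'a) \<Rightarrow> 'a set \<Rightarrow> real \<Rightarrow> nat \<Rightarrow> bool" where
  "interpolates_from g F \<delta> N \<longleftrightarrow> (\<forall>z. (\<forall>n. cmod (z n) = 1) \<and> (\<forall>n<N. z n = 1) \<longrightarrow>
        (\<exists>\<beta>\<in>alg_chars G. (\<forall>x\<in>F. cmod (\<beta> x - 1) \<le> \<delta>) \<and>
          (\<forall>n. cmod (\<beta> (g n) - z n) \<le> \<delta>) \<and> (\<lambda>n. \<beta> (g n) - z n) \<longlonglongrightarrow> 0))"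

locale interpolating_sequence = comm_group G for G (structure) +
  fixes g :: "nat \<Rightarrow> 'a"
  assumes g_closed: "g n \<in> carrier G"
    and interpolation: "finite F \<Longrightarrow> F \<subseteq> carrier G \<Longrightarrow> \<delta> > 0 \<Longrightarrow>
      \<exists>N. interpolates_from g F \<delta> N"
begin

text \<open>These become the continuous characters for the topology put on G, by
  \<open>characters_seq_top\<close>.\<close>

definition null_chars :: "('a \<Rightarrow> complex) set" where
  "null_chars = {\<xi> \<in> alg_chars G. (\<lambda>n. \<xi> (g n)) \<longlonglongrightarrow> 1}"

lemma null_chars_alg: "\<xi> \<in> null_chars \<Longrightarrow> \<xi> \<in> alg_chars G"
  by (simp add: null_chars_def)

lemma null_charsD:
  assumes "\<xi> \<in> null_chars" "r > 0"
  shows "\<exists>N. \<forall>n\<ge>N. cmod (\<xi> (g n) - 1) < r"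
proof -
  have "(\<lambda>n. \<xi> (g n)) \<longlonglongrightarrow> 1" using assms(1) by (simp add: null_chars_def)
  from LIMSEQ_D[OF this assms(2)] show ?thesis by simp
qed

lemma null_chars_mult:
  assumes "\<xi> \<in> null_chars" "\<beta> \<in> null_chars" shows "char_mult G \<xi> \<beta> \<in> null_chars"
proof -
  have "(\<lambda>n. \<xi> (g n) * \<beta> (g n)) \<longlonglongrightarrow> 1 * 1"
    using assms by (intro tendsto_mult) (simp_all add: null_chars_def)
  then show ?thesis
    using assms by (simp add: null_chars_def char_mult_closed char_mult_apply[OF g_closed])
qed

lemma null_chars_inv:
  assumes "\<xi> \<in> null_chars" shows "char_inv G \<xi> \<in> null_chars"
proof -
  have "(\<lambda>n. cnj (\<xi> (g n))) \<longlonglongrightarrow> cnj 1"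
    using assms by (intro tendsto_cnj) (simp add: null_chars_def)
  then show ?thesis
    using assms by (simp add: null_chars_def char_inv_closed char_inv_apply[OF g_closed])
qed

lemma null_chars_one: "char_one G \<in> null_chars"
  by (simp add: null_chars_def char_one_closed char_one_apply[OF g_closed])

text \<open>Any character \<xi> with \<xi> x different from 1 is multiplied by some \<beta> that
  cancels it along g in the limit and moves the value at x by at most half of its distance to
  1.\<close>

lemma null_chars_separate:
  assumes x: "x \<in> carrier G" "x \<noteq> \<one>"
  shows "\<exists>\<xi>\<in>null_chars. \<xi> x \<noteq> 1"
proof -
  obtain \<xi> where \<xi>: "\<xi> \<in> alg_chars G" "\<xi> x \<noteq> 1"
    using character_separates[OF triv_subgroup x(1)] x(2) by auto
  define \<delta> where "\<delta> = cmod (\<xi> x - 1) / 2"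
  have \<delta>: "\<delta> > 0" using \<xi>(2) by (simp add: \<delta>_def)
  obtain N where "interpolates_from g {x} \<delta> N" using interpolation[of "{x}" \<delta>] x \<delta> by auto
  note N = this[unfolded interpolates_from_def, THEN spec, THEN mp]
  define z where "z n = (if n < N then 1 else cnj (\<xi> (g n)))" for n
  have "(\<forall>n. cmod (z n) = 1) \<and> (\<forall>n<N. z n = 1)"
    using char_norm[OF \<xi>(1) g_closed] by (simp add: z_def)
  from N[OF this] obtain \<beta> where \<beta>: "\<beta> \<in> alg_chars G" "cmod (\<beta> x - 1) \<le> \<delta>"
    "(\<lambda>n. \<beta> (g n) - z n) \<longlonglongrightarrow> 0" by auto
  have "(\<lambda>n. \<xi> (g n) * \<beta> (g n)) \<longlonglongrightarrow> 1"
  proof (subst tendsto_dist_iff, rule Lim_transform_eventually)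
    show "(\<lambda>n. cmod (\<beta> (g n) - z n)) \<longlonglongrightarrow> 0" using tendsto_norm_zero[OF \<beta>(3)] .
    show "eventually (\<lambda>n. cmod (\<beta> (g n) - z n) = dist (\<xi> (g n) * \<beta> (g n)) 1) sequentially"
      using eventually_ge_at_top[of N]
    proof eventually_elim
      case (elim n)
      note nrm = char_norm[OF \<xi>(1) g_closed, of n]
      have "\<xi> (g n) * \<beta> (g n) - 1 = \<xi> (g n) * (\<beta> (g n) - z n)"
        using elim char_mult_cnj[OF \<xi>(1) g_closed, of n] by (simp add: z_def algebra_simps)
      then show ?case using nrm by (simp add: dist_norm norm_mult)
    qed
  qed
  then have "char_mult G \<xi> \<beta> \<in> null_chars"
    using \<xi> \<beta> by (simp add: null_chars_def char_mult_closed char_mult_apply[OF g_closed])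
  moreover have "char_mult G \<xi> \<beta> x \<noteq> 1"
  proof
    assume "char_mult G \<xi> \<beta> x = 1"
    then have "\<xi> x * \<beta> x = 1" using x by (simp add: char_mult_apply)
    then have "\<xi> x - 1 = - (\<xi> x * (\<beta> x - 1))" by (simp add: algebra_simps)
    then have "cmod (\<xi> x - 1) = cmod (\<beta> x - 1)"
      using char_norm[OF \<xi>(1) x(1)] by (simp add: norm_mult)
    then show False using \<beta>(2) \<delta> by (simp add: \<delta>_def)
  qed
  ultimately show ?thesis by blast
qed

end

text \<open>\<open>\<psi>_cont\<close> is continuity at the trivial character for uniform closeness
  along g combined with closeness at finitely many points. It is the only consequence of
  compact-open continuity that the argument uses.\<close>

locale null_chars_hom = interpolating_sequence +
  fixes \<psi> :: "('a \<Rightarrow> complex) \<Rightarrow> complex"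
  assumes \<psi>_norm: "\<xi> \<in> null_chars \<Longrightarrow> cmod (\<psi> \<xi>) = 1"
    and \<psi>_mult: "\<xi> \<in> null_chars \<Longrightarrow> \<beta> \<in> null_chars \<Longrightarrow> \<psi> (char_mult G \<xi> \<beta>) = \<psi> \<xi> * \<psi> \<beta>"
    and \<psi>_cont: "\<eta> > 0 \<Longrightarrow> \<exists>F \<epsilon>. finite F \<and> F \<subseteq> carrier G \<and> \<epsilon> > 0 \<and>
      (\<forall>\<xi>\<in>null_chars. (\<forall>x\<in>F. cmod (\<xi> x - 1) \<le> \<epsilon>) \<and> (\<forall>n. cmod (\<xi> (g n) - 1) \<le> \<epsilon>) \<longrightarrow> cmod (\<psi> \<xi> - 1) \<le> \<eta>)"
begin

text \<open>Pointwise continuity at the trivial character, restricted to characters within r of 1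
  along g. For r at least 2, the diameter of the circle, the restriction is void.\<close>

definition pointwise_cont_on_ball :: "real \<Rightarrow> bool" where
  "pointwise_cont_on_ball r \<longleftrightarrow> (\<forall>\<eta>>0. \<exists>F \<delta>. finite F \<and> F \<subseteq> carrier G \<and> \<delta> > 0 \<and>
     (\<forall>\<xi>\<in>null_chars. (\<forall>n. cmod (\<xi> (g n) - 1) \<le> r) \<and> (\<forall>x\<in>F. cmod (\<xi> x - 1) \<le> \<delta>) \<longrightarrow>
       cmod (\<psi> \<xi> - 1) \<le> \<eta>))"

lemma \<psi>_one: "\<psi> (char_one G) = 1"
  by (rule multiplicative_at_char_one[OF \<psi>_mult[OF null_chars_one null_chars_one] \<psi>_norm[OF null_chars_one]])

lemma \<psi>_inv: assumes "\<xi> \<in> null_chars" shows "\<psi> (char_inv G \<xi>) = cnj (\<psi> \<xi>)"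
proof -
  note A = null_chars_alg[OF assms]
  have "char_mult G (char_inv G \<xi>) \<xi> = char_one G"
  proof (rule char_eqI)
    fix x assume x: "x \<in> carrier G"
    show "char_mult G (char_inv G \<xi>) \<xi> x = char_one G x"
      using x char_mult_cnj[OF A x]
      by (simp add: char_mult_apply char_inv_apply char_one_apply mult.commute)
  qed (simp_all add: char_mult_closed char_inv_closed char_one_closed A)
  then have "\<psi> (char_inv G \<xi>) * \<psi> \<xi> = 1"
    using \<psi>_mult[OF null_chars_inv[OF assms] assms] \<psi>_one by simp
  moreover have "cnj (\<psi> \<xi>) * \<psi> \<xi> = 1"
    using \<psi>_norm[OF assms] complex_norm_square[of "\<psi> \<xi>"] by (simp add: mult.commute)
  moreover have "\<psi> \<xi> \<noteq> 0" using \<psi>_norm[OF assms] by auto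
  ultimately show ?thesis by (metis mult_cancel_right)
qed

text \<open>If it failed, characters \<open>\<xi> j\<close> could be chosen one by one, with
  \<open>\<psi> (\<xi> j)\<close> bounded away from 1, each close to 1 on F0 and at those terms of g
  where an earlier one has not settled near 1. At every term of g at most one of them is then far
  from 1, so all partial products stay where \<psi> is within 1/2 of 1, against
  \<open>rotating_products_leave_arc\<close>.\<close>

lemma gliding_hump:
  "\<exists>\<epsilon>>0. pointwise_cont_on_ball \<epsilon>"
proof -
  obtain F0 \<epsilon>0 where F0: "finite F0" "F0 \<subseteq> carrier G" "\<epsilon>0 > 0"
    and near: "\<And>\<xi>. \<xi> \<in> null_chars \<Longrightarrow> (\<forall>x\<in>F0. cmod (\<xi> x - 1) \<le> \<epsilon>0) \<and> (\<forall>n. cmod (\<xi> (g n) - 1) \<le> \<epsilon>0)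
      \<Longrightarrow> cmod (\<psi> \<xi> - 1) \<le> 1 / 2"
    using \<psi>_cont[of "1 / 2"] by (auto simp del: divide_const_simps)
  \<comment> \<open>One half of \<open>\<epsilon>0\<close> pays for the single hump at each
    \<open>g n\<close>, the other half for the sum of the tolerances \<open>t j\<close>.\<close>
  define \<epsilon> where "\<epsilon> = \<epsilon>0 / 2"
  have \<epsilon>: "\<epsilon> > 0" using F0(3) by (simp add: \<epsilon>_def)
  have "pointwise_cont_on_ball \<epsilon>"
  proof (rule ccontr)
    assume "\<not> pointwise_cont_on_ball \<epsilon>"
    then obtain \<eta> where \<eta>: "\<eta> > 0" and no: "\<not> (\<exists>F \<delta>. finite F \<and> F \<subseteq> carrier G \<and> \<delta> > 0 \<and>
     (\<forall>\<xi>\<in>null_chars. (\<forall>n. cmod (\<xi> (g n) - 1) \<le> \<epsilon>) \<and> (\<forall>x\<in>F. cmod (\<xi> x - 1) \<le> \<delta>) \<longrightarrow>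
       cmod (\<psi> \<xi> - 1) \<le> \<eta>))"
      unfolding pointwise_cont_on_ball_def by blast
    have bad: "\<exists>\<xi>\<in>null_chars. (\<forall>n. cmod (\<xi> (g n) - 1) \<le> \<epsilon>) \<and> (\<forall>x\<in>F. cmod (\<xi> x - 1) \<le> \<delta>) \<and>
      cmod (\<psi> \<xi> - 1) > \<eta> \<and> Im (\<psi> \<xi>) \<ge> 0"
      if F: "finite F" "F \<subseteq> carrier G" "\<delta> > 0" for F \<delta>
    proof -
      obtain \<xi> where \<xi>: "\<xi> \<in> null_chars" "\<forall>n. cmod (\<xi> (g n) - 1) \<le> \<epsilon>" "\<forall>x\<in>F. cmod (\<xi> x - 1) \<le> \<delta>"
        "\<not> cmod (\<psi> \<xi> - 1) \<le> \<eta>" using no F by blast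
      show ?thesis
      \<comment> \<open>Passing to the inverse character conjugates the value of \<psi>, so all
        chosen values may lie in the upper half plane and rotate the same way.\<close>
      proof (cases "Im (\<psi> \<xi>) \<ge> 0")
        case True
        then show ?thesis using \<xi> by (intro bexI[of _ \<xi>]) auto
      next
        case False
        have "\<forall>n. cmod (char_inv G \<xi> (g n) - 1) \<le> \<epsilon>"
          using \<xi>(2) by (simp add: char_inv_apply[OF g_closed] cnj_dist_one)
        moreover have "\<forall>x\<in>F. cmod (char_inv G \<xi> x - 1) \<le> \<delta>"
        proof
          fix x assume x: "x \<in> F"
          then have "x \<in> carrier G" using F(2) by blast
          then show "cmod (char_inv G \<xi> x - 1) \<le> \<delta>"
            using bspec[OF \<xi>(3) x] by (simp add: char_inv_apply cnj_dist_one)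
        qed
        moreover have "cmod (\<psi> (char_inv G \<xi>) - 1) > \<eta>" "Im (\<psi> (char_inv G \<xi>)) \<ge> 0"
          using False \<xi>(4) by (simp_all add: \<psi>_inv[OF \<xi>(1)] cnj_dist_one)
        ultimately show ?thesis using null_chars_inv[OF \<xi>(1)] by blast
      qed
    qed
    define t where "t j = \<epsilon> / 2 ^ (j + 2)" for j :: nat
    have t: "t j > 0" for j using \<epsilon> by (simp add: t_def)
    have tsum: "(\<Sum>j<k. t j) \<le> \<epsilon> / 2" for k
    proof -
      have "(\<Sum>j<k. t j) = \<epsilon> / 2 - \<epsilon> / 2 ^ (k + 1)"
        by (induction k) (simp_all add: t_def field_simps)
      then show ?thesis using \<epsilon> by simp
    qed
    \<comment> \<open>A state is a character together with an index from which on it stays within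
      \<open>t j\<close> of 1 along g.\<close>
    define P where "P j s \<longleftrightarrow> fst s \<in> null_chars \<and> (\<forall>n. cmod (fst s (g n) - 1) \<le> \<epsilon>) \<and>
      (\<forall>x\<in>F0. cmod (fst s x - 1) \<le> t j) \<and> cmod (\<psi> (fst s) - 1) > \<eta> \<and> Im (\<psi> (fst s)) \<ge> 0 \<and>
      (\<forall>n\<ge>snd s. cmod (fst s (g n) - 1) \<le> t j)" for j and s :: "('a \<Rightarrow> complex) \<times> nat"
    \<comment> \<open>The next character is close to 1 wherever its predecessor has not settled; as
      the indices increase, this takes care of all earlier ones too.\<close>
    define Q where "Q j s s' \<longleftrightarrow> snd s \<le> snd s' \<and> (\<forall>n<snd s. cmod (fst s' (g n) - 1) \<le> t (Suc j))"
      for j :: nat and s s' :: "('a \<Rightarrow> complex) \<times> nat"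
    have step: "\<exists>s. P j s \<and> N \<le> snd s \<and> (\<forall>n<N. cmod (fst s (g n) - 1) \<le> t j)" for j N
    proof -
      have "finite (F0 \<union> g ` {..<N})" "F0 \<union> g ` {..<N} \<subseteq> carrier G"
        using F0 g_closed by auto
      from bad[OF this t[of j]] obtain \<xi> where \<xi>: "\<xi> \<in> null_chars" "\<forall>n. cmod (\<xi> (g n) - 1) \<le> \<epsilon>"
        "\<forall>x\<in>F0 \<union> g ` {..<N}. cmod (\<xi> x - 1) \<le> t j" "cmod (\<psi> \<xi> - 1) > \<eta>" "Im (\<psi> \<xi>) \<ge> 0" by blast
      obtain N' where N': "\<forall>n\<ge>N'. cmod (\<xi> (g n) - 1) < t j" using null_charsD[OF \<xi>(1) t] by blast
      have "P j (\<xi>, max N N')" unfolding P_def using \<xi> N' by (simp add: less_imp_le)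
      then show ?thesis using \<xi>(3) by (intro exI[of _ "(\<xi>, max N N')"]) simp
    qed
    obtain f where f: "\<And>j. P j (f j)" "\<And>j. Q j (f j) (f (Suc j))"
    proof -
      have "\<exists>f. \<forall>j. P j (f j) \<and> Q j (f j) (f (Suc j))"
      proof (rule dependent_nat_choice)
        show "\<exists>s. P 0 s" using step by blast
        show "\<exists>s'. P (Suc j) s' \<and> Q j s s'" for s j
          using step[of "Suc j" "snd s"] unfolding Q_def by blast
      qed
      then show ?thesis using that by blast
    qed
    define \<xi> where "\<xi> j = fst (f j)" for j
    define N where "N j = snd (f j)" for j
    have \<xi>: "\<xi> j \<in> null_chars" "cmod (\<xi> j (g n) - 1) \<le> \<epsilon>" "x \<in> F0 \<Longrightarrow> cmod (\<xi> j x - 1) \<le> t j"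
      "cmod (\<psi> (\<xi> j) - 1) > \<eta>" "Im (\<psi> (\<xi> j)) \<ge> 0" "N j \<le> n \<Longrightarrow> cmod (\<xi> j (g n) - 1) \<le> t j" for j n x
      using f(1)[of j] unfolding P_def \<xi>_def N_def by blast+
    have N: "N j \<le> N (Suc j)" "n < N j \<Longrightarrow> cmod (\<xi> (Suc j) (g n) - 1) \<le> t (Suc j)" for j n
      using f(2)[of j] unfolding Q_def \<xi>_def N_def by blast+
    \<comment> \<open>The additional \<epsilon> is the one hump: it can have occurred only for n
      below \<open>N k\<close>, and there all later characters keep to their tolerances.\<close>
    have \<epsilon>_sum: "(\<Sum>j<Suc k. cmod (\<xi> j (g n) - 1)) \<le> (\<Sum>j<Suc k. t j) + (if n < N k then \<epsilon> else 0)" for n k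
    proof (induction k)
      case 0
      then show ?case using \<xi>(2)[of 0 n] \<xi>(6)[of 0 n] t[of 0] by simp
    next
      case (Suc k)
      then show ?case
        using \<xi>(2)[of "Suc k" n] \<xi>(6)[of "Suc k" n] N(1)[of k] N(2)[of n k] t[of "Suc k"]
        by (auto split: if_splits)
    qed
    have g_sum: "(\<Sum>j<k. cmod (\<xi> j (g n) - 1)) \<le> \<epsilon>0" for n k
    proof (cases k)
      case (Suc k')
      then show ?thesis using \<epsilon>_sum[of n k'] tsum[of "Suc k'"] \<epsilon> by (auto simp: \<epsilon>_def split: if_splits)
    qed (use F0 in simp)
    have F_sum: "(\<Sum>j<k. cmod (\<xi> j x - 1)) \<le> \<epsilon>0" if "x \<in> F0" for x k
    proof -
      have "(\<Sum>j<k. cmod (\<xi> j x - 1)) \<le> (\<Sum>j<k. t j)" using \<xi>(3)[OF that] by (intro sum_mono)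
      then show ?thesis using tsum[of k] F0(3) by (simp add: \<epsilon>_def)
    qed
    define \<beta> where "\<beta> = rec_nat (char_one G) (\<lambda>j b. char_mult G b (\<xi> j))"
    have \<beta>S: "\<beta> k \<in> null_chars" for k
      by (induction k) (simp_all add: \<beta>_def null_chars_one null_chars_mult \<xi>(1))
    have \<beta>_apply: "\<beta> k x = (\<Prod>j<k. \<xi> j x)" if "x \<in> carrier G" for k x
      by (induction k) (simp_all add: \<beta>_def char_one_apply char_mult_apply that)
    have \<psi>\<beta>: "\<psi> (\<beta> k) = (\<Prod>j<k. \<psi> (\<xi> j))" for k
    proof (induction k)
      case (Suc k)
      have "\<beta> (Suc k) = char_mult G (\<beta> k) (\<xi> k)" by (simp add: \<beta>_def)
      then show ?case using Suc \<psi>_mult[OF \<beta>S \<xi>(1)] by simp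
    qed (simp add: \<beta>_def \<psi>_one)
    have \<beta>_dist: "cmod (\<beta> k x - 1) \<le> (\<Sum>j<k. cmod (\<xi> j x - 1))" if "x \<in> carrier G" for k x
      unfolding \<beta>_apply[OF that]
      by (rule norm_prod_minus_one_le) (rule char_norm[OF null_chars_alg[OF \<xi>(1)] that])
    have "cmod (\<psi> (\<beta> k) - 1) \<le> 1 / 2" for k
    proof (rule near[OF \<beta>S], intro conjI ballI allI)
      show "cmod (\<beta> k x - 1) \<le> \<epsilon>0" if "x \<in> F0" for x
        using \<beta>_dist[of x k] F_sum[OF that, of k] that F0(2) by (meson order_trans subsetD)
      show "cmod (\<beta> k (g n) - 1) \<le> \<epsilon>0" for n
        using \<beta>_dist[OF g_closed, of k n] g_sum by (rule order_trans)
    qed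
    moreover have "cmod (\<psi> (\<xi> j) - 1) \<le> 1 / 2" for j
    proof (rule near[OF \<xi>(1)], intro conjI ballI allI)
      show "cmod (\<xi> j x - 1) \<le> \<epsilon>0" if x: "x \<in> F0" for x
      proof -
        have "0 \<le> (\<Sum>i<j. t i)" using t by (intro sum_nonneg) (simp add: less_imp_le)
        then have "t j \<le> \<epsilon>0" using tsum[of "Suc j"] F0(3) by (simp add: \<epsilon>_def)
        then show ?thesis using \<xi>(3)[OF x, of j] by linarith
      qed
      show "cmod (\<xi> j (g n) - 1) \<le> \<epsilon>0" for n using \<xi>(2)[of j n] F0(3) by (simp add: \<epsilon>_def)
    qed
    ultimately show False
      using rotating_products_leave_arc[of "\<lambda>j. \<psi> (\<xi> j)" \<eta>] \<psi>_norm[OF \<xi>(1)] \<xi>(4,5) \<eta>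
      by (simp add: \<psi>\<beta>)
  qed
  then show ?thesis using \<epsilon> by blast
qed

text \<open>Interpolating square roots of the values of a small character splits it into two
  characters that are smaller on the sequence by a factor close to the square root of 2.\<close>

lemma enlarge_ball:
  assumes r: "r > 0" and cont: "pointwise_cont_on_ball r"
  shows "pointwise_cont_on_ball (6 / 5 * r)"
  unfolding pointwise_cont_on_ball_def
proof (intro allI impI)
  fix \<eta> :: real assume \<eta>: "\<eta> > 0"
  obtain F \<delta>1 where F: "finite F" "F \<subseteq> carrier G" "\<delta>1 > 0"
    and small: "\<And>\<xi>. \<xi> \<in> null_chars \<Longrightarrow> (\<forall>n. cmod (\<xi> (g n) - 1) \<le> r) \<and> (\<forall>x\<in>F. cmod (\<xi> x - 1) \<le> \<delta>1) \<Longrightarrow>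
       cmod (\<psi> \<xi> - 1) \<le> \<eta> / 2"
    using cont[unfolded pointwise_cont_on_ball_def, rule_format, of "\<eta> / 2"] \<eta> by (auto simp del: divide_const_simps)
  \<comment> \<open>On F the quotient of \<xi> by \<beta> has error up to
    \<open>2 * \<delta>\<close>, hence half of \<open>\<delta>1\<close>. Along g, a root within 9/10
    r of 1 and an error of r/10 stay in the ball of radius r.\<close>
  define \<delta> where "\<delta> = min (\<delta>1 / 2) (r / 10)"
  have \<delta>: "\<delta> > 0" "2 * \<delta> \<le> \<delta>1" "\<delta> \<le> r / 10" using F(3) r by (auto simp: \<delta>_def)
  obtain N where "interpolates_from g F \<delta> N" using interpolation[OF F(1,2) \<delta>(1)] by (elim exE)
  note N = this[unfolded interpolates_from_def, THEN spec, THEN mp]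
  \<comment> \<open>At the first N terms interpolation can only prescribe the value 1 instead of a
    root, so \<xi> itself has to be close to 1 there.\<close>
  define F' where "F' = F \<union> g ` {..<N}"
  have F': "finite F'" "F' \<subseteq> carrier G" using F g_closed by (auto simp: F'_def)
  have "cmod (\<psi> \<xi> - 1) \<le> \<eta>"
    if \<xi>: "\<xi> \<in> null_chars" "\<forall>n. cmod (\<xi> (g n) - 1) \<le> 6 / 5 * r" "\<forall>x\<in>F'. cmod (\<xi> x - 1) \<le> \<delta>" for \<xi>
  proof -
    note A = null_chars_alg[OF \<xi>(1)]
    define z where "z n = (if n < N then 1 else csqrt (\<xi> (g n)))" for n
    have nrm: "cmod (\<xi> (g n)) = 1" for n using char_norm[OF A g_closed] .
    have z1: "cmod (z n) = 1" for n by (simp add: z_def norm_csqrt nrm)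
    have "(\<forall>n. cmod (z n) = 1) \<and> (\<forall>n<N. z n = 1)" using z1 by (simp add: z_def)
    from N[OF this] obtain \<beta> where \<beta>: "\<beta> \<in> alg_chars G" "\<And>x. x \<in> F \<Longrightarrow> cmod (\<beta> x - 1) \<le> \<delta>"
      "\<And>n. cmod (\<beta> (g n) - z n) \<le> \<delta>" "(\<lambda>n. \<beta> (g n) - z n) \<longlonglongrightarrow> 0" by blast
    have root: "2 * (cmod (z n - 1))\<^sup>2 \<le> (cmod (\<xi> (g n) - 1))\<^sup>2" for n
      using csqrt_dist_one[OF nrm[of n]] by (simp add: z_def)
    \<comment> \<open>Half of the square of 6/5 is 0.72, below 0.81, the square of 9/10.\<close>
    have z_small: "cmod (z n - 1) \<le> 9 / 10 * r" for n
    proof (rule power2_le_imp_le)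
      have "(cmod (\<xi> (g n) - 1))\<^sup>2 \<le> (6 / 5 * r)\<^sup>2" using \<xi>(2) by (intro power_mono) auto
      then show "(cmod (z n - 1))\<^sup>2 \<le> (9 / 10 * r)\<^sup>2"
        using root[of n] by (simp add: power2_eq_square) (use zero_le_square[of r] in linarith)
    qed (use r in simp)
    have z_le: "cmod (z n - 1) \<le> cmod (\<xi> (g n) - 1)" for n
      by (rule power2_le_imp_le) (use root[of n] zero_le_power2[of "cmod (z n - 1)"] in linarith, simp)
    have "z \<longlonglongrightarrow> 1"
    proof (rule LIMSEQ_I)
      fix e :: real assume "e > 0"
      then obtain M where "\<forall>n\<ge>M. cmod (\<xi> (g n) - 1) < e" using null_charsD[OF \<xi>(1)] by blast
      then show "\<exists>M. \<forall>n\<ge>M. norm (z n - 1) < e" using z_le le_less_trans by blast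
    qed
    from tendsto_add[OF \<beta>(4) this] have "(\<lambda>n. \<beta> (g n)) \<longlonglongrightarrow> 1" by simp
    then have \<beta>S: "\<beta> \<in> null_chars" using \<beta>(1) by (simp add: null_chars_def)
    define \<gamma> where "\<gamma> = char_mult G \<xi> (char_inv G \<beta>)"
    have \<gamma>S: "\<gamma> \<in> null_chars" unfolding \<gamma>_def by (intro null_chars_mult null_chars_inv \<xi>(1) \<beta>S)
    have \<gamma>: "\<gamma> x = \<xi> x * cnj (\<beta> x)" if "x \<in> carrier G" for x
      using that by (simp add: \<gamma>_def char_mult_apply char_inv_apply)
    have \<beta>cnj: "cnj (\<beta> x) * \<beta> x = 1" if "x \<in> carrier G" for x
      using char_mult_cnj[OF \<beta>(1) that] by (simp add: mult.commute)
    have split: "\<xi> = char_mult G \<gamma> \<beta>"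
      by (rule char_eqI[OF A]) (simp_all add: null_chars_alg \<gamma>S \<beta>S char_mult_closed char_mult_apply \<gamma> \<beta>cnj mult.assoc)
    \<comment> \<open>If \<open>w * w\<close> approximates \<xi> x and w approximates \<beta> x, the
      other factor \<gamma> x is close to w too. The choice w = \<open>z n\<close> serves the
      sequence, w = 1 the points of F.\<close>
    have \<gamma>_near: "cmod (\<gamma> x - w) \<le> cmod (\<xi> x - w * w) + cmod (\<beta> x - w)" if x: "x \<in> carrier G" and w: "cmod w = 1" for x w
    proof -
      have "\<gamma> x - w = cnj (\<beta> x) * (\<xi> x - w * w) - cnj (\<beta> x) * w * (\<beta> x - w)"
        using \<beta>cnj[OF x] by (simp add: \<gamma>[OF x] algebra_simps)
      then have "cmod (\<gamma> x - w) \<le> cmod (cnj (\<beta> x) * (\<xi> x - w * w)) + cmod (cnj (\<beta> x) * w * (\<beta> x - w))"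
        by (metis norm_triangle_ineq4)
      then show ?thesis using char_norm[OF \<beta>(1) x] w by (simp add: norm_mult)
    qed
    have \<gamma>g: "cmod (\<gamma> (g n) - z n) \<le> 2 * \<delta>" for n
    proof (cases "n < N")
      case True
      have "cmod (\<xi> (g n) - 1) \<le> \<delta>" using \<xi>(3) True by (simp add: F'_def)
      then show ?thesis using \<gamma>_near[OF g_closed z1, of n n] \<beta>(3)[of n] True by (simp add: z_def)
    next
      case False
      then have "z n * z n = \<xi> (g n)" by (simp add: z_def power2_eq_square[symmetric])
      then show ?thesis using \<gamma>_near[OF g_closed z1, of n n] \<beta>(3)[of n] \<delta>(1) by simp
    qed
    have \<gamma>g': "cmod (\<gamma> (g n) - 1) \<le> r" for n
    proof (cases "n < N")
      case True
      then show ?thesis using \<gamma>g[of n] \<delta>(3) r by (simp add: z_def)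
    next
      case False
      then have zz: "z n * z n = \<xi> (g n)" by (simp add: z_def power2_eq_square[symmetric])
      have "cmod (\<gamma> (g n) - z n) \<le> \<delta>"
        using \<gamma>_near[OF g_closed z1, of n n] \<beta>(3)[of n] by (simp add: zz)
      then show ?thesis
        using norm_triangle_ineq[of "\<gamma> (g n) - z n" "z n - 1"] z_small[of n] \<delta>(3) by simp
    qed
    have \<beta>g': "cmod (\<beta> (g n) - 1) \<le> r" for n
      using norm_triangle_ineq[of "\<beta> (g n) - z n" "z n - 1"] z_small[of n] \<delta>(3) \<beta>(3)[of n] by simp
    have "cmod (\<psi> \<beta> - 1) \<le> \<eta> / 2"
    proof (rule small[OF \<beta>S], intro conjI allI ballI \<beta>g')
      show "cmod (\<beta> x - 1) \<le> \<delta>1" if "x \<in> F" for x using \<beta>(2)[OF that] \<delta> by linarith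
    qed
    moreover have "cmod (\<psi> \<gamma> - 1) \<le> \<eta> / 2"
    proof (rule small[OF \<gamma>S], intro conjI allI ballI \<gamma>g')
      fix x assume x: "x \<in> F"
      then have "x \<in> carrier G" "cmod (\<xi> x - 1) \<le> \<delta>" using F(2) \<xi>(3) by (auto simp: F'_def)
      then show "cmod (\<gamma> x - 1) \<le> \<delta>1" using \<gamma>_near[of x 1] \<beta>(2)[OF x] \<delta>(2) by simp
    qed
    moreover have eq: "\<psi> \<xi> - 1 = \<psi> \<gamma> * (\<psi> \<beta> - 1) + (\<psi> \<gamma> - 1)"
      using \<psi>_mult[OF \<gamma>S \<beta>S] by (simp add: split[symmetric] algebra_simps)
    have "cmod (\<psi> \<xi> - 1) \<le> cmod (\<psi> \<beta> - 1) + cmod (\<psi> \<gamma> - 1)"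
      unfolding eq using norm_triangle_ineq[of "\<psi> \<gamma> * (\<psi> \<beta> - 1)" "\<psi> \<gamma> - 1"] \<psi>_norm[OF \<gamma>S]
      by (simp only: norm_mult mult_1_left)
    ultimately show ?thesis by simp
  qed
  then show "\<exists>F \<delta>. finite F \<and> F \<subseteq> carrier G \<and> \<delta> > 0 \<and>
     (\<forall>\<xi>\<in>null_chars. (\<forall>n. cmod (\<xi> (g n) - 1) \<le> 6 / 5 * r) \<and> (\<forall>x\<in>F. cmod (\<xi> x - 1) \<le> \<delta>) \<longrightarrow>
       cmod (\<psi> \<xi> - 1) \<le> \<eta>)"
    using F' \<delta>(1) by (intro exI[of _ F'] exI[of _ \<delta>]) blast
qed

theorem null_chars_hom_is_evaluation: "\<exists>d\<in>carrier G. \<forall>\<xi>\<in>null_chars. \<psi> \<xi> = \<xi> d"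
proof -
  obtain \<epsilon> where \<epsilon>: "\<epsilon> > 0" "pointwise_cont_on_ball \<epsilon>" using gliding_hump by blast
  have iter: "pointwise_cont_on_ball ((6 / 5) ^ k * \<epsilon>)" for k
  proof (induction k)
    case (Suc k)
    have "pointwise_cont_on_ball (6 / 5 * ((6 / 5) ^ k * \<epsilon>))"
      by (rule enlarge_ball[OF _ Suc]) (use \<epsilon>(1) in simp)
    then show ?case by (simp only: power_Suc mult.assoc)
  qed (use \<epsilon> in simp)
  obtain k where "2 / \<epsilon> < (6 / 5 :: real) ^ k" using real_arch_pow[of "6 / 5" "2 / \<epsilon>"] by auto
  \<comment> \<open>Values on the circle differ from 1 by at most 2, so at this radius the ball is
    all of \<open>null_chars\<close>.\<close>
  then have k: "2 \<le> (6 / 5) ^ k * \<epsilon>" using \<epsilon>(1) by (simp add: pos_divide_less_eq less_imp_le)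
  obtain F \<delta> where F: "finite F" "F \<subseteq> carrier G" "\<delta> > 0"
    and small: "\<And>\<xi>. \<xi> \<in> null_chars \<Longrightarrow> (\<forall>n. cmod (\<xi> (g n) - 1) \<le> (6 / 5) ^ k * \<epsilon>) \<and>
      (\<forall>x\<in>F. cmod (\<xi> x - 1) \<le> \<delta>) \<Longrightarrow> cmod (\<psi> \<xi> - 1) \<le> 1 / 2"
    using iter[of k, unfolded pointwise_cont_on_ball_def, rule_format, of "1 / 2"] by (auto simp del: divide_const_simps)
  show ?thesis
  proof (rule pointwise_continuous_hom_is_evaluation[OF _ null_chars_one null_chars_mult \<psi>_norm \<psi>_mult F])
    show "null_chars \<subseteq> alg_chars G" using null_chars_alg by blast
    fix \<xi> assume \<xi>: "\<xi> \<in> null_chars" "\<forall>x\<in>F. cmod (\<xi> x - 1) \<le> \<delta>"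
    have "cmod (\<xi> (g n) - 1) \<le> (6 / 5) ^ k * \<epsilon>" for n
      using char_dist_le_2[OF null_chars_alg[OF \<xi>(1)] g_closed] k by (rule order_trans)
    then have "cmod (\<psi> \<xi> - 1) \<le> 1 / 2" using small \<xi> by blast
    then show "1 / 2 \<le> Re (\<psi> \<xi>)" using abs_Re_le_cmod[of "\<psi> \<xi> - 1"] by simp
  qed
qed

end

section \<open>The topology\<close>

context comm_group
begin

section \<open>Compactness of the group of all characters\<close>

lemma closed_alg_chars_relations:
  "closed {\<xi> :: 'a \<Rightarrow> complex. \<forall>x\<in>carrier G. \<forall>y\<in>carrier G. \<xi> (x \<otimes> y) = \<xi> x * \<xi> y}"
proof -
  have "closed (\<Inter>x\<in>carrier G. \<Inter>y\<in>carrier G. {\<xi> :: 'a \<Rightarrow> complex. \<xi> (x \<otimes> y) = \<xi> x * \<xi> y})"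
    by (intro closed_INT ballI closed_Collect_eq continuous_on_mult continuous_on_product_coordinates)
  also have "(\<Inter>x\<in>carrier G. \<Inter>y\<in>carrier G. {\<xi> :: 'a \<Rightarrow> complex. \<xi> (x \<otimes> y) = \<xi> x * \<xi> y})
      = {\<xi>. \<forall>x\<in>carrier G. \<forall>y\<in>carrier G. \<xi> (x \<otimes> y) = \<xi> x * \<xi> y}"
    by blast
  finally show ?thesis .
qed

text \<open>Tychonoff's theorem for functions on the whole type: off the carrier the factor is the
  single point \<open>undefined\<close>, which builds extensionality into the product.\<close>

lemma compact_alg_chars: "compact (alg_chars G)"
proof -
  let ?M = "{\<xi>. \<forall>x\<in>carrier G. \<forall>y\<in>carrier G. \<xi> (x \<otimes> y) = \<xi> x * \<xi> y}"
  define C :: "'a \<Rightarrow> complex set" where "C x = (if x \<in> carrier G then sphere 0 1 else {undefined})" for x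
  have "compactin (product_topology (\<lambda>_. euclidean) UNIV) (PiE UNIV C)"
    unfolding compactin_PiE by (auto simp: C_def)
  then have "compact (PiE UNIV C)" by (simp add: euclidean_product_topology)
  then have "compact (PiE UNIV C \<inter> ?M)"
    using closed_alg_chars_relations by (rule compact_Int_closed)
  also have "PiE UNIV C \<inter> ?M = alg_chars G"
  proof (intro equalityI subsetI)
    fix \<xi> assume a: "\<xi> \<in> PiE UNIV C \<inter> ?M"
    then have C: "\<xi> x \<in> C x" for x by auto
    show "\<xi> \<in> alg_chars G"
    proof (rule alg_charsI)
      show "\<xi> \<in> extensional (carrier G)" unfolding extensional_def
      proof (intro CollectI allI impI)
        fix x assume "x \<notin> carrier G"
        then show "\<xi> x = undefined" using C[of x] by (simp add: C_def)
      qed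
      show "cmod (\<xi> x) = 1" if "x \<in> carrier G" for x using C[of x] that by (simp add: C_def)
      show "\<xi> (x \<otimes> y) = \<xi> x * \<xi> y" if "x \<in> carrier G" "y \<in> carrier G" for x y using a that by blast
    qed
  next
    fix \<xi> assume a: "\<xi> \<in> alg_chars G"
    then have "\<xi> x \<in> C x" for x
      using char_norm[OF a, of x] by (auto simp: C_def alg_chars_def extensional_def)
    then show "\<xi> \<in> PiE UNIV C \<inter> ?M"
      using char_mult_hom[OF a] by auto
  qed
  finally show ?thesis .
qed

end

section \<open>Null balls and uniform convergence on them\<close>

context interpolating_sequence
begin

text \<open>For rates \<epsilon> tending to 0 these are, up to inclusion, the compact subsets of the
  dual, by \<open>compactin_null_ball\<close> and
  \<open>compactin_dual_top_subset_null_ball\<close>.\<close>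

definition null_ball :: "(nat \<Rightarrow> real) \<Rightarrow> ('a \<Rightarrow> complex) set" where
  "null_ball \<epsilon> = {\<xi> \<in> alg_chars G. \<forall>n. cmod (\<xi> (g n) - 1) \<le> \<epsilon> n}"

definition polar_nbhd :: "(nat \<Rightarrow> real) \<Rightarrow> real \<Rightarrow> 'a \<Rightarrow> 'a set" where
  "polar_nbhd \<epsilon> r x = {y \<in> carrier G. \<forall>\<xi>\<in>null_ball \<epsilon>. cmod (\<xi> y - \<xi> x) < r}"

text \<open>The definition does not presuppose that the sets \<open>polar_nbhd\<close> are open;
  \<open>polar_nbhd_contains_open\<close> shows that they are neighbourhoods.\<close>

definition seq_top :: "'a topology" where
  "seq_top = topology (\<lambda>U. U \<subseteq> carrier G \<and> (\<forall>x\<in>U. \<exists>\<epsilon> r. \<epsilon> \<longlonglongrightarrow> 0 \<and> r > 0 \<and> polar_nbhd \<epsilon> r x \<subseteq> U))"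

lemma null_ball_alg: "\<xi> \<in> null_ball \<epsilon> \<Longrightarrow> \<xi> \<in> alg_chars G"
  by (simp add: null_ball_def)

lemma null_ball_subset:
  assumes "\<epsilon> \<longlonglongrightarrow> 0" shows "null_ball \<epsilon> \<subseteq> null_chars"
proof
  fix \<xi> assume \<xi>: "\<xi> \<in> null_ball \<epsilon>"
  have "(\<lambda>n. \<xi> (g n) - 1) \<longlonglongrightarrow> 0"
    by (rule Lim_null_comparison[OF _ assms]) (use \<xi> in \<open>simp add: null_ball_def\<close>)
  then have "(\<lambda>n. \<xi> (g n)) \<longlonglongrightarrow> 1" by (simp add: LIM_zero_iff)
  then show "\<xi> \<in> null_chars" using \<xi> by (simp add: null_chars_def null_ball_def)
qed

lemma openin_seq_top:
  "openin seq_top U \<longleftrightarrow>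
    U \<subseteq> carrier G \<and> (\<forall>x\<in>U. \<exists>\<epsilon> r. \<epsilon> \<longlonglongrightarrow> 0 \<and> r > 0 \<and> polar_nbhd \<epsilon> r x \<subseteq> U)"
proof -
  let ?P = "\<lambda>U. U \<subseteq> carrier G \<and> (\<forall>x\<in>U. \<exists>\<epsilon> r. \<epsilon> \<longlonglongrightarrow> 0 \<and> r > 0 \<and> polar_nbhd \<epsilon> r x \<subseteq> U)"
  have "istopology ?P"
    unfolding istopology_def
  proof (intro conjI allI impI ballI)
    fix U V assume U: "?P U" and V: "?P V"
    show "U \<inter> V \<subseteq> carrier G" using U by blast
    fix x assume x: "x \<in> U \<inter> V"
    obtain \<epsilon> r where 1: "\<epsilon> \<longlonglongrightarrow> 0" "r > 0" "polar_nbhd \<epsilon> r x \<subseteq> U" using U x by blast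
    obtain \<epsilon>' r' where 2: "\<epsilon>' \<longlonglongrightarrow> 0" "r' > 0" "polar_nbhd \<epsilon>' r' x \<subseteq> V" using V x by blast
    \<comment> \<open>The larger of two rates still tends to 0, and a larger ball of characters
      gives a smaller neighbourhood.\<close>
    define \<mu> where "\<mu> n = max (\<epsilon> n) (\<epsilon>' n)" for n
    have "\<mu> \<longlonglongrightarrow> max 0 0" unfolding \<mu>_def by (intro tendsto_max 1 2)
    moreover have "null_ball \<epsilon> \<subseteq> null_ball \<mu>" "null_ball \<epsilon>' \<subseteq> null_ball \<mu>"
      by (auto simp: null_ball_def \<mu>_def le_max_iff_disj)
    then have "polar_nbhd \<mu> (min r r') x \<subseteq> polar_nbhd \<epsilon> r x \<inter> polar_nbhd \<epsilon>' r' x"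
      by (auto simp: polar_nbhd_def)
    ultimately show "\<exists>\<epsilon> r. \<epsilon> \<longlonglongrightarrow> 0 \<and> r > 0 \<and> polar_nbhd \<epsilon> r x \<subseteq> U \<inter> V"
      using 1 2 by (intro exI[of _ \<mu>] exI[of _ "min r r'"]) auto
  next
    fix \<K> assume K: "\<forall>K\<in>\<K>. ?P K"
    show "\<Union>\<K> \<subseteq> carrier G" using K by blast
    fix x assume "x \<in> \<Union>\<K>"
    then obtain V where V: "V \<in> \<K>" "x \<in> V" by blast
    then obtain \<epsilon> r where "\<epsilon> \<longlonglongrightarrow> 0" "r > 0" "polar_nbhd \<epsilon> r x \<subseteq> V" using K by blast
    then show "\<exists>\<epsilon> r. \<epsilon> \<longlonglongrightarrow> 0 \<and> r > 0 \<and> polar_nbhd \<epsilon> r x \<subseteq> \<Union>\<K>" using V(1) by blast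
  qed
  then show ?thesis by (simp add: seq_top_def topology_inverse')
qed

lemma topspace_seq_top [simp]: "topspace seq_top = carrier G"
proof -
  have "openin seq_top (carrier G)"
    unfolding openin_seq_top polar_nbhd_def
    by (auto intro!: exI[of _ "\<lambda>_. 0"] exI[of _ "1::real"])
  then show ?thesis
    using openin_subset openin_topspace openin_seq_top by blast
qed

text \<open>The open set asks for a bound s < r uniform in \<xi>; half of the gap r - s is then room
  to move about a point.\<close>

lemma polar_nbhd_contains_open:
  assumes \<epsilon>: "\<epsilon> \<longlonglongrightarrow> 0" and r: "r > 0" and x: "x \<in> carrier G"
  shows "\<exists>U. openin seq_top U \<and> x \<in> U \<and> U \<subseteq> polar_nbhd \<epsilon> r x"
proof -
  define U where "U = {y \<in> carrier G. \<exists>s<r. \<forall>\<xi>\<in>null_ball \<epsilon>. cmod (\<xi> y - \<xi> x) \<le> s}"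
  have "openin seq_top U"
    unfolding openin_seq_top
  proof (intro conjI ballI)
    show "U \<subseteq> carrier G" by (auto simp: U_def)
    fix y assume "y \<in> U"
    then obtain s where y: "y \<in> carrier G" and s: "s < r" "\<And>\<xi>. \<xi> \<in> null_ball \<epsilon> \<Longrightarrow> cmod (\<xi> y - \<xi> x) \<le> s"
      by (auto simp: U_def)
    have "polar_nbhd \<epsilon> ((r - s) / 2) y \<subseteq> U"
    proof
      fix w assume w: "w \<in> polar_nbhd \<epsilon> ((r - s) / 2) y"
      have "cmod (\<xi> w - \<xi> x) \<le> (r + s) / 2" if \<xi>: "\<xi> \<in> null_ball \<epsilon>" for \<xi>
      proof -
        have "cmod (\<xi> w - \<xi> y) < (r - s) / 2" using w \<xi> by (simp add: polar_nbhd_def)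
        then show ?thesis
          using norm_triangle_ineq[of "\<xi> w - \<xi> y" "\<xi> y - \<xi> x"] s(2)[OF \<xi>] by (simp add: field_simps)
      qed
      moreover have "(r + s) / 2 < r" using s(1) by simp
      moreover have "w \<in> carrier G" using w by (simp add: polar_nbhd_def)
      ultimately show "w \<in> U" unfolding U_def by blast
    qed
    then show "\<exists>\<epsilon> r. \<epsilon> \<longlonglongrightarrow> 0 \<and> r > 0 \<and> polar_nbhd \<epsilon> r y \<subseteq> U"
      using \<epsilon> s(1) by (intro exI[of _ \<epsilon>] exI[of _ "(r - s) / 2"]) simp
  qed
  moreover have "x \<in> U" using x r by (auto simp: U_def)
  moreover have "U \<subseteq> polar_nbhd \<epsilon> r x" by (auto simp: U_def polar_nbhd_def intro: le_less_trans)
  ultimately show ?thesis by blast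
qed

lemma continuous_map_into_seq_top:
  assumes f: "\<And>x. x \<in> topspace X \<Longrightarrow> f x \<in> carrier G"
    and cont: "\<And>x \<epsilon> r. x \<in> topspace X \<Longrightarrow> \<epsilon> \<longlonglongrightarrow> 0 \<Longrightarrow> r > 0 \<Longrightarrow>
      \<exists>U. openin X U \<and> x \<in> U \<and> f ` U \<subseteq> polar_nbhd \<epsilon> r (f x)"
  shows "continuous_map X seq_top f"
  unfolding continuous_map_def
proof (intro conjI allI impI)
  show "f \<in> topspace X \<rightarrow> topspace seq_top" using f by simp
  fix V assume V: "openin seq_top V"
  show "openin X {x \<in> topspace X. f x \<in> V}"
  proof (subst openin_subopen, intro ballI)
    fix x assume x: "x \<in> {x \<in> topspace X. f x \<in> V}"
    then obtain \<epsilon> r where er: "\<epsilon> \<longlonglongrightarrow> 0" "r > 0" "polar_nbhd \<epsilon> r (f x) \<subseteq> V"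
      using V unfolding openin_seq_top by blast
    obtain U where "openin X U" "x \<in> U" "f ` U \<subseteq> polar_nbhd \<epsilon> r (f x)"
      using cont[OF _ er(1,2)] x by blast
    then show "\<exists>T. openin X T \<and> x \<in> T \<and> T \<subseteq> {x \<in> topspace X. f x \<in> V}"
      using er(3) openin_subset[of X U] by (intro exI[of _ U]) blast
  qed
qed

lemma group_topology_seq_top: "group_topology G seq_top"
  unfolding group_topology_def
proof (intro conjI)
  show "group G" by (rule is_group)
  show "topspace seq_top = carrier G" by simp
  show "continuous_map (prod_topology seq_top seq_top) seq_top (\<lambda>(x, y). x \<otimes> y)"
  proof (rule continuous_map_into_seq_top)
    show "(case p of (x, y) \<Rightarrow> x \<otimes> y) \<in> carrier G"
      if "p \<in> topspace (prod_topology seq_top seq_top)" for p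
      using that by auto
    fix p and \<epsilon> :: "nat \<Rightarrow> real" and r :: real
    assume p: "p \<in> topspace (prod_topology seq_top seq_top)" and \<epsilon>: "\<epsilon> \<longlonglongrightarrow> 0" and r: "r > 0"
    obtain x y where xy: "p = (x, y)" "x \<in> carrier G" "y \<in> carrier G" using p by auto
    obtain U where U: "openin seq_top U" "x \<in> U" "U \<subseteq> polar_nbhd \<epsilon> (r / 2) x"
      using polar_nbhd_contains_open[OF \<epsilon> _ xy(2), of "r / 2"] r by auto
    obtain V where V: "openin seq_top V" "y \<in> V" "V \<subseteq> polar_nbhd \<epsilon> (r / 2) y"
      using polar_nbhd_contains_open[OF \<epsilon> _ xy(3), of "r / 2"] r by auto
    have "x' \<otimes> y' \<in> polar_nbhd \<epsilon> r (x \<otimes> y)" if "x' \<in> U" "y' \<in> V" for x' y'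
    proof -
      have x': "x' \<in> polar_nbhd \<epsilon> (r / 2) x" and y': "y' \<in> polar_nbhd \<epsilon> (r / 2) y"
        using that U V by auto
      then have c: "x' \<in> carrier G" "y' \<in> carrier G" by (simp_all add: polar_nbhd_def)
      have "cmod (\<xi> (x' \<otimes> y') - \<xi> (x \<otimes> y)) < r" if \<xi>: "\<xi> \<in> null_ball \<epsilon>" for \<xi>
      proof -
        note A = null_ball_alg[OF \<xi>]
        have eq: "\<xi> (x' \<otimes> y') - \<xi> (x \<otimes> y) = (\<xi> x' - \<xi> x) * \<xi> y' + \<xi> x * (\<xi> y' - \<xi> y)"
          using c xy by (simp add: char_mult_hom[OF A] algebra_simps)
        have "cmod (\<xi> x' - \<xi> x) < r / 2" "cmod (\<xi> y' - \<xi> y) < r / 2"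
          using x' y' \<xi> by (simp_all add: polar_nbhd_def)
        then show ?thesis unfolding eq
          using norm_triangle_ineq[of "(\<xi> x' - \<xi> x) * \<xi> y'" "\<xi> x * (\<xi> y' - \<xi> y)"]
            char_norm[OF A c(2)] char_norm[OF A xy(2)] by (simp add: norm_mult)
      qed
      then show ?thesis using c by (simp add: polar_nbhd_def)
    qed
    then show "\<exists>W. openin (prod_topology seq_top seq_top) W \<and> p \<in> W \<and>
      (\<lambda>(x, y). x \<otimes> y) ` W \<subseteq> polar_nbhd \<epsilon> r (case p of (x, y) \<Rightarrow> x \<otimes> y)"
      using U V xy by (intro exI[of _ "U \<times> V"]) (auto simp: openin_prod_Times_iff)
  qed
  show "continuous_map seq_top seq_top (\<lambda>x. inv x)"
  proof (rule continuous_map_into_seq_top)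
    show "inv x \<in> carrier G" if "x \<in> topspace seq_top" for x using that by simp
    fix x and \<epsilon> :: "nat \<Rightarrow> real" and r :: real
    assume x: "x \<in> topspace seq_top" and \<epsilon>: "\<epsilon> \<longlonglongrightarrow> 0" and r: "r > 0"
    obtain U where U: "openin seq_top U" "x \<in> U" "U \<subseteq> polar_nbhd \<epsilon> r x"
      using polar_nbhd_contains_open[OF \<epsilon> r] x by auto
    have "inv y \<in> polar_nbhd \<epsilon> r (inv x)" if "y \<in> U" for y
    proof -
      have y: "y \<in> polar_nbhd \<epsilon> r x" using that U by auto
      have "cmod (\<xi> (inv y) - \<xi> (inv x)) < r" if \<xi>: "\<xi> \<in> null_ball \<epsilon>" for \<xi>
      proof -
        have eq: "\<xi> (inv y) - \<xi> (inv x) = cnj (\<xi> y - \<xi> x)"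
          using y x char_at_inv[OF null_ball_alg[OF \<xi>]] by (simp add: polar_nbhd_def)
        show ?thesis unfolding eq complex_mod_cnj using y \<xi> by (simp add: polar_nbhd_def)
      qed
      then show ?thesis using y by (simp add: polar_nbhd_def)
    qed
    then show "\<exists>U. openin seq_top U \<and> x \<in> U \<and> m_inv G ` U \<subseteq> polar_nbhd \<epsilon> r (inv x)"
      using U by (intro exI[of _ U]) auto
  qed
qed

text \<open>All characters of a ball with rate \<epsilon> are within \<open>\<epsilon> n\<close> of
  1 at \<open>g n\<close>, so one index serves all of them.\<close>

lemma seq_limitin_one: "limitin seq_top g \<one> sequentially"
  unfolding limitin_def
proof (intro conjI allI impI)
  show "\<one> \<in> topspace seq_top" by simp
  fix U assume "openin seq_top U \<and> \<one> \<in> U"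
  then obtain \<epsilon> r where er: "\<epsilon> \<longlonglongrightarrow> 0" "r > 0" "polar_nbhd \<epsilon> r \<one> \<subseteq> U"
    unfolding openin_seq_top by blast
  have "eventually (\<lambda>n. \<epsilon> n < r) sequentially" using order_tendstoD(2)[OF er(1,2)] .
  then show "eventually (\<lambda>n. g n \<in> U) sequentially"
  proof eventually_elim
    case (elim n)
    have "g n \<in> polar_nbhd \<epsilon> r \<one>"
      unfolding polar_nbhd_def
    proof (intro CollectI conjI ballI g_closed)
      fix \<xi> assume \<xi>: "\<xi> \<in> null_ball \<epsilon>"
      then have "cmod (\<xi> (g n) - 1) \<le> \<epsilon> n" by (simp add: null_ball_def)
      then show "cmod (\<xi> (g n) - \<xi> \<one>) < r" using elim char_at_one[OF null_ball_alg[OF \<xi>]] by simp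
    qed
    then show ?case using er(3) by blast
  qed
qed

text \<open>In the discrete topology g would eventually be the identity. A character interpolating
  -1 on the tail with error at most 1 excludes this, since its value at the identity has distance 2
  from -1.\<close>

lemma seq_top_not_discrete: "seq_top \<noteq> discrete_topology (carrier G)"
proof
  assume "seq_top = discrete_topology (carrier G)"
  then have "openin seq_top {\<one>}" by simp
  then have ev: "eventually (\<lambda>n. g n = \<one>) sequentially"
    using seq_limitin_one unfolding limitin_def by auto
  obtain N where "interpolates_from g {} 1 N" using interpolation[of "{}" 1] by auto
  note N = this[unfolded interpolates_from_def, THEN spec, THEN mp]
  have "(\<forall>n. cmod (if n < N then 1 else - 1) = 1) \<and> (\<forall>n<N. (if n < N then 1 else - 1) = (1::complex))"
    by simp
  from N[OF this] obtain \<beta> where \<beta>: "\<beta> \<in> alg_chars G"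
    "\<And>n. cmod (\<beta> (g n) - (if n < N then 1 else - 1)) \<le> 1" by blast
  obtain n where "n \<ge> N" "g n = \<one>"
    using ev unfolding eventually_sequentially by (meson linear order_trans)
  then show False using \<beta>(2)[of n] char_at_one[OF \<beta>(1)] by simp
qed

text \<open>A continuous character tends to 1 along g because g tends to the identity. Conversely, a
  null character lies in the \<open>null_ball\<close> of its own rate
  \<open>cmod (\<xi> (g n) - 1)\<close> and is therefore continuous.\<close>

lemma characters_seq_top: "characters G seq_top = null_chars"
proof (intro equalityI subsetI)
  fix \<xi> assume "\<xi> \<in> characters G seq_top"
  then have \<xi>: "\<xi> \<in> alg_chars G" "continuous_map seq_top torus_topology \<xi>"
    by (auto simp: characters_def alg_chars_def)
  have "(\<lambda>n. \<xi> (g n)) \<longlonglongrightarrow> 1"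
  proof (rule LIMSEQ_I)
    fix r :: real assume r: "r > 0"
    have "openin seq_top {x \<in> topspace seq_top. cmod (\<xi> x - 1) < r}"
      by (rule openin_torus_ball[OF \<xi>(2)])
    moreover have "\<one> \<in> {x \<in> topspace seq_top. cmod (\<xi> x - 1) < r}"
      using r char_at_one[OF \<xi>(1)] by simp
    ultimately have "eventually (\<lambda>n. g n \<in> {x \<in> topspace seq_top. cmod (\<xi> x - 1) < r}) sequentially"
      using seq_limitin_one unfolding limitin_def by blast
    then show "\<exists>N. \<forall>n\<ge>N. norm (\<xi> (g n) - 1) < r"
      unfolding eventually_sequentially by blast
  qed
  then show "\<xi> \<in> null_chars" using \<xi>(1) by (simp add: null_chars_def)
next
  fix \<xi> assume \<xi>: "\<xi> \<in> null_chars"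
  note A = null_chars_alg[OF \<xi>]
  define \<epsilon> where "\<epsilon> n = cmod (\<xi> (g n) - 1)" for n
  have "(\<lambda>n. \<xi> (g n) - 1) \<longlonglongrightarrow> 1 - 1" using \<xi> by (intro tendsto_diff) (simp_all add: null_chars_def)
  then have \<epsilon>: "\<epsilon> \<longlonglongrightarrow> 0" unfolding \<epsilon>_def using tendsto_norm_zero by simp
  have \<xi>\<epsilon>: "\<xi> \<in> null_ball \<epsilon>" using A by (simp add: null_ball_def \<epsilon>_def)
  have "continuous_map seq_top torus_topology \<xi>"
  proof (rule continuous_map_torusI)
    show "cmod (\<xi> x) = 1" if "x \<in> topspace seq_top" for x using that char_norm[OF A] by simp
    fix x and r :: real assume x: "x \<in> topspace seq_top" and r: "r > 0"
    obtain U where "openin seq_top U" "x \<in> U" "U \<subseteq> polar_nbhd \<epsilon> r x"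
      using polar_nbhd_contains_open[OF \<epsilon> r x[unfolded topspace_seq_top]] by (elim exE conjE)
    then show "\<exists>U. openin seq_top U \<and> x \<in> U \<and> (\<forall>y\<in>U. cmod (\<xi> y - \<xi> x) < r)"
      using \<xi>\<epsilon> unfolding polar_nbhd_def by blast
  qed
  then show "\<xi> \<in> characters G seq_top" using A by (simp add: characters_def alg_chars_def)
qed

lemma null_char_continuous: "\<xi> \<in> null_chars \<Longrightarrow> continuous_map seq_top torus_topology \<xi>"
  using characters_seq_top by (auto simp: characters_def)

text \<open>Total boundedness, uniformly over the characters of a null ball: questions about C are
  reduced to finitely many of its points.\<close>

lemma compactin_finite_net:
  assumes C: "compactin seq_top C" and \<epsilon>: "\<epsilon> \<longlonglongrightarrow> 0" and r: "r > 0"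
  shows "\<exists>Y. finite Y \<and> Y \<subseteq> C \<and> (\<forall>c\<in>C. \<exists>y\<in>Y. \<forall>\<xi>\<in>null_ball \<epsilon>. cmod (\<xi> c - \<xi> y) < r)"
proof -
  have CG: "C \<subseteq> carrier G" using compactin_subset_topspace[OF C] by simp
  have "\<forall>x\<in>C. \<exists>U. openin seq_top U \<and> x \<in> U \<and> U \<subseteq> polar_nbhd \<epsilon> r x"
    using polar_nbhd_contains_open[OF \<epsilon> r] CG by blast
  then obtain U where U: "\<And>x. x \<in> C \<Longrightarrow> openin seq_top (U x)" "\<And>x. x \<in> C \<Longrightarrow> x \<in> U x"
    "\<And>x. x \<in> C \<Longrightarrow> U x \<subseteq> polar_nbhd \<epsilon> r x" by metis
  have "\<exists>\<F>. finite \<F> \<and> \<F> \<subseteq> U ` C \<and> C \<subseteq> \<Union>\<F>"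
    using C U(1,2) unfolding compactin_def by (elim conjE allE[of _ "U ` C"]) blast
  then obtain Y where Y: "finite Y" "Y \<subseteq> C" "C \<subseteq> (\<Union>y\<in>Y. U y)" by (metis finite_subset_image)
  have "\<exists>y\<in>Y. \<forall>\<xi>\<in>null_ball \<epsilon>. cmod (\<xi> c - \<xi> y) < r" if c: "c \<in> C" for c
  proof -
    obtain y where y: "y \<in> Y" "c \<in> U y" using subsetD[OF Y(3) c] by (elim UN_E)
    then have "c \<in> polar_nbhd \<epsilon> r y" using U(3) Y(2) by blast
    then show ?thesis using y(1) unfolding polar_nbhd_def by blast
  qed
  then show ?thesis using Y by blast
qed

text \<open>In particular the subgroup generated by the sequence is open.\<close>

lemma null_ball_zero_polar:
  assumes "x \<in> polar_nbhd (\<lambda>_. 0) 1 y" and y: "y \<in> carrier G"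
  shows "x \<otimes> inv y \<in> generate G (range g)"
proof (rule ccontr)
  have sub: "subgroup (generate G (range g)) G" using g_closed by (intro generate_is_subgroup) auto
  have x: "x \<in> carrier G" using assms(1) by (simp add: polar_nbhd_def)
  assume notin: "x \<otimes> inv y \<notin> generate G (range g)"
  then obtain \<xi> where \<xi>: "\<xi> \<in> alg_chars G" "\<forall>h\<in>generate G (range g). \<xi> h = 1" "\<xi> (x \<otimes> inv y) \<noteq> 1"
    using character_separates[OF sub m_closed[OF x inv_closed[OF y]] notin] by (elim bexE conjE)
  define w where "w = \<xi> (x \<otimes> inv y)"
  have w1: "cmod w = 1" using char_norm[OF \<xi>(1)] x y by (simp add: w_def)
  \<comment> \<open>All powers of \<xi> are trivial along g, hence in the ball of rate 0. So all
    powers of w are within 1 of 1, which forces w = 1.\<close>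
  have "cmod (w ^ k - 1) < 1" for k
  proof -
    define \<beta> where "\<beta> = (\<lambda>h\<in>carrier G. \<xi> h ^ k)"
    have "\<beta> \<in> alg_chars G"
      by (rule alg_charsI)
        (simp_all add: \<beta>_def norm_power char_norm[OF \<xi>(1)] char_mult_hom[OF \<xi>(1)] power_mult_distrib)
    moreover have "\<beta> (g n) = 1" for n
      using \<xi>(2) g_closed by (simp add: \<beta>_def generate.incl)
    ultimately have "\<beta> \<in> null_ball (\<lambda>_. 0)" by (simp add: null_ball_def)
    then have lt: "cmod (\<beta> x - \<beta> y) < 1" using assms(1) by (simp add: polar_nbhd_def)
    have "\<beta> x - \<beta> y = (w ^ k - 1) * \<beta> y"
    proof -
      have "w * \<xi> y = \<xi> x"
        unfolding w_def using x y char_mult_hom[OF \<xi>(1), of "x \<otimes> inv y" y] by (simp add: m_assoc)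
      then have "\<beta> x = w ^ k * \<beta> y" using x y by (simp add: \<beta>_def power_mult_distrib[symmetric])
      then show ?thesis by (simp add: algebra_simps)
    qed
    moreover have "cmod (\<beta> y) = 1" using y char_norm[OF \<xi>(1)] by (simp add: \<beta>_def norm_power)
    ultimately show ?thesis using lt by (simp add: norm_mult)
  qed
  then have "w = 1" using unit_powers_leave w1 by blast
  then show False using \<xi>(3) by (simp add: w_def)
qed

lemma tends_one_on_generated:
  assumes \<xi>: "\<And>j::nat. \<xi> j \<in> alg_chars G" and lim: "\<And>n. (\<lambda>j. \<xi> j (g n)) \<longlonglongrightarrow> 1"
    and h: "h \<in> generate G (range g)"
  shows "(\<lambda>j. \<xi> j h) \<longlonglongrightarrow> 1"
  using h
proof induction
  case one
  then show ?case by (simp add: char_at_one[OF \<xi>])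
next
  case (incl h)
  then show ?case using lim by auto
next
  case (inv h)
  then obtain n where n: "h = g n" by auto
  have "(\<lambda>j. cnj (\<xi> j (g n))) \<longlonglongrightarrow> cnj 1" by (intro tendsto_cnj lim)
  then show ?case by (simp add: n char_at_inv[OF \<xi> g_closed])
next
  case (eng h1 h2)
  have "range g \<subseteq> carrier G" using g_closed by auto
  then have c: "h1 \<in> carrier G" "h2 \<in> carrier G" using eng.hyps generate_in_carrier by blast+
  have "(\<lambda>j. \<xi> j h1 * \<xi> j h2) \<longlonglongrightarrow> 1 * 1" by (intro tendsto_mult eng.IH)
  then show ?case by (simp add: char_mult_hom[OF \<xi> c])
qed

text \<open>Brings neighbourhoods of the trivial character in the dual into the form of
  \<open>\<psi>_cont\<close>. Counterexamples \<open>\<xi> j\<close> tending to 1 at finitely many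
  points and uniformly along g tend to 1 at each point of C and lie in one common null ball; a
  finite net of C for the rate of that ball turns this into uniform convergence on C.\<close>

lemma compactin_equicontinuous:
  assumes C: "compactin seq_top C" and \<eta>: "\<eta> > 0"
  shows "\<exists>F \<epsilon>. finite F \<and> F \<subseteq> carrier G \<and> \<epsilon> > 0 \<and>
    (\<forall>\<xi>\<in>null_chars. (\<forall>x\<in>F. cmod (\<xi> x - 1) \<le> \<epsilon>) \<and> (\<forall>n. cmod (\<xi> (g n) - 1) \<le> \<epsilon>) \<longrightarrow>
      (\<forall>c\<in>C. cmod (\<xi> c - 1) < \<eta>))"
proof (rule ccontr)
  assume no: "\<not> ?thesis"
  have CG: "C \<subseteq> carrier G" using compactin_subset_topspace[OF C] by simp
  \<comment> \<open>With rate 0, Y meets every coset of the subgroup generated by g that C meets, by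
    \<open>null_ball_zero_polar\<close>. So limits along g and on Y determine limits at every point
    of C.\<close>
  obtain Y where Y: "finite Y" "Y \<subseteq> C"
    "\<And>c. c \<in> C \<Longrightarrow> \<exists>y\<in>Y. \<forall>\<xi>\<in>null_ball (\<lambda>_. 0). cmod (\<xi> c - \<xi> y) < 1"
    using compactin_finite_net[OF C tendsto_const, of 1] by auto
  define e where "e j = 1 / real (Suc j)" for j
  have e: "e j > 0" for j by (simp add: e_def)
  have e_lim: "e \<longlonglongrightarrow> 0" unfolding e_def by (rule lim_1_over_n[THEN LIMSEQ_Suc])
  have "\<exists>\<xi>\<in>null_chars. (\<forall>x\<in>Y. cmod (\<xi> x - 1) \<le> e j) \<and> (\<forall>n. cmod (\<xi> (g n) - 1) \<le> e j) \<and>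
      (\<exists>c\<in>C. \<not> cmod (\<xi> c - 1) < \<eta>)" for j
  proof (rule ccontr)
    assume none: "\<not> ?thesis"
    have "finite Y \<and> Y \<subseteq> carrier G \<and> e j > 0 \<and>
      (\<forall>\<xi>\<in>null_chars. (\<forall>x\<in>Y. cmod (\<xi> x - 1) \<le> e j) \<and> (\<forall>n. cmod (\<xi> (g n) - 1) \<le> e j) \<longrightarrow>
        (\<forall>c\<in>C. cmod (\<xi> c - 1) < \<eta>))"
    proof (intro conjI ballI impI Y(1) e order_trans[OF Y(2) CG])
      fix \<xi> c
      assume a: "\<xi> \<in> null_chars" "(\<forall>x\<in>Y. cmod (\<xi> x - 1) \<le> e j) \<and> (\<forall>n. cmod (\<xi> (g n) - 1) \<le> e j)" "c \<in> C"
      show "cmod (\<xi> c - 1) < \<eta>"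
      proof (rule ccontr)
        assume "\<not> cmod (\<xi> c - 1) < \<eta>"
        then have "\<exists>\<xi>\<in>null_chars. (\<forall>x\<in>Y. cmod (\<xi> x - 1) \<le> e j) \<and> (\<forall>n. cmod (\<xi> (g n) - 1) \<le> e j) \<and>
          (\<exists>c\<in>C. \<not> cmod (\<xi> c - 1) < \<eta>)"
          using a by (intro bexI[of _ \<xi>] conjI bexI[of _ c]) simp_all
        then show False using none by (rule notE[rotated])
      qed
    qed
    from notE[OF no, OF exI, OF exI, OF this] show False .
  qed
  then obtain \<xi> where \<xi>: "\<And>j. \<xi> j \<in> null_chars" "\<And>j x. x \<in> Y \<Longrightarrow> cmod (\<xi> j x - 1) \<le> e j"
    "\<And>j n. cmod (\<xi> j (g n) - 1) \<le> e j" and bad: "\<And>j. \<exists>c\<in>C. \<not> cmod (\<xi> j c - 1) < \<eta>" by metis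
  note A = null_chars_alg[OF \<xi>(1)]
  have tends: "(\<lambda>j. \<xi> j x) \<longlonglongrightarrow> 1" if "\<And>j. cmod (\<xi> j x - 1) \<le> e j" for x
  proof -
    have "(\<lambda>j. \<xi> j x - 1) \<longlonglongrightarrow> 0" by (rule Lim_null_comparison[OF _ e_lim]) (simp add: that)
    then show ?thesis by (simp add: LIM_zero_iff)
  qed
  have lim_C: "(\<lambda>j. \<xi> j c) \<longlonglongrightarrow> 1" if c: "c \<in> C" for c
  proof -
    obtain y where y: "y \<in> Y" "\<forall>\<xi>\<in>null_ball (\<lambda>_. 0). cmod (\<xi> c - \<xi> y) < 1" using Y(3)[OF c] by blast
    have cy: "c \<in> carrier G" "y \<in> carrier G" using c y Y(2) CG by blast+
    then have "c \<in> polar_nbhd (\<lambda>_. 0) 1 y" using y(2) by (simp add: polar_nbhd_def)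
    then have "c \<otimes> inv y \<in> generate G (range g)" using null_ball_zero_polar cy by blast
    then have "(\<lambda>j. \<xi> j (c \<otimes> inv y)) \<longlonglongrightarrow> 1"
      by (rule tends_one_on_generated[OF A tends[OF \<xi>(3)]])
    moreover have "(\<lambda>j. \<xi> j y) \<longlonglongrightarrow> 1" by (rule tends[OF \<xi>(2)[OF y(1)]])
    ultimately have "(\<lambda>j. \<xi> j (c \<otimes> inv y) * \<xi> j y) \<longlonglongrightarrow> 1 * 1" by (rule tendsto_mult)
    moreover have "\<xi> j (c \<otimes> inv y) * \<xi> j y = \<xi> j c" for j
      using cy char_mult_hom[OF A, of "c \<otimes> inv y" y j] by (simp add: m_assoc)
    ultimately show ?thesis by simp
  qed
  \<comment> \<open>A common rate for all \<open>\<xi> j\<close>. It tends to 0 since all but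
    finitely many of them are uniformly small along g and each of the others tends to 1.\<close>
  define \<mu> where "\<mu> n = (SUP j. cmod (\<xi> j (g n) - 1))" for n
  have bdd: "bdd_above (range (\<lambda>j. cmod (\<xi> j (g n) - 1)))" for n
    by (rule bdd_aboveI2[where M = 2]) (rule char_dist_le_2[OF A g_closed])
  have \<mu>_upper: "cmod (\<xi> j (g n) - 1) \<le> \<mu> n" for j n
    unfolding \<mu>_def by (rule cSUP_upper[OF _ bdd]) simp
  have \<mu>: "\<mu> \<longlonglongrightarrow> 0"
  proof (rule LIMSEQ_I)
    fix r :: real assume r: "r > 0"
    have "eventually (\<lambda>j. e j < r / 2) sequentially"
      using order_tendstoD(2)[OF e_lim, of "r / 2"] r by simp
    then obtain J where J: "\<And>j. j \<ge> J \<Longrightarrow> e j < r / 2" unfolding eventually_sequentially by blast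
    have "\<forall>j. \<exists>N. \<forall>n\<ge>N. cmod (\<xi> j (g n) - 1) < r / 2" by (intro allI null_charsD[OF \<xi>(1) half_gt_zero[OF r]])
    then obtain N where N: "\<And>j n. n \<ge> N j \<Longrightarrow> cmod (\<xi> j (g n) - 1) < r / 2" by metis
    define M where "M = Max (N ` {..J})"
    have "norm (\<mu> n - 0) < r" if n: "n \<ge> M" for n
    proof -
      have "cmod (\<xi> j (g n) - 1) \<le> r / 2" for j
      proof (cases "j \<le> J")
        case True
        then have "N j \<le> M" by (simp add: M_def)
        then show ?thesis using N[of j n] n by simp
      next
        case False
        then show ?thesis using J[of j] \<xi>(3)[of j n] by simp
      qed
      then have "\<mu> n \<le> r / 2" unfolding \<mu>_def by (intro cSUP_least) auto
      moreover have "0 \<le> \<mu> n" by (rule order_trans[OF norm_ge_zero \<mu>_upper[of 0 n]])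
      ultimately show ?thesis using r by simp
    qed
    then show "\<exists>M. \<forall>n\<ge>M. norm (\<mu> n - 0) < r" by blast
  qed
  have \<xi>\<mu>: "\<xi> j \<in> null_ball \<mu>" for j using A \<mu>_upper by (simp add: null_ball_def)
  obtain Z where Z: "finite Z" "Z \<subseteq> C"
    "\<And>c. c \<in> C \<Longrightarrow> \<exists>y\<in>Z. \<forall>\<xi>\<in>null_ball \<mu>. cmod (\<xi> c - \<xi> y) < \<eta> / 2"
    using compactin_finite_net[OF C \<mu>, of "\<eta> / 2"] \<eta> by auto
  have "eventually (\<lambda>j. \<forall>y\<in>Z. cmod (\<xi> j y - 1) < \<eta> / 2) sequentially"
  proof (intro eventually_ball_finite Z(1) ballI)
    fix y assume "y \<in> Z"
    then have "(\<lambda>j. \<xi> j y) \<longlonglongrightarrow> 1" using lim_C Z(2) by (meson subsetD)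
    from tendstoD[OF this, of "\<eta> / 2"] \<eta>
    show "eventually (\<lambda>j. cmod (\<xi> j y - 1) < \<eta> / 2) sequentially" by (simp add: dist_norm)
  qed
  then obtain j where j: "\<And>y. y \<in> Z \<Longrightarrow> cmod (\<xi> j y - 1) < \<eta> / 2"
    unfolding eventually_sequentially by blast
  obtain c where c: "c \<in> C" "\<not> cmod (\<xi> j c - 1) < \<eta>" using bad by blast
  obtain y where y: "y \<in> Z" "\<forall>\<xi>\<in>null_ball \<mu>. cmod (\<xi> c - \<xi> y) < \<eta> / 2" using Z(3)[OF c(1)] by blast
  have "cmod (\<xi> j c - \<xi> j y) < \<eta> / 2" using y(2) \<xi>\<mu> by blast
  then have "cmod (\<xi> j c - 1) < \<eta>"
    using norm_triangle_ineq[of "\<xi> j c - \<xi> j y" "\<xi> j y - 1"] j[OF y(1)] by simp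
  then show False using c(2) by blast
qed

end

section \<open>Reflexivity\<close>

context interpolating_sequence
begin

section \<open>The dual group and its compact subsets\<close>

abbreviation dual where "dual \<equiv> dual_group G seq_top"
abbreviation dual_top where "dual_top \<equiv> dual_topology G seq_top"
abbreviation eval_map where "eval_map \<equiv> canonical_map G seq_top"

lemma dual_top_eq: "dual_top = compact_open_topology seq_top torus_topology null_chars"
  by (simp add: dual_topology_def characters_seq_top)

lemma topspace_dual_top [simp]: "topspace dual_top = null_chars"
  by (simp add: dual_top_eq)

lemma dual_simps [simp]:
  "carrier dual = null_chars" "\<xi> \<otimes>\<^bsub>dual\<^esub> \<beta> = char_mult G \<xi> \<beta>"
  by (simp_all add: dual_group_def characters_seq_top char_mult_def)

lemma eval_map_apply: "\<xi> \<in> null_chars \<Longrightarrow> eval_map x \<xi> = \<xi> x"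
  by (simp add: canonical_map_def characters_seq_top)

lemma eval_map_extensional: "eval_map x \<in> extensional null_chars"
  by (simp add: canonical_map_def characters_seq_top)

lemma dual_top_contains_uniform_nbhd:
  assumes "openin dual_top W" "\<xi> \<in> W"
  shows "\<exists>K r. compactin seq_top K \<and> r > 0 \<and>
    (\<forall>\<beta>\<in>null_chars. (\<forall>x\<in>K. cmod (\<beta> x - \<xi> x) < r) \<longrightarrow> \<beta> \<in> W)"
  by (rule compact_open_contains_uniform_nbhd[OF null_char_continuous assms[unfolded dual_top_eq]])

lemma uniform_nbhd_contains_dual_top:
  assumes "\<xi> \<in> null_chars" "compactin seq_top K" "r > 0"
  shows "\<exists>W. openin dual_top W \<and> \<xi> \<in> W \<and> (\<forall>\<beta>\<in>W. \<forall>x\<in>K. cmod (\<beta> x - \<xi> x) < r)"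
  unfolding dual_top_eq
  by (rule uniform_nbhd_contains_compact_open[OF assms(1) null_char_continuous[OF assms(1)] assms(2,3)])

lemma compact_null_ball: "compact (null_ball \<epsilon>)"
proof -
  have "closed (\<Inter>n. {\<xi> :: 'a \<Rightarrow> complex. cmod (\<xi> (g n) - 1) \<le> \<epsilon> n})"
    by (intro closed_INT ballI closed_Collect_le continuous_on_norm continuous_on_diff
        continuous_on_product_coordinates continuous_on_const)
  then have "compact (alg_chars G \<inter> (\<Inter>n. {\<xi>. cmod (\<xi> (g n) - 1) \<le> \<epsilon> n}))"
    by (rule compact_Int_closed[OF compact_alg_chars])
  also have "alg_chars G \<inter> (\<Inter>n. {\<xi>. cmod (\<xi> (g n) - 1) \<le> \<epsilon> n}) = null_ball \<epsilon>"
    by (auto simp: null_ball_def)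
  finally show ?thesis .
qed

text \<open>On the ball a compact C is controlled by a finite net, so there the compact-open
  topology is no finer than the pointwise one, for which the ball is compact.\<close>

lemma compactin_null_ball:
  assumes \<epsilon>: "\<epsilon> \<longlonglongrightarrow> 0"
  shows "compactin dual_top (null_ball \<epsilon>)"
proof -
  have "continuous_map (top_of_set (null_ball \<epsilon>)) dual_top (\<lambda>\<xi>. \<xi>)"
    unfolding continuous_map_def
  proof (intro conjI allI impI)
    show "(\<lambda>\<xi>. \<xi>) \<in> topspace (top_of_set (null_ball \<epsilon>)) \<rightarrow> topspace dual_top"
      using null_ball_subset[OF \<epsilon>] by auto
    fix W assume W: "openin dual_top W"
    show "openin (top_of_set (null_ball \<epsilon>)) {\<xi> \<in> topspace (top_of_set (null_ball \<epsilon>)). \<xi> \<in> W}"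
    proof (subst openin_subopen, intro ballI)
      fix \<xi> assume "\<xi> \<in> {\<xi> \<in> topspace (top_of_set (null_ball \<epsilon>)). \<xi> \<in> W}"
      then have \<xi>: "\<xi> \<in> null_ball \<epsilon>" "\<xi> \<in> W" by auto
      obtain C r where C: "compactin seq_top C" and r: "r > 0"
        and sub: "\<forall>\<beta>\<in>null_chars. (\<forall>x\<in>C. cmod (\<beta> x - \<xi> x) < r) \<longrightarrow> \<beta> \<in> W"
        using dual_top_contains_uniform_nbhd[OF W \<xi>(2)] by (elim exE conjE)
      obtain Y where Y: "finite Y" "Y \<subseteq> C"
        "\<forall>c\<in>C. \<exists>y\<in>Y. \<forall>\<xi>\<in>null_ball \<epsilon>. cmod (\<xi> c - \<xi> y) < r / 3"
        using compactin_finite_net[OF C \<epsilon> divide_pos_pos[OF r zero_less_numeral[of "num.Bit1 num.One"]]] by (elim exE conjE)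
      define T where "T = (\<Inter>y\<in>Y. {\<beta>. cmod (\<beta> y - \<xi> y) < r / 3})"
      have "open T" unfolding T_def
        by (intro open_INT Y(1) ballI open_Collect_less continuous_on_norm continuous_on_diff
            continuous_on_product_coordinates continuous_on_const)
      then have "openin (top_of_set (null_ball \<epsilon>)) (null_ball \<epsilon> \<inter> T)" by (rule openin_open_Int)
      moreover have "\<xi> \<in> null_ball \<epsilon> \<inter> T" using \<xi> r by (simp add: T_def)
      moreover have "\<beta> \<in> W" if \<beta>: "\<beta> \<in> null_ball \<epsilon>" "\<beta> \<in> T" for \<beta>
      proof (rule sub[rule_format])
        show "\<beta> \<in> null_chars" using \<beta>(1) null_ball_subset[OF \<epsilon>] by blast
        fix c assume c: "c \<in> C"
        obtain y where y: "y \<in> Y" "\<forall>\<xi>\<in>null_ball \<epsilon>. cmod (\<xi> c - \<xi> y) < r / 3"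
          using bspec[OF Y(3) c] by (elim bexE)
        have 1: "cmod (\<beta> c - \<beta> y) < r / 3" by (rule bspec[OF y(2) \<beta>(1)])
        have 3: "cmod (\<xi> y - \<xi> c) < r / 3"
          unfolding norm_minus_commute[of "\<xi> y"] by (rule bspec[OF y(2) \<xi>(1)])
        have 2: "cmod (\<beta> y - \<xi> y) < r / 3" using \<beta>(2) y(1) by (simp add: T_def)
        show "cmod (\<beta> c - \<xi> c) < r"
          using norm_triangle_ineq[of "\<beta> c - \<beta> y" "\<beta> y - \<xi> c"]
            norm_triangle_ineq[of "\<beta> y - \<xi> y" "\<xi> y - \<xi> c"] 1 2 3 by simp
      qed
      ultimately show "\<exists>T. openin (top_of_set (null_ball \<epsilon>)) T \<and> \<xi> \<in> T \<and>
          T \<subseteq> {\<xi> \<in> topspace (top_of_set (null_ball \<epsilon>)). \<xi> \<in> W}"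
        by (intro exI[of _ "null_ball \<epsilon> \<inter> T"]) auto
    qed
  qed
  moreover have "compactin (top_of_set (null_ball \<epsilon>)) (null_ball \<epsilon>)"
    by (simp add: compactin_subtopology compact_null_ball)
  ultimately have "compactin dual_top ((\<lambda>\<xi>. \<xi>) ` null_ball \<epsilon>)" by (rule image_compactin[rotated])
  then show ?thesis by simp
qed

text \<open>The sequence with its limit is compact in G, so finitely many sets of characters
  uniformly close along g cover Q. Their finitely many centres tend to 1, whence the supremum over Q
  tends to 0.\<close>

lemma compactin_dual_top_subset_null_ball:
  assumes Q: "compactin dual_top Q"
  shows "\<exists>\<epsilon>. \<epsilon> \<longlonglongrightarrow> 0 \<and> Q \<subseteq> null_ball \<epsilon>"
\<comment> \<open>The supremum that defines \<epsilon> is meaningful only for nonempty Q.\<close>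
proof (cases "Q = {}")
  case True
  then show ?thesis using tendsto_const by blast
next
  case False
  have QS: "Q \<subseteq> null_chars" using compactin_subset_topspace[OF Q] by simp
  have K: "compactin seq_top (insert \<one> (range g))"
    by (rule compactin_sequence_with_limit[OF seq_limitin_one]) (use g_closed in auto)
  define \<epsilon> where "\<epsilon> n = (SUP \<xi>\<in>Q. cmod (\<xi> (g n) - 1))" for n
  have bdd: "bdd_above ((\<lambda>\<xi>. cmod (\<xi> (g n) - 1)) ` Q)" for n
  proof (rule bdd_aboveI2)
    fix \<xi> assume "\<xi> \<in> Q"
    then have "\<xi> \<in> alg_chars G" using QS null_chars_alg by blast
    then show "cmod (\<xi> (g n) - 1) \<le> 2" by (rule char_dist_le_2[OF _ g_closed])
  qed
  have upper: "cmod (\<xi> (g n) - 1) \<le> \<epsilon> n" if "\<xi> \<in> Q" for \<xi> n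
    unfolding \<epsilon>_def by (rule cSUP_upper[OF that bdd])
  have "\<epsilon> \<longlonglongrightarrow> 0"
  proof (rule LIMSEQ_I)
    fix r :: real assume r: "r > 0"
    have "\<forall>\<xi>\<in>Q. \<exists>W. openin dual_top W \<and> \<xi> \<in> W \<and> (\<forall>\<beta>\<in>W. \<forall>x\<in>insert \<one> (range g). cmod (\<beta> x - \<xi> x) < r / 4)"
    proof
      fix \<xi> assume "\<xi> \<in> Q"
      then have "\<xi> \<in> null_chars" using QS by blast
      then show "\<exists>W. openin dual_top W \<and> \<xi> \<in> W \<and> (\<forall>\<beta>\<in>W. \<forall>x\<in>insert \<one> (range g). cmod (\<beta> x - \<xi> x) < r / 4)"
        by (rule uniform_nbhd_contains_dual_top[OF _ K]) (use r in simp)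
    qed
    then obtain W where W: "\<forall>\<xi>\<in>Q. openin dual_top (W \<xi>) \<and> \<xi> \<in> W \<xi> \<and>
        (\<forall>\<beta>\<in>W \<xi>. \<forall>x\<in>insert \<one> (range g). cmod (\<beta> x - \<xi> x) < r / 4)"
      by (rule bchoice[THEN exE])
    have "\<exists>\<F>. finite \<F> \<and> \<F> \<subseteq> W ` Q \<and> Q \<subseteq> \<Union>\<F>"
      using Q W unfolding compactin_def by (elim conjE allE[of _ "W ` Q"]) blast
    then obtain Y where Y: "finite Y" "Y \<subseteq> Q" "Q \<subseteq> (\<Union>\<xi>\<in>Y. W \<xi>)" by (metis finite_subset_image)
    have "\<forall>\<xi>\<in>Y. eventually (\<lambda>n. cmod (\<xi> (g n) - 1) < r / 4) sequentially"
    proof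
      fix \<xi> assume "\<xi> \<in> Y"
      then have "\<xi> \<in> null_chars" using Y(2) QS by blast
      from null_charsD[OF this, of "r / 4"] r
      show "eventually (\<lambda>n. cmod (\<xi> (g n) - 1) < r / 4) sequentially"
        unfolding eventually_sequentially by simp
    qed
    then have "eventually (\<lambda>n. \<forall>\<xi>\<in>Y. cmod (\<xi> (g n) - 1) < r / 4) sequentially"
      by (intro eventually_ball_finite Y(1))
    then obtain N where N: "\<And>n \<xi>. n \<ge> N \<Longrightarrow> \<xi> \<in> Y \<Longrightarrow> cmod (\<xi> (g n) - 1) < r / 4"
      unfolding eventually_sequentially by (elim exE) blast
    have "norm (\<epsilon> n - 0) < r" if n: "n \<ge> N" for n
    proof -
      have "cmod (\<beta> (g n) - 1) \<le> r / 2" if \<beta>: "\<beta> \<in> Q" for \<beta>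
      proof -
        obtain \<xi> where \<xi>: "\<xi> \<in> Y" "\<beta> \<in> W \<xi>" using subsetD[OF Y(3) \<beta>] by (elim UN_E)
        have \<xi>Q: "\<xi> \<in> Q" using \<xi>(1) Y(2) by blast
        have "\<forall>x\<in>insert \<one> (range g). cmod (\<beta> x - \<xi> x) < r / 4"
          using bspec[OF W \<xi>Q, THEN conjunct2, THEN conjunct2] \<xi>(2) by (rule bspec)
        then have "cmod (\<beta> (g n) - \<xi> (g n)) < r / 4" by simp
        then show ?thesis
          using norm_triangle_ineq[of "\<beta> (g n) - \<xi> (g n)" "\<xi> (g n) - 1"] N[OF n \<xi>(1)] by simp
      qed
      then have "\<epsilon> n \<le> r / 2" unfolding \<epsilon>_def using False by (intro cSUP_least)
      moreover obtain \<xi> where "\<xi> \<in> Q" using False by blast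
      then have "0 \<le> \<epsilon> n" by (rule order_trans[OF norm_ge_zero upper])
      ultimately show ?thesis using r by simp
    qed
    then show "\<exists>N. \<forall>n\<ge>N. norm (\<epsilon> n - 0) < r" by blast
  qed
  moreover have "Q \<subseteq> null_ball \<epsilon>"
  proof
    fix \<xi> assume \<xi>: "\<xi> \<in> Q"
    then show "\<xi> \<in> null_ball \<epsilon>" unfolding null_ball_def using upper[OF \<xi>] QS null_chars_alg by blast
  qed
  ultimately show ?thesis by blast
qed

section \<open>The bidual and the canonical map\<close>

lemma eval_map_character:
  assumes x: "x \<in> carrier G"
  shows "eval_map x \<in> characters dual dual_top"
proof -
  have xK: "compactin seq_top {x}" using x by simp
  have "eval_map x \<in> hom dual torus_group"
  proof (rule homI)
    show "eval_map x \<xi> \<in> carrier torus_group" if "\<xi> \<in> carrier dual" for \<xi>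
      using that x by (simp add: eval_map_apply char_norm null_chars_alg)
    show "eval_map x (\<xi> \<otimes>\<^bsub>dual\<^esub> \<beta>) = eval_map x \<xi> \<otimes>\<^bsub>torus_group\<^esub> eval_map x \<beta>"
      if "\<xi> \<in> carrier dual" "\<beta> \<in> carrier dual" for \<xi> \<beta>
      using that x by (simp add: eval_map_apply null_chars_mult char_mult_apply)
  qed
  moreover have "continuous_map dual_top torus_topology (eval_map x)"
  proof (rule continuous_map_torusI)
    show "cmod (eval_map x \<xi>) = 1" if "\<xi> \<in> topspace dual_top" for \<xi>
      using that x by (simp add: eval_map_apply char_norm null_chars_alg)
    fix \<xi> and r :: real assume "\<xi> \<in> topspace dual_top" and r: "r > 0"
    then have \<xi>: "\<xi> \<in> null_chars" by simp
    obtain W where W: "openin dual_top W" "\<xi> \<in> W" "\<forall>\<beta>\<in>W. \<forall>y\<in>{x}. cmod (\<beta> y - \<xi> y) < r"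
      using uniform_nbhd_contains_dual_top[OF \<xi> xK r] by (elim exE conjE)
    have "cmod (eval_map x \<beta> - eval_map x \<xi>) < r" if \<beta>: "\<beta> \<in> W" for \<beta>
    proof -
      have "\<beta> \<in> null_chars" using openin_subset[OF W(1)] \<beta> by auto
      then show ?thesis using bspec[OF W(3) \<beta>] \<xi> by (simp add: eval_map_apply)
    qed
    then show "\<exists>W. openin dual_top W \<and> \<xi> \<in> W \<and> (\<forall>\<beta>\<in>W. cmod (eval_map x \<beta> - eval_map x \<xi>) < r)"
      using W(1,2) by blast
  qed
  ultimately show ?thesis by (simp add: characters_def eval_map_extensional)
qed

text \<open>\<open>compactin_equicontinuous\<close> turns compact-open continuity into
  \<open>\<psi>_cont\<close>, which makes \<psi> an instance of
  \<open>null_chars_hom\<close>.\<close>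

lemma bidual_character_is_evaluation:
  assumes \<psi>: "\<psi> \<in> characters dual dual_top"
  shows "\<exists>x\<in>carrier G. \<psi> = eval_map x"
proof -
  have ext: "\<psi> \<in> extensional null_chars" and hom: "\<psi> \<in> hom dual torus_group"
    and cont: "continuous_map dual_top torus_topology \<psi>"
    using \<psi> by (simp_all add: characters_def)
  have mult: "\<psi> (char_mult G \<xi> \<beta>) = \<psi> \<xi> * \<psi> \<beta>" if "\<xi> \<in> null_chars" "\<beta> \<in> null_chars" for \<xi> \<beta>
    using hom_mult[OF hom, of \<xi> \<beta>] that by simp
  have norm: "cmod (\<psi> \<xi>) = 1" if "\<xi> \<in> null_chars" for \<xi>
    using hom_in_carrier[OF hom, of \<xi>] that by simp
  have one: "\<psi> (char_one G) = 1"
    by (rule multiplicative_at_char_one[OF mult[OF null_chars_one null_chars_one] norm[OF null_chars_one]])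
  interpret null_chars_hom G g \<psi>
  proof unfold_locales
    show "cmod (\<psi> \<xi>) = 1" if "\<xi> \<in> null_chars" for \<xi> using norm[OF that] .
    show "\<psi> (char_mult G \<xi> \<beta>) = \<psi> \<xi> * \<psi> \<beta>" if "\<xi> \<in> null_chars" "\<beta> \<in> null_chars" for \<xi> \<beta>
      using mult[OF that] .
    fix \<eta> :: real assume \<eta>: "\<eta> > 0"
    define W where "W = {\<xi> \<in> topspace dual_top. cmod (\<psi> \<xi> - 1) < \<eta>}"
    have W: "openin dual_top W" unfolding W_def by (rule openin_torus_ball[OF cont])
    have "char_one G \<in> W" using one \<eta> null_chars_one by (simp add: W_def)
    from dual_top_contains_uniform_nbhd[OF W this] obtain C r where
      C: "compactin seq_top C" and r: "r > 0"
      and sub: "\<forall>\<beta>\<in>null_chars. (\<forall>x\<in>C. cmod (\<beta> x - char_one G x) < r) \<longrightarrow> \<beta> \<in> W"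
      by (elim exE conjE)
    have CG: "C \<subseteq> carrier G" using compactin_subset_topspace[OF C] by simp
    obtain F \<epsilon> where F: "finite F" "F \<subseteq> carrier G" "\<epsilon> > 0" and
      near: "\<forall>\<xi>\<in>null_chars. (\<forall>x\<in>F. cmod (\<xi> x - 1) \<le> \<epsilon>) \<and> (\<forall>n. cmod (\<xi> (g n) - 1) \<le> \<epsilon>) \<longrightarrow>
        (\<forall>c\<in>C. cmod (\<xi> c - 1) < r)"
      using compactin_equicontinuous[OF C r] by (elim exE conjE)
    have "cmod (\<psi> \<xi> - 1) \<le> \<eta>"
      if \<xi>: "\<xi> \<in> null_chars" "(\<forall>x\<in>F. cmod (\<xi> x - 1) \<le> \<epsilon>) \<and> (\<forall>n. cmod (\<xi> (g n) - 1) \<le> \<epsilon>)" for \<xi>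
    proof -
      have Cr: "\<forall>c\<in>C. cmod (\<xi> c - 1) < r" using bspec[OF near \<xi>(1)] \<xi>(2) by (rule mp)
      have "\<xi> \<in> W"
      proof (rule sub[rule_format, OF \<xi>(1)])
        fix x assume x: "x \<in> C"
        then have "x \<in> carrier G" using CG by blast
        then show "cmod (\<xi> x - char_one G x) < r" using bspec[OF Cr x] by (simp add: char_one_apply)
      qed
      then show ?thesis by (simp add: W_def)
    qed
    then show "\<exists>F \<epsilon>. finite F \<and> F \<subseteq> carrier G \<and> \<epsilon> > 0 \<and>
      (\<forall>\<xi>\<in>null_chars. (\<forall>x\<in>F. cmod (\<xi> x - 1) \<le> \<epsilon>) \<and> (\<forall>n. cmod (\<xi> (g n) - 1) \<le> \<epsilon>) \<longrightarrow> cmod (\<psi> \<xi> - 1) \<le> \<eta>)"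
      using F by (intro exI[of _ F] exI[of _ \<epsilon>] conjI ballI impI)
  qed
  obtain d where d: "d \<in> carrier G" "\<forall>\<xi>\<in>null_chars. \<psi> \<xi> = \<xi> d"
    using null_chars_hom_is_evaluation by (elim bexE)
  have "\<psi> = eval_map d"
  proof (rule extensionalityI[OF ext eval_map_extensional])
    fix \<xi> assume \<xi>: "\<xi> \<in> null_chars"
    show "\<psi> \<xi> = eval_map d \<xi>" using bspec[OF d(2) \<xi>] by (simp add: eval_map_apply[OF \<xi>])
  qed
  then show ?thesis using d(1) by blast
qed

lemma eval_map_inj: "inj_on eval_map (carrier G)"
proof (rule inj_onI, rule ccontr)
  fix x y assume xy: "x \<in> carrier G" "y \<in> carrier G" "eval_map x = eval_map y" "x \<noteq> y"
  have "x \<otimes> inv y \<noteq> \<one>" using xy by (metis inv_equality inv_inv inv_closed)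
  then obtain \<xi> where \<xi>: "\<xi> \<in> null_chars" "\<xi> (x \<otimes> inv y) \<noteq> 1"
    using null_chars_separate[of "x \<otimes> inv y"] xy by auto
  note A = null_chars_alg[OF \<xi>(1)]
  have "\<xi> x = \<xi> y" using fun_cong[OF xy(3), of \<xi>] by (simp add: eval_map_apply[OF \<xi>(1)])
  moreover have "\<xi> y * cnj (\<xi> y) = 1" by (rule char_mult_cnj[OF A xy(2)])
  ultimately have "\<xi> (x \<otimes> inv y) = 1" using xy by (simp add: char_mult_hom[OF A] char_at_inv[OF A])
  then show False using \<xi>(2) by blast
qed

lemma eval_map_image: "eval_map ` carrier G = characters dual dual_top"
proof
  show "eval_map ` carrier G \<subseteq> characters dual dual_top"
    by (rule image_subsetI) (rule eval_map_character)
  show "characters dual dual_top \<subseteq> eval_map ` carrier G"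
  proof
    fix \<psi> assume "\<psi> \<in> characters dual dual_top"
    then obtain x where "x \<in> carrier G" "\<psi> = eval_map x" using bidual_character_is_evaluation by (elim bexE[rotated]) 
    then show "\<psi> \<in> eval_map ` carrier G" by (rule image_eqI[rotated])
  qed
qed

lemma eval_map_iso: "eval_map \<in> iso G (bidual_group G seq_top)"
proof -
  have "eval_map \<in> hom G (bidual_group G seq_top)"
  proof (rule homI)
    show "eval_map x \<in> carrier (bidual_group G seq_top)" if "x \<in> carrier G" for x
      using eval_map_character[OF that] by (simp add: dual_group_def[of dual])
    fix x y assume xy: "x \<in> carrier G" "y \<in> carrier G"
    show "eval_map (x \<otimes> y) = eval_map x \<otimes>\<^bsub>bidual_group G seq_top\<^esub> eval_map y"
    proof (rule extensionalityI[OF eval_map_extensional])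
      show "eval_map x \<otimes>\<^bsub>bidual_group G seq_top\<^esub> eval_map y \<in> extensional null_chars"
        by (simp add: dual_group_def[of dual])
      fix \<xi> assume \<xi>: "\<xi> \<in> null_chars"
      show "eval_map (x \<otimes> y) \<xi> = (eval_map x \<otimes>\<^bsub>bidual_group G seq_top\<^esub> eval_map y) \<xi>"
        using \<xi> xy char_mult_hom[OF null_chars_alg[OF \<xi>] xy] by (simp add: dual_group_def[of dual] eval_map_apply)
    qed
  qed
  moreover have "bij_betw eval_map (carrier G) (carrier (bidual_group G seq_top))"
    using eval_map_inj eval_map_image by (simp add: bij_betw_def dual_group_def[of dual])
  ultimately show ?thesis by (simp add: iso_def)
qed

text \<open>Uniform convergence on compact subsets of the dual is compared with that on null balls:
  continuity holds because each compact set lies in a null ball, openness because null balls are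
  compact.\<close>

lemma eval_map_homeomorphic: "homeomorphic_map seq_top (bidual_topology G seq_top) eval_map"
proof (rule bijective_open_imp_homeomorphic_map)
  let ?B = "characters dual dual_top"
  have BT: "bidual_topology G seq_top = compact_open_topology dual_top torus_topology ?B"
    by (simp add: dual_topology_def[of dual])
  have B_cont: "continuous_map dual_top torus_topology f" if "f \<in> ?B" for f
    using that by (simp add: characters_def)
  have top: "topspace (bidual_topology G seq_top) = ?B" by (simp add: BT)
  show "eval_map ` topspace seq_top = topspace (bidual_topology G seq_top)"
    by (simp add: top eval_map_image)
  show "inj_on eval_map (topspace seq_top)" by (simp add: eval_map_inj)
  show "continuous_map seq_top (bidual_topology G seq_top) eval_map"
    unfolding continuous_map_def
  proof (intro conjI allI impI)
    show "eval_map \<in> topspace seq_top \<rightarrow> topspace (bidual_topology G seq_top)"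
      by (simp add: top eval_map_character)
    fix W assume "openin (bidual_topology G seq_top) W"
    then have W: "openin (compact_open_topology dual_top torus_topology ?B) W" by (simp only: BT)
    show "openin seq_top {x \<in> topspace seq_top. eval_map x \<in> W}"
      unfolding openin_seq_top
    proof (intro conjI ballI)
      fix x assume "x \<in> {x \<in> topspace seq_top. eval_map x \<in> W}"
      then have x: "x \<in> carrier G" "eval_map x \<in> W" by auto
      have "\<exists>Q r. compactin dual_top Q \<and> r > 0 \<and>
          (\<forall>f\<in>?B. (\<forall>\<xi>\<in>Q. cmod (f \<xi> - eval_map x \<xi>) < r) \<longrightarrow> f \<in> W)"
        by (rule compact_open_contains_uniform_nbhd[OF B_cont W x(2)])
      then obtain Q r where Q: "compactin dual_top Q" and r: "r > 0"
        and sub: "\<forall>f\<in>?B. (\<forall>\<xi>\<in>Q. cmod (f \<xi> - eval_map x \<xi>) < r) \<longrightarrow> f \<in> W"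
        by (elim exE conjE)
      obtain \<epsilon> where \<epsilon>: "\<epsilon> \<longlonglongrightarrow> 0" "Q \<subseteq> null_ball \<epsilon>"
        using compactin_dual_top_subset_null_ball[OF Q] by (elim exE conjE)
      have "polar_nbhd \<epsilon> r x \<subseteq> {x \<in> topspace seq_top. eval_map x \<in> W}"
      proof
        fix y assume y: "y \<in> polar_nbhd \<epsilon> r x"
        then have yG: "y \<in> carrier G" by (simp add: polar_nbhd_def)
        have "eval_map y \<in> W"
        proof (rule sub[rule_format, OF eval_map_character[OF yG]])
          fix \<xi> assume "\<xi> \<in> Q"
          then have \<xi>: "\<xi> \<in> null_ball \<epsilon>" using \<epsilon>(2) by blast
          then have "\<xi> \<in> null_chars" using null_ball_subset[OF \<epsilon>(1)] by blast
          moreover have "cmod (\<xi> y - \<xi> x) < r" using y \<xi> by (simp add: polar_nbhd_def)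
          ultimately show "cmod (eval_map y \<xi> - eval_map x \<xi>) < r" by (simp add: eval_map_apply)
        qed
        then show "y \<in> {x \<in> topspace seq_top. eval_map x \<in> W}" using yG by simp
      qed
      then show "\<exists>\<epsilon> r. \<epsilon> \<longlonglongrightarrow> 0 \<and> r > 0 \<and> polar_nbhd \<epsilon> r x \<subseteq> {x \<in> topspace seq_top. eval_map x \<in> W}"
        using \<epsilon>(1) r by (intro exI[of _ \<epsilon>] exI[of _ r] conjI)
    qed simp
  qed
  show "open_map seq_top (bidual_topology G seq_top) eval_map"
    unfolding open_map_def
  proof (intro allI impI)
    fix U assume U: "openin seq_top U"
    then have UG: "U \<subseteq> carrier G" using openin_subset by fastforce
    show "openin (bidual_topology G seq_top) (eval_map ` U)"
    proof (subst openin_subopen, intro ballI)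
      fix f assume "f \<in> eval_map ` U"
      then obtain x where x: "x \<in> U" "f = eval_map x" by (elim imageE)
      have xG: "x \<in> carrier G" using x(1) UG by blast
      have "\<exists>\<epsilon> r. \<epsilon> \<longlonglongrightarrow> 0 \<and> r > 0 \<and> polar_nbhd \<epsilon> r x \<subseteq> U"
        using U x(1) unfolding openin_seq_top by (elim conjE) (rule bspec)
      then obtain \<epsilon> r where er: "\<epsilon> \<longlonglongrightarrow> 0" "r > 0" "polar_nbhd \<epsilon> r x \<subseteq> U" by (elim exE conjE)
      have xB: "eval_map x \<in> ?B" by (rule eval_map_character[OF xG])
      obtain W where W: "openin (compact_open_topology dual_top torus_topology ?B) W" "eval_map x \<in> W"
        "\<forall>f\<in>W. \<forall>\<xi>\<in>null_ball \<epsilon>. cmod (f \<xi> - eval_map x \<xi>) < r"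
        using uniform_nbhd_contains_compact_open[OF xB B_cont[OF xB] compactin_null_ball[OF er(1)] er(2)]
        by (elim exE conjE)
      have "W \<subseteq> eval_map ` U"
      proof
        fix h assume h: "h \<in> W"
        have "h \<in> ?B" using openin_subset[OF W(1)] h by auto
        then obtain y where y: "y \<in> carrier G" "h = eval_map y" using eval_map_image by (metis imageE)
        have "y \<in> polar_nbhd \<epsilon> r x"
          unfolding polar_nbhd_def
        proof (intro CollectI conjI ballI y(1))
          fix \<xi> assume \<xi>: "\<xi> \<in> null_ball \<epsilon>"
          then have "\<xi> \<in> null_chars" using null_ball_subset[OF er(1)] by blast
          then show "cmod (\<xi> y - \<xi> x) < r"
            using bspec[OF bspec[OF W(3) h] \<xi>] by (simp add: y(2) eval_map_apply)
        qed
        then show "h \<in> eval_map ` U" using er(3) y(2) by blast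
      qed
      then show "\<exists>T. openin (bidual_topology G seq_top) T \<and> f \<in> T \<and> T \<subseteq> eval_map ` U"
        using W(1,2) x(2) unfolding BT by blast
    qed
  qed
qed

theorem seq_top_reflexive: "pontryagin_reflexive G seq_top"
  unfolding pontryagin_reflexive_def using eval_map_iso eval_map_homeomorphic by (rule conjI)

end

section \<open>Existence of interpolating sequences\<close>

context comm_group
begin

text \<open>One value is adjusted at a time, nearly preserving F and the earlier terms. The errors
  \<rho> are fixed before n and w, and their summability allows infinitely many adjustments to be
  composed.\<close>

definition step_interpolating :: "(nat \<Rightarrow> 'a) \<Rightarrow> bool" where
  "step_interpolating g \<longleftrightarrow> (\<forall>n. g n \<in> carrier G) \<and>
     (\<forall>F. finite F \<and> F \<subseteq> carrier G \<longrightarrow>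
       (\<exists>\<rho>. summable \<rho> \<and> (\<forall>n w. cmod w = 1 \<longrightarrow>
         (\<exists>\<beta>\<in>alg_chars G. (\<forall>x\<in>F \<union> g ` {..<n}. cmod (\<beta> x - 1) \<le> \<rho> n) \<and> cmod (\<beta> (g n) - w) \<le> \<rho> n))))"

text \<open>The values at the \<open>g n\<close> are corrected in turn. Later corrections disturb
  them, and the values on F, by at most a tail of the summable errors; N makes this tail smaller
  than \<delta>, and compactness supplies the final character.\<close>

lemma step_interpolating_limit:
  assumes g: "step_interpolating g" and F: "finite F" "F \<subseteq> carrier G" and \<delta>: "\<delta> > 0"
  shows "\<exists>N. interpolates_from g F \<delta> N"
proof -
  have gG: "g n \<in> carrier G" for n using g by (simp add: step_interpolating_def)
  obtain \<rho> where \<rho>: "summable \<rho>" and step: "\<forall>n w. cmod w = 1 \<longrightarrow>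
         (\<exists>\<beta>\<in>alg_chars G. (\<forall>x\<in>F \<union> g ` {..<n}. cmod (\<beta> x - 1) \<le> \<rho> n) \<and> cmod (\<beta> (g n) - w) \<le> \<rho> n)"
    using g[unfolded step_interpolating_def, THEN conjunct2, rule_format, OF conjI[OF F]]
    by (elim exE conjE)
  define pick where "pick n w = (SOME \<beta>. \<beta> \<in> alg_chars G \<and>
    (\<forall>x\<in>F \<union> g ` {..<n}. cmod (\<beta> x - 1) \<le> \<rho> n) \<and> cmod (\<beta> (g n) - w) \<le> \<rho> n)" for n w
  have pick: "pick n w \<in> alg_chars G \<and> (\<forall>x\<in>F \<union> g ` {..<n}. cmod (pick n w x - 1) \<le> \<rho> n) \<and>
    cmod (pick n w (g n) - w) \<le> \<rho> n" if "cmod w = 1" for n w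
    using step[rule_format, OF that, of n] unfolding pick_def Bex_def by (rule someI_ex)
  have \<rho>0: "\<rho> n \<ge> 0" for n using pick[of 1 n] norm_ge_zero order_trans by (metis norm_one)
  define s where "s n = sum \<rho> {..<n}" for n
  define R where "R n = suminf \<rho> - s n" for n
  have "s \<longlonglongrightarrow> suminf \<rho>" unfolding s_def by (rule summable_LIMSEQ[OF \<rho>])
  then have "(\<lambda>n. suminf \<rho> - s n) \<longlonglongrightarrow> suminf \<rho> - suminf \<rho>" by (intro tendsto_diff tendsto_const)
  then have R_lim: "R \<longlonglongrightarrow> 0" by (simp add: R_def[abs_def])
  have s_le: "s m \<le> suminf \<rho>" for m
    unfolding s_def by (rule sum_le_suminf[OF \<rho>]) (simp_all add: \<rho>0)
  have s_mono: "s k \<le> s m" if "k \<le> m" for k m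
    unfolding s_def using that \<rho>0 by (intro sum_mono2) auto
  have s_Suc: "s (Suc n) = s n + \<rho> n" for n by (simp add: s_def)
  have "eventually (\<lambda>n. R n < \<delta>) sequentially" by (rule order_tendstoD(2)[OF R_lim \<delta>])
  then obtain N where N: "R N < \<delta>" by (auto simp: eventually_sequentially)
  have "\<exists>\<beta>\<in>alg_chars G. (\<forall>x\<in>F. cmod (\<beta> x - 1) \<le> \<delta>) \<and>
      (\<forall>n. cmod (\<beta> (g n) - z n) \<le> \<delta>) \<and> (\<lambda>n. \<beta> (g n) - z n) \<longlonglongrightarrow> 0"
    if z1: "\<forall>n. cmod (z n) = 1" and zN: "\<forall>n<N. z n = 1" for z
  proof -
    \<comment> \<open>Stage n multiplies by a character whose value at \<open>g n\<close> is nearly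
      the quotient of the wanted value by the one reached so far; before N nothing is
      changed.\<close>
    define \<theta> where "\<theta> = rec_nat (char_one G)
      (\<lambda>n t. if n < N then t else char_mult G t (pick n (z n / t (g n))))"
    have \<theta>_Suc: "\<theta> (Suc n) = (if n < N then \<theta> n else char_mult G (\<theta> n) (pick n (z n / \<theta> n (g n))))" for n
      by (simp add: \<theta>_def)
    have \<theta>_alg: "\<theta> n \<in> alg_chars G" for n
    proof (induction n)
      case (Suc n)
      have "cmod (z n / \<theta> n (g n)) = 1" using z1 char_norm[OF Suc gG] by (simp add: norm_divide)
      then show ?case using pick[of "z n / \<theta> n (g n)" n] Suc by (simp add: \<theta>_Suc char_mult_closed)
    qed (simp add: \<theta>_def char_one_closed)
    have w: "cmod (z n / \<theta> n (g n)) = 1" for n using z1 char_norm[OF \<theta>_alg gG] by (simp add: norm_divide)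
    have \<theta>_early: "\<theta> n = char_one G" if "n \<le> N" for n
      using that by (induction n) (simp_all add: \<theta>_Suc, simp add: \<theta>_def)
    have \<theta>_step: "cmod (\<theta> (Suc n) x - \<theta> n x) \<le> \<rho> n" if x: "x \<in> F \<union> g ` {..<n}" for n x
    proof (cases "n < N")
      case True
      then show ?thesis using \<rho>0 by (simp add: \<theta>_Suc)
    next
      case False
      have xG: "x \<in> carrier G" using x F(2) gG by auto
      define \<beta> where "\<beta> = pick n (z n / \<theta> n (g n))"
      have "\<theta> (Suc n) x - \<theta> n x = \<theta> n x * (\<beta> x - 1)"
        using False xG by (simp add: \<theta>_Suc char_mult_apply \<beta>_def algebra_simps)
      moreover have "cmod (\<beta> x - 1) \<le> \<rho> n" using pick[OF w] x by (simp add: \<beta>_def)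
      ultimately show ?thesis using char_norm[OF \<theta>_alg xG] by (simp add: norm_mult)
    qed
    have \<theta>_new: "cmod (\<theta> (Suc n) (g n) - z n) \<le> \<rho> n" for n
    proof (cases "n < N")
      case True
      then show ?thesis using \<rho>0 zN \<theta>_early[of "Suc n"] by (simp add: char_one_apply[OF gG])
    next
      case False
      define \<beta> where "\<beta> = pick n (z n / \<theta> n (g n))"
      have "\<theta> (Suc n) (g n) - z n = \<theta> n (g n) * (\<beta> (g n) - z n / \<theta> n (g n))"
        using False char_neq_0[OF \<theta>_alg gG] by (simp add: \<theta>_Suc char_mult_apply[OF gG] \<beta>_def algebra_simps)
      moreover have "cmod (\<beta> (g n) - z n / \<theta> n (g n)) \<le> \<rho> n" using pick[OF w] by (simp add: \<beta>_def)
      ultimately show ?thesis using char_norm[OF \<theta>_alg gG] by (simp add: norm_mult)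
    qed
    have \<theta>_diff: "cmod (\<theta> m x - \<theta> k x) \<le> s m - s k" if "k \<le> m" "x \<in> F \<union> g ` {..<k}" for k m x
      using that(1)
    proof (induction m rule: dec_induct)
      case (step m)
      have "x \<in> F \<union> g ` {..<m}" using that(2) step.hyps by auto
      then have "cmod (\<theta> (Suc m) x - \<theta> m x) \<le> \<rho> m" by (rule \<theta>_step)
      then show ?case
        using norm_triangle_ineq[of "\<theta> (Suc m) x - \<theta> m x" "\<theta> m x - \<theta> k x"] step.IH by (simp add: s_Suc)
    qed simp
    have \<theta>_near_z: "cmod (\<theta> m (g n) - z n) \<le> R n" if "n < m" for m n
    proof -
      have "cmod (\<theta> m (g n) - \<theta> (Suc n) (g n)) \<le> s m - s (Suc n)" using that by (intro \<theta>_diff) auto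
      then show ?thesis
        using norm_triangle_ineq[of "\<theta> m (g n) - \<theta> (Suc n) (g n)" "\<theta> (Suc n) (g n) - z n"] \<theta>_new[of n] s_le[of m]
        by (simp add: R_def s_Suc)
    qed
    have \<theta>_near_1: "cmod (\<theta> m x - 1) \<le> \<delta>" if x: "x \<in> F \<union> g ` {..<N}" for m x
    proof -
      have xG: "x \<in> carrier G" using x F(2) gG by auto
      have "cmod (\<theta> m x - \<theta> N x) \<le> R N"
      proof (cases "N \<le> m")
        case True
        then show ?thesis using \<theta>_diff[OF True x] s_le[of m] by (simp add: R_def)
      next
        case False
        then show ?thesis using \<theta>_early[of m] \<theta>_early[of N] s_le[of N] by (simp add: R_def)
      qed
      then show ?thesis using \<theta>_early[of N] N xG by (simp add: char_one_apply)
    qed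
    have \<theta>_near_z': "cmod (\<theta> m (g n) - z n) \<le> \<delta>" if "n < m" for m n
    proof (cases "n < N")
      case True
      then show ?thesis using \<theta>_near_1[of "g n" m] zN by simp
    next
      case False
      then have "R n \<le> R N" using s_mono[of N n] by (simp add: R_def)
      then show ?thesis using \<theta>_near_z[OF that] N by simp
    qed
    \<comment> \<open>The estimates control the partial products only on F and along g, so \<beta>
      is obtained from closed conditions with the finite intersection property rather than as a
      limit.\<close>
    define T where "T n = {\<beta> :: 'a \<Rightarrow> complex. cmod (\<beta> (g n) - z n) \<le> min \<delta> (R n)} \<inter> (\<Inter>x\<in>F. {\<beta>. cmod (\<beta> x - 1) \<le> \<delta>})" for n
    have "alg_chars G \<inter> (\<Inter>n\<in>UNIV. T n) \<noteq> {}"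
    proof (rule compact_imp_fip_image[OF compact_alg_chars])
      show "closed (T n)" for n
        unfolding T_def by (intro closed_Int closed_INT ballI closed_Collect_le continuous_on_norm continuous_on_diff
            continuous_on_product_coordinates continuous_on_const)
      fix J :: "nat set" assume J: "finite J"
      define m where "m = Suc (Max (insert 0 J))"
      have "n < m" if "n \<in> J" for n using J that by (simp add: m_def le_imp_less_Suc)
      then have "\<theta> m \<in> T n" if "n \<in> J" for n
        using that \<theta>_near_z \<theta>_near_z' \<theta>_near_1 by (simp add: T_def)
      then show "alg_chars G \<inter> (\<Inter>n\<in>J. T n) \<noteq> {}" using \<theta>_alg by blast
    qed
    then obtain \<beta> where \<beta>: "\<beta> \<in> alg_chars G" "\<And>n. \<beta> \<in> T n" by blast
    have "(\<lambda>n. \<beta> (g n) - z n) \<longlonglongrightarrow> 0"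
      by (rule Lim_null_comparison[OF _ R_lim]) (use \<beta>(2) in \<open>simp add: T_def\<close>)
    moreover have "cmod (\<beta> (g n) - z n) \<le> \<delta>" for n using \<beta>(2)[of n] by (simp add: T_def)
    moreover have "cmod (\<beta> x - 1) \<le> \<delta>" if "x \<in> F" for x using \<beta>(2)[of 0] that by (simp add: T_def)
    ultimately show ?thesis using \<beta>(1) by blast
  qed
  then show ?thesis unfolding interpolates_from_def by (intro exI[of _ N]) simp
qed

text \<open>A homomorphism \<phi> to the reals with \<phi> e = 1 yields the characters
  \<open>cis (s * \<phi> x)\<close> for all real s. Choosing s so that the value at
  \<open>g n\<close> is exactly w makes s tiny, and points with much smaller \<phi> are hardly
  moved.\<close>

lemma step_interpolating_infinite_order:
  assumes e: "e \<in> carrier G" "\<And>m::nat. m > 0 \<Longrightarrow> e [^] m \<noteq> \<one>"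
  shows "\<exists>g. step_interpolating g"
proof -
  interpret R: comm_group real_group by (rule comm_group_real)
  interpret hom_extension G real_group by unfold_locales (rule divisible_real)
  have "1 [^]\<^bsub>real_group\<^esub> k = \<one>\<^bsub>real_group\<^esub>" if k: "e [^] k \<in> {\<one>}" for k :: int
  proof -
    have "k = 0" using int_pow_mem_imp_nat_pow_mem[OF triv_subgroup e(1) k] e(2) by auto
    then show ?thesis by simp
  qed
  then obtain \<phi> where \<phi>: "\<phi> \<in> hom G real_group" "\<phi> e = 1"
    using hom_trivial_on_subgroup[OF triv_subgroup e(1), of 1] by auto
  have \<phi>_mult: "\<phi> (x \<otimes> y) = \<phi> x + \<phi> y" if "x \<in> carrier G" "y \<in> carrier G" for x y
    using hom_mult[OF \<phi>(1) that] by simp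
  have \<phi>_one: "\<phi> \<one> = 0" using \<phi>_mult[of \<one> \<one>] by simp
  have \<phi>_pow: "\<phi> (e [^] n) = real n" for n :: nat
    by (induction n) (simp_all add: \<phi>_one \<phi>_mult e(1) \<phi>(2))
  \<comment> \<open>Since \<open>i\<^sup>2 + n \<le> n\<^sup>2\<close> for i < n, every earlier term
    is smaller than the n-th by a factor of at least \<open>2 ^ n\<close>, which makes the errors
    summable.\<close>
  define g where "g n = e [^] ((2::nat) ^ (n\<^sup>2))" for n
  have \<phi>g: "\<phi> (g n) = 2 ^ (n\<^sup>2)" for n by (simp add: g_def \<phi>_pow)
  have gG: "g n \<in> carrier G" for n using e(1) by (simp add: g_def)
  have "step_interpolating g"
    unfolding step_interpolating_def
  proof (intro conjI allI impI gG)
    fix F assume "finite F \<and> F \<subseteq> carrier G"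
    then have F: "finite F" "F \<subseteq> carrier G" by auto
    \<comment> \<open>C bounds \<phi> on F; the summand 1 lets the same errors serve the earlier
      terms of g.\<close>
    define C where "C = 1 + (\<Sum>x\<in>F. \<bar>\<phi> x\<bar>)"
    define \<rho> where "\<rho> n = pi * C * (1 / 2) ^ n" for n
    have C: "C \<ge> 1" by (simp add: C_def sum_nonneg)
    have "summable \<rho>" unfolding \<rho>_def by (intro summable_mult summable_geometric) simp
    moreover have "\<exists>\<beta>\<in>alg_chars G. (\<forall>x\<in>F \<union> g ` {..<n}. cmod (\<beta> x - 1) \<le> \<rho> n) \<and> cmod (\<beta> (g n) - w) \<le> \<rho> n"
      if w: "cmod w = 1" for n w
    proof -
      define t where "t = Arg w"
      have t: "\<bar>t\<bar> \<le> pi" "w = cis t"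
        using Arg_bounded[of w] rcis_cmod_Arg[of w] w by (auto simp: t_def rcis_def)
      define \<beta> where "\<beta> = (\<lambda>x\<in>carrier G. cis (t * \<phi> x / 2 ^ (n\<^sup>2)))"
      have "\<beta> \<in> alg_chars G"
        by (rule alg_charsI) (simp_all add: \<beta>_def \<phi>_mult cis_mult add_divide_distrib distrib_left)
      moreover have "cmod (\<beta> (g n) - w) \<le> \<rho> n"
        using C by (simp add: \<beta>_def gG \<phi>g t(2)[symmetric] \<rho>_def)
      moreover have "cmod (\<beta> x - 1) \<le> \<rho> n" if x: "x \<in> F \<union> g ` {..<n}" for x
      proof -
        have xG: "x \<in> carrier G" using x F(2) gG by auto
        have pos: "(0::real) < 2 ^ (n\<^sup>2)" by simp
        have "\<bar>\<phi> x\<bar> * 2 ^ n \<le> C * 2 ^ (n\<^sup>2)"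
        proof (cases "x \<in> F")
          case True
          have "\<bar>\<phi> x\<bar> \<le> C" using member_le_sum[OF True, of "\<lambda>x. \<bar>\<phi> x\<bar>"] F(1) by (simp add: C_def)
          moreover have "(2::real) ^ n \<le> 2 ^ (n\<^sup>2)" by (intro power_increasing) (simp_all add: power2_eq_square)
          ultimately show ?thesis using C by (intro mult_mono) auto
        next
          case False
          then obtain i where i: "i < n" "x = g i" using x by auto
          have "i\<^sup>2 + n \<le> n\<^sup>2"
          proof -
            have "i * i + n \<le> (n - 1) * (n - 1) + n" using i by (intro add_mono mult_mono) auto
            also have "\<dots> \<le> n * n" using i by (cases n) (auto simp: algebra_simps)
            finally show ?thesis by (simp add: power2_eq_square)
          qed
          then have "(2::real) ^ (i\<^sup>2 + n) \<le> 2 ^ (n\<^sup>2)" by (intro power_increasing) auto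
          then have "\<bar>\<phi> x\<bar> * 2 ^ n \<le> 1 * 2 ^ (n\<^sup>2)" by (simp add: i(2) \<phi>g power_add)
          also have "\<dots> \<le> C * 2 ^ (n\<^sup>2)" using C by (intro mult_right_mono) auto
          finally show ?thesis .
        qed
        then have "\<bar>\<phi> x\<bar> / 2 ^ (n\<^sup>2) \<le> C / 2 ^ n" using pos by (simp add: field_simps)
        then have "\<bar>t\<bar> * (\<bar>\<phi> x\<bar> / 2 ^ (n\<^sup>2)) \<le> pi * (C / 2 ^ n)"
          using t(1) by (intro mult_mono) auto
        moreover have "cmod (\<beta> x - 1) \<le> \<bar>t * \<phi> x / 2 ^ (n\<^sup>2)\<bar>"
          using cmod_cis_minus_one_le[of "t * \<phi> x / 2 ^ (n\<^sup>2)"] xG by (simp add: \<beta>_def)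
        moreover have "\<bar>t * \<phi> x / 2 ^ (n\<^sup>2)\<bar> = \<bar>t\<bar> * (\<bar>\<phi> x\<bar> / 2 ^ (n\<^sup>2))" by (simp add: abs_mult)
        moreover have "\<rho> n = pi * (C / 2 ^ n)" by (simp add: \<rho>_def power_one_over)
        ultimately show ?thesis by linarith
      qed
      ultimately show ?thesis by blast
    qed
    ultimately show "\<exists>\<rho>. summable \<rho> \<and> (\<forall>n w. cmod w = 1 \<longrightarrow>
         (\<exists>\<beta>\<in>alg_chars G. (\<forall>x\<in>F \<union> g ` {..<n}. cmod (\<beta> x - 1) \<le> \<rho> n) \<and> cmod (\<beta> (g n) - w) \<le> \<rho> n))"
      by (intro exI[of _ \<rho>]) simp
  qed
  then show ?thesis by blast
qed

text \<open>As G is commutative, the elements whose f-th power lies in K form a subgroup.\<close>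

lemma generate_pow_mem:
  assumes K: "subgroup K G" and B: "B \<subseteq> carrier G" and f: "\<And>x. x \<in> B \<Longrightarrow> x [^] (f::nat) \<in> K"
    and y: "y \<in> generate G B"
  shows "y [^] f \<in> K"
  using y
proof induction
  case one
  then show ?case using subgroup.one_closed[OF K] by simp
next
  case (incl h)
  then show ?case by (rule f)
next
  case (inv h)
  then have "h \<in> carrier G" using B by blast
  then have "inv h [^] f = inv (h [^] f)" by (rule nat_pow_inv)
  then show ?case using subgroup.m_inv_closed[OF K f[OF inv]] by simp
next
  case (eng h1 h2)
  then have "h1 \<in> carrier G" "h2 \<in> carrier G" using generate_in_carrier[OF B] by blast+
  then have "(h1 \<otimes> h2) [^] f = h1 [^] f \<otimes> h2 [^] f" by (rule nat_pow_distrib)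
  then show ?case using subgroup.m_closed[OF K eng.IH] by simp
qed

lemma torsion_common_exponent:
  assumes torsion: "\<And>x. x \<in> carrier G \<Longrightarrow> \<exists>m::nat. m > 0 \<and> x [^] m = \<one>"
    and B: "finite B" "B \<subseteq> carrier G"
  shows "\<exists>f::nat. f > 0 \<and> (\<forall>x\<in>B. x [^] f = \<one>)"
  using B
proof (induction B)
  case empty
  then show ?case by (intro exI[of _ 1]) simp
next
  case (insert y B)
  then obtain f :: nat where f: "f > 0" "\<And>x. x \<in> B \<Longrightarrow> x [^] f = \<one>" by auto
  obtain m :: nat where m: "m > 0" "y [^] m = \<one>" using torsion insert.prems by blast
  have "x [^] (m * f) = \<one>" if "x \<in> insert y B" for x
  proof (cases "x = y")
    case True
    then show ?thesis using m insert.prems nat_pow_pow[of y m f] by simp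
  next
    case False
    then have "x \<in> B" using that by simp
    then show ?thesis using f(2)[of x] insert.prems nat_pow_pow[of x f m] by (auto simp: mult.commute)
  qed
  then show ?case using f(1) m(1) by (intro exI[of _ "m * f"]) simp
qed

text \<open>Modulo the earlier terms, \<open>g n\<close> has order beyond \<open>2 ^ n\<close>.
  Modulo F as well, its order m still satisfies \<open>2 ^ n \<le> m * f\<close> for an exponent f
  of F. Characters trivial on F and the earlier terms can take any m-th root of unity at
  \<open>g n\<close>, and these roots are dense up to 2 pi / m.\<close>

lemma step_interpolating_torsion:
  assumes torsion: "\<And>x. x \<in> carrier G \<Longrightarrow> \<exists>m::nat. m > 0 \<and> x [^] m = \<one>"
    and unbounded: "\<And>m::nat. m > 0 \<Longrightarrow> \<exists>x\<in>carrier G. x [^] m \<noteq> \<one>"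
  shows "\<exists>g. step_interpolating g"
proof -
  have ex: "\<exists>x\<in>carrier G. \<forall>j::nat. 0 < j \<and> j \<le> M \<longrightarrow> x [^] j \<notin> generate G B"
    if B: "finite B" "B \<subseteq> carrier G" for B and M :: nat
  proof -
    obtain f :: nat where f: "f > 0" "\<forall>x\<in>B. x [^] f = \<one>"
      using torsion_common_exponent[OF torsion B] by blast
    \<comment> \<open>f annihilates \<open>generate G B\<close>, and \<open>fact M\<close> is a
      multiple of every j up to M, so no such power of x can lie in that subgroup.\<close>
    obtain x where x: "x \<in> carrier G" "x [^] (f * fact M) \<noteq> \<one>"
      using unbounded[of "f * fact M"] f(1) by auto
    have "x [^] j \<notin> generate G B" if j: "0 < j" "j \<le> M" for j :: nat
    proof
      assume "x [^] j \<in> generate G B"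
      then have "(x [^] j) [^] f \<in> {\<one>}"
        by (rule generate_pow_mem[OF triv_subgroup B(2), rotated]) (use f(2) in simp)
      then have jf: "x [^] (j * f) = \<one>" using x(1) by (simp add: nat_pow_pow)
      have "j dvd fact M" using j by (simp add: dvd_fact)
      then obtain q where "fact M = j * q" by (auto simp: dvd_def)
      then have "x [^] (f * fact M) = (x [^] (j * f)) [^] q" using x(1) by (simp add: nat_pow_pow mult_ac)
      then show False using x(2) jf by simp
    qed
    then show ?thesis using x(1) by blast
  qed
  \<comment> \<open>A state holds the set of the earlier terms and the term chosen at stage
    n.\<close>
  define P where "P n s \<longleftrightarrow> finite (fst s) \<and> fst s \<subseteq> carrier G \<and> (n = 0 \<longrightarrow> fst s = {}) \<and>
      snd s \<in> carrier G \<and> (\<forall>j::nat. 0 < j \<and> j \<le> 2 ^ n \<longrightarrow> snd s [^] j \<notin> generate G (fst s))"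
    for n :: nat and s :: "'a set \<times> 'a"
  have "\<exists>s. \<forall>n. P n (s n) \<and> fst (s (Suc n)) = insert (snd (s n)) (fst (s n))"
  proof (rule dependent_nat_choice)
    obtain x where "x \<in> carrier G" "\<forall>j::nat. 0 < j \<and> j \<le> 2 ^ 0 \<longrightarrow> x [^] j \<notin> generate G {}"
      using ex[of "{}" "2 ^ 0"] by auto
    then show "\<exists>s. P 0 s" unfolding P_def by (intro exI[of _ "({}, x)"]) simp
    fix s n assume s: "P n s"
    then have "finite (insert (snd s) (fst s))" "insert (snd s) (fst s) \<subseteq> carrier G" by (auto simp: P_def)
    from ex[OF this, of "2 ^ Suc n"] obtain x where "x \<in> carrier G"
      "\<forall>j::nat. 0 < j \<and> j \<le> 2 ^ Suc n \<longrightarrow> x [^] j \<notin> generate G (insert (snd s) (fst s))" by (elim bexE)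
    then show "\<exists>s'. P (Suc n) s' \<and> fst s' = insert (snd s) (fst s)"
      using s unfolding P_def by (intro exI[of _ "(insert (snd s) (fst s), x)"]) simp
  qed
  then obtain s where s: "\<forall>n. P n (s n) \<and> fst (s (Suc n)) = insert (snd (s n)) (fst (s n))" by (elim exE)
  define g where "g n = snd (s n)" for n
  have fst_s: "fst (s n) = g ` {..<n}" for n
  proof (induction n)
    case 0
    then show ?case using spec[OF s, of 0] by (simp add: P_def)
  next
    case (Suc n)
    then show ?case using spec[OF s, of n] by (simp add: g_def lessThan_Suc)
  qed
  have gG: "g n \<in> carrier G" for n using spec[OF s, of n] by (simp add: g_def P_def)
  have g_far: "g n [^] j \<notin> generate G (g ` {..<n})" if "0 < j" "j \<le> 2 ^ n" for n and j :: nat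
    using spec[OF s, of n] that unfolding P_def fst_s g_def[symmetric] by blast
  have "step_interpolating g"
    unfolding step_interpolating_def
  proof (intro conjI allI impI gG)
    fix F assume "finite F \<and> F \<subseteq> carrier G"
    then have F: "finite F" "F \<subseteq> carrier G" by auto
    obtain f :: nat where f: "f > 0" "\<forall>x\<in>F. x [^] f = \<one>"
      using torsion_common_exponent[OF torsion F] by blast
    define \<rho> where "\<rho> n = 2 * pi * f * (1 / 2) ^ n" for n
    have "summable \<rho>" unfolding \<rho>_def by (intro summable_mult summable_geometric) simp
    moreover have "\<exists>\<beta>\<in>alg_chars G. (\<forall>x\<in>F \<union> g ` {..<n}. cmod (\<beta> x - 1) \<le> \<rho> n) \<and> cmod (\<beta> (g n) - w) \<le> \<rho> n"
      if w: "cmod w = 1" for n w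
    proof -
      define B where "B = F \<union> g ` {..<n}"
      have BG: "B \<subseteq> carrier G" using F(2) gG by (auto simp: B_def)
      have E: "subgroup (generate G B) G" by (rule generate_is_subgroup[OF BG])
      have K: "subgroup (generate G (g ` {..<n})) G" by (rule generate_is_subgroup) (use gG in auto)
      have ex_m: "\<exists>m::nat. m > 0 \<and> g n [^] m \<in> generate G B"
        using torsion[OF gG, of n] subgroup.one_closed[OF E] by auto
      define m where "m = (LEAST m::nat. m > 0 \<and> g n [^] m \<in> generate G B)"
      have m: "m > 0" "g n [^] m \<in> generate G B" using LeastI_ex[OF ex_m] by (simp_all add: m_def)
      have least: "g n [^] j \<notin> generate G B" if "0 < j" "j < m" for j
        using not_less_Least[of j "\<lambda>m. m > 0 \<and> g n [^] m \<in> generate G B"] that by (auto simp: m_def)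
      \<comment> \<open>Raising to the power f removes the contribution of F, so
        \<open>m * f\<close> leads into the subgroup of the earlier terms and must exceed
        \<open>2 ^ n\<close>.\<close>
      have "(g n [^] m) [^] f \<in> generate G (g ` {..<n})"
      proof (rule generate_pow_mem[OF K BG _ m(2)])
        fix x assume "x \<in> B"
        then consider "x \<in> F" | "x \<in> g ` {..<n}" by (auto simp: B_def)
        then show "x [^] f \<in> generate G (g ` {..<n})"
        proof cases
          case 1
          then show ?thesis using f(2) subgroup.one_closed[OF K] by simp
        next
          case 2
          then have "x \<in> generate G (g ` {..<n})" by (rule generate.incl)
          then show ?thesis using subgroup_int_pow_closed[OF K, of x "int f"] by (simp add: int_pow_int)
        qed
      qed
      then have "g n [^] (m * f) \<in> generate G (g ` {..<n})" using gG by (simp add: nat_pow_pow)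
      then have "\<not> m * f \<le> 2 ^ n" using g_far[of "m * f" n] m(1) f(1) by auto
      then have "2 ^ n \<le> m * f" by simp
      then have "real (2 ^ n) \<le> real (m * f)" by (simp only: of_nat_le_iff)
      then have mf: "2 ^ n \<le> real m * real f" by simp
      define t where "t = Arg w"
      have t: "w = cis t" using rcis_cmod_Arg[of w] w by (simp add: t_def rcis_def)
      \<comment> \<open>The angle of w is rounded down to a multiple of 2 pi / m, the angle of an
        m-th root of unity.\<close>
      define k where "k = \<lfloor>t * m / (2 * pi)\<rfloor>"
      define a where "a = 2 * pi * real_of_int k / m"
      have ta: "\<bar>a - t\<bar> \<le> 2 * pi / m"
      proof -
        have "\<bar>real_of_int k - t * m / (2 * pi)\<bar> \<le> 1" unfolding k_def by linarith
        then have "2 * pi / m * \<bar>real_of_int k - t * m / (2 * pi)\<bar> \<le> 2 * pi / m * 1"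
          by (intro mult_left_mono) auto
        moreover have "2 * pi / m * \<bar>real_of_int k - t * m / (2 * pi)\<bar> = \<bar>2 * pi / m * (real_of_int k - t * m / (2 * pi))\<bar>"
          by (simp add: abs_mult)
        moreover have "2 * pi / m * (real_of_int k - t * m / (2 * pi)) = a - t"
          using m(1) by (simp add: a_def right_diff_distrib)
        ultimately show ?thesis by (simp only: mult_1_right)
      qed
      have "cis a ^ m = cis (2 * pi * real_of_int k)" using m(1) by (simp add: Complex.DeMoivre a_def)
      also have "\<dots> = 1" by (rule cis_multiple_2pi) simp
      finally have cis_pow: "cis a ^ m = 1" .
      have "\<exists>\<beta>\<in>alg_chars G. (\<forall>x\<in>generate G B. \<beta> x = 1) \<and> \<beta> (g n) = cis a"
        by (rule character_with_value[OF E gG norm_cis m least cis_pow])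
      then obtain \<beta> where \<beta>: "\<beta> \<in> alg_chars G" "\<forall>x\<in>generate G B. \<beta> x = 1" "\<beta> (g n) = cis a"
        by (elim bexE conjE)
      have \<rho>0: "\<rho> n \<ge> 0" by (simp add: \<rho>_def)
      have "cmod (\<beta> x - 1) \<le> \<rho> n" if "x \<in> F \<union> g ` {..<n}" for x
        using \<beta>(2) \<rho>0 generate.incl[of x B G] that by (simp add: B_def)
      moreover have "cmod (\<beta> (g n) - w) \<le> \<rho> n"
      proof -
        have "\<beta> (g n) - w = cis t * (cis (a - t) - 1)"
          by (simp add: \<beta>(3) t right_diff_distrib cis_mult)
        then have "cmod (\<beta> (g n) - w) \<le> \<bar>a - t\<bar>"
          using cmod_cis_minus_one_le[of "a - t"] by (simp add: norm_mult)
        also have "\<dots> \<le> 2 * pi / m" by (rule ta)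
        also have "\<dots> \<le> \<rho> n"
        proof -
          have "2 * pi * 2 ^ n \<le> 2 * pi * (real m * real f)" using mf by (intro mult_left_mono) auto
          then show ?thesis using m(1) by (simp add: \<rho>_def power_one_over field_simps)
        qed
        finally show ?thesis .
      qed
      ultimately show ?thesis using \<beta>(1) by blast
    qed
    ultimately show "\<exists>\<rho>. summable \<rho> \<and> (\<forall>n w. cmod w = 1 \<longrightarrow>
         (\<exists>\<beta>\<in>alg_chars G. (\<forall>x\<in>F \<union> g ` {..<n}. cmod (\<beta> x - 1) \<le> \<rho> n) \<and> cmod (\<beta> (g n) - w) \<le> \<rho> n))"
      by (intro exI[of _ \<rho>]) simp
  qed
  then show ?thesis by blast
qed

end

theorem theorem1:
  fixes G :: "('a, 'b) monoid_scheme"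
  assumes "comm_group G"
    and "infinite (carrier G)"
    and "group_exponent G = \<infinity>"
  shows "\<exists>T :: 'a topology. group_topology G T \<and> T \<noteq> discrete_topology (carrier G) \<and> pontryagin_reflexive G T"
proof -
  interpret comm_group G by (rule assms(1))
  have unbounded: "\<exists>x\<in>carrier G. x [^]\<^bsub>G\<^esub> m \<noteq> \<one>\<^bsub>G\<^esub>" if "m > 0" for m :: nat
  proof (rule ccontr)
    assume "\<not> ?thesis"
    then have "\<exists>n::nat. n \<ge> 1 \<and> (\<forall>g\<in>carrier G. g [^]\<^bsub>G\<^esub> n = \<one>\<^bsub>G\<^esub>)"
      using that by (intro exI[of _ m]) auto
    then show False using assms(3) by (simp add: group_exponent_def)
  qed
  \<comment> \<open>Infinite exponent leaves two cases: a torsion group without a common exponent,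
    or an element of infinite order.\<close>
  have "\<exists>g. step_interpolating g"
  proof (cases "\<forall>x\<in>carrier G. \<exists>m::nat. m > 0 \<and> x [^]\<^bsub>G\<^esub> m = \<one>\<^bsub>G\<^esub>")
    case True
    then show ?thesis using unbounded by (intro step_interpolating_torsion) blast+
  next
    case False
    then obtain e where e: "e \<in> carrier G" "\<forall>m::nat. m > 0 \<longrightarrow> e [^]\<^bsub>G\<^esub> m \<noteq> \<one>\<^bsub>G\<^esub>" by blast
    then show ?thesis by (intro step_interpolating_infinite_order[of e]) simp_all
  qed
  then obtain g where g: "step_interpolating g" by blast
  have "interpolating_sequence G g"
  proof unfold_locales
    show "g n \<in> carrier G" for n using g by (simp add: step_interpolating_def)
  qed (rule step_interpolating_limit[OF g])
  then interpret interpolating_sequence G g .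
  show ?thesis
    using group_topology_seq_top seq_top_not_discrete seq_top_reflexive by blast
qed

end
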